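(* Let $r\in\mathbb{N}$. Suppose that conditions (A1)–(A4) hold with $s=r+2$, and choose $q\in\mathbb{N}$ with $q>\frac{r+1}{2r_1}$. Then, for $f\in F^{q+2}_{0}$, $S_N$ admits the weak global Edgeworth expansion of order $r$: there are polynomials $P_{0,g},\dots,P_{r,g}$, independent of $f$, such that $$\mathbb{E}(f(S_N-NA))=\sum_{p=0}^r\frac{1}{N^{p/2}}\int P_{p,g}(z)\,\mathfrak{n}(z)\,f(z\sqrt{N})\,dz+\|f\|\,o\left(N^{-(r+1)/2}\right),$$ where $\|f\|=C^{q+2}_0(f)$ and the $o$-term does not depend on $f$.
   Context: Let $X_1,X_2,\dots$ be real random variables and $S_N=\sum_{n=1}^N X_n$. Assume there are a complex Banach space $\mathcal{B}$ with dual $\mathcal{B}'$, a family of bounded linear operators $\mathcal{L}_t:\mathcal{B}\to\mathcal{B}$ ($t\in\mathbb{R}$), and vectors $v\in\mathcal{B}$, $\ell\in\mathcal{B}'$ such that $\mathbb{E}(e^{itS_N})=\ell(\mathcal{L}_t^N v)$ for all $t\in\mathbb{R}$ and $N\geq1$. The conditions are: (A1) $t\mapsto\mathcal{L}_t$ is continuous and there exist $s\in\mathbb{N}$ and $\delta>0$ such that $t\mapsto\mathcal{L}_t$ is $s$ times continuously differentiable for $|t|\leq\delta$. (A2) $1$ is an isolated and simple eigenvalue of $\mathcal{L}_0$, all other eigenvalues of $\mathcal{L}_0$ have absolute value less than $1$, and the essential spectrum of $\mathcal{L}_0$ is contained in a disk of radius strictly less than $1$. (A3) For all $t\neq 0$,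 the spectrum of $\mathcal{L}_t$ is contained in $\{|z|<1\}$. (A4) There are positive real numbers $K,r_1,r_2,N_0$ such that $\|\mathcal{L}_t^N\|\leq N^{-r_2}$ for all $t$ with $K\leq|t|\leq N^{r_1}$ and all $N>N_0$. Under (A1)–(A3) with $s\geq3$ there are $A\in\mathbb{R}$ and $\sigma^2\geq0$ such that $(S_N-NA)/\sqrt{N}$ converges in distribution to $\mathcal{N}(0,\sigma^2)$; it is assumed that $\sigma^2>0$. $\mathfrak{n}(y)=\frac{1}{\sqrt{2\pi\sigma^2}}e^{-y^2/(2\sigma^2)}$. Function spaces: for $m,k\geq 0$ put $C^m(f)=\max_{0\leq j\leq m}\|f^{(j)}\|_{L^1}$, $C_k(f)=\max_{0\leq j\leq k}\|x^jf\|_{L^1}$, $C^m_k(f)=C^m(f)+C_k(f)$; $f\in F^m_k$ means $f$ is $m$ times continuously differentiable and $C^m_k(f)<\infty$. *)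

theory Defs
  imports "HOL-Analysis.Analysis" "HOL-Probability.Probability"
    "HOL-Computational_Algebra.Polynomial"
begin

text \<open>HOL has no class of complex vector spaces; a complex Banach space is a real
Banach space equipped with a compatible complex scalar multiplication.\<close>

class complex_banach = banach +
  fixes scaleC :: "complex \<Rightarrow> 'a \<Rightarrow> 'a"
  assumes scaleC_add_right: "scaleC a (x + y) = scaleC a x + scaleC a y"
    and scaleC_add_left: "scaleC (a + b) x = scaleC a x + scaleC b x"
    and scaleC_scaleC: "scaleC a (scaleC b x) = scaleC (a * b) x"
    and scaleC_one: "scaleC 1 x = x"
    and scaleR_scaleC: "scaleR r x = scaleC (complex_of_real r) x"
    and norm_scaleC: "norm (scaleC a x) = cmod a * norm x"

definition clinear_op :: "('b::complex_banach \<Rightarrow>\<^sub>L 'b) \<Rightarrow> bool" where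
  "clinear_op T \<longleftrightarrow> (\<forall>c x. blinfun_apply T (scaleC c x) = scaleC c (blinfun_apply T x))"

definition clinear_functional :: "('b::complex_banach \<Rightarrow>\<^sub>L complex) \<Rightarrow> bool" where
  "clinear_functional l \<longleftrightarrow> (\<forall>c x. blinfun_apply l (scaleC c x) = c * blinfun_apply l x)"

definition opow :: "('b::real_normed_vector \<Rightarrow>\<^sub>L 'b) \<Rightarrow> nat \<Rightarrow> ('b \<Rightarrow>\<^sub>L 'b)" where
  "opow T n = ((\<lambda>S. T o\<^sub>L S) ^^ n) id_blinfun"

definition shift_op :: "('b::complex_banach \<Rightarrow>\<^sub>L 'b) \<Rightarrow> complex \<Rightarrow> 'b \<Rightarrow> 'b" where
  "shift_op T z x = blinfun_apply T x - scaleC z x"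

definition op_spectrum :: "('b::complex_banach \<Rightarrow>\<^sub>L 'b) \<Rightarrow> complex set" where
  "op_spectrum T = {z. \<not> (\<exists>S::'b \<Rightarrow>\<^sub>L 'b. (\<forall>x. blinfun_apply S (shift_op T z x) = x)
                                         \<and> (\<forall>x. shift_op T z (blinfun_apply S x) = x))}"

definition op_eigenvalue :: "('b::complex_banach \<Rightarrow>\<^sub>L 'b) \<Rightarrow> complex \<Rightarrow> bool" where
  "op_eigenvalue T z \<longleftrightarrow> (\<exists>x. x \<noteq> 0 \<and> blinfun_apply T x = scaleC z x)"

definition isolated_in_spectrum :: "('b::complex_banach \<Rightarrow>\<^sub>L 'b) \<Rightarrow> complex \<Rightarrow> bool" where
  "isolated_in_spectrum T z \<longleftrightarrow> z \<in> op_spectrum T \<and> (\<exists>e>0. op_spectrum T \<inter> ball z e = {z})"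

text \<open>Simple eigenvalue: algebraic multiplicity one, i.e. the generalised eigenspace
\<open>\<Union>k. ker (T - z)^k\<close> is one-dimensional (over \<open>\<complex>\<close>).\<close>
definition simple_eigenvalue :: "('b::complex_banach \<Rightarrow>\<^sub>L 'b) \<Rightarrow> complex \<Rightarrow> bool" where
  "simple_eigenvalue T z \<longleftrightarrow>
     (\<exists>v. v \<noteq> 0 \<and> {x. \<exists>k. (shift_op T z ^^ k) x = 0} = range (\<lambda>c. scaleC c v))"

text \<open>Fredholm operator: finite-dimensional kernel, closed range of finite codimension.
(Finite dimension over \<open>\<real>\<close> and over \<open>\<complex>\<close> coincide.)\<close>
definition fredholm :: "('b::real_normed_vector \<Rightarrow> 'b) \<Rightarrow> bool" where
  "fredholm A \<longleftrightarrow> (\<exists>F. finite F \<and> {x. A x = 0} \<subseteq> span F)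
                  \<and> closed (range A)
                  \<and> (\<exists>G. finite G \<and> range A + span G = UNIV)"

definition ess_spectrum :: "('b::complex_banach \<Rightarrow>\<^sub>L 'b) \<Rightarrow> complex set" where
  "ess_spectrum T = {z. \<not> fredholm (shift_op T z)}"

definition Ck_on :: "nat \<Rightarrow> real set \<Rightarrow> (real \<Rightarrow> 'a::real_normed_vector) \<Rightarrow> bool" where
  "Ck_on s S L \<longleftrightarrow> (\<exists>D :: nat \<Rightarrow> real \<Rightarrow> 'a. D 0 = L
      \<and> (\<forall>j<s. \<forall>t\<in>S. (D j has_vector_derivative D (Suc j) t) (at t within S))
      \<and> continuous_on S (D s))"

definition Cup :: "nat \<Rightarrow> (real \<Rightarrow> real) \<Rightarrow> real" where
  "Cup m f = Max {(LINT x|lborel. \<bar>(deriv ^^ j) f x\<bar>) | j. j \<le> m}"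

definition Clow :: "nat \<Rightarrow> (real \<Rightarrow> real) \<Rightarrow> real" where
  "Clow k f = Max {(LINT x|lborel. \<bar>x ^ j * f x\<bar>) | j. j \<le> k}"

definition Cupk :: "nat \<Rightarrow> nat \<Rightarrow> (real \<Rightarrow> real) \<Rightarrow> real" where
  "Cupk m k f = Cup m f + Clow k f"

text \<open>\<open>f \<in> F^m_k\<close>: \<open>m\<close> times continuously differentiable and \<open>C^m_k(f) < \<infinity>\<close>
(i.e. all the relevant functions are Lebesgue integrable).\<close>
definition Fspace :: "nat \<Rightarrow> nat \<Rightarrow> (real \<Rightarrow> real) set" where
  "Fspace m k = {f. (\<forall>j<m. \<forall>x. ((deriv ^^ j) f has_real_derivative (deriv ^^ Suc j) f x) (at x))
                  \<and> continuous_on UNIV ((deriv ^^ m) f)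
                  \<and> (\<forall>j\<le>m. integrable lborel ((deriv ^^ j) f))
                  \<and> (\<forall>j\<le>k. integrable lborel (\<lambda>x. x ^ j * f x))}"

end

theory Submission
  imports Defs
begin

text \<open>
  The operators \<open>L t\<close> with \<open>t \<noteq> 0\<close> have no spectrum on or outside the unit circle and converge to \<open>L 0\<close>,
  so \<open>L 0 - z\<close> with \<open>|z| \<ge> 1\<close>, \<open>z \<noteq> 1\<close> is a limit of invertible operators; being Fredholm and injective it is
  bounded below, hence invertible. Together with the simple isolated eigenvalue \<open>1\<close> this gives a splitting
  \<open>span v0 \<oplus> range (L 0 - 1)\<close> whose second part has spectral radius below \<open>1\<close>. The eigenvector of \<open>L t\<close> near \<open>v0\<close>
  is the fixed point of a contraction, and finite Taylor expansions of \<open>L t\<close> at \<open>0\<close> bootstrap through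
  that equation. So \<open>E exp (i t S_N) = \<mu>(t)^N Z(t) + O(\<kappa>^N)\<close> near \<open>t = 0\<close>, and no contour integral is needed.

  The central limit theorem forces \<open>ln \<mu>(t) = i A t - \<sigma>\<^sup>2 t\<^sup>2 / 2 + t\<^sup>2 k(t)\<close> with \<open>k(0) = 0\<close>; expanding
  \<open>exp (s\<^sup>2 k(s / sqrt N)) Z(s / sqrt N)\<close> in powers of \<open>1 / sqrt N\<close> produces polynomials in \<open>s\<close>, which times the
  Gaussian are Fourier transforms of the sought polynomials times \<open>n\<close>. By Fourier inversion the error is an integral of the
  transform of \<open>f\<close>, bounded by \<open>\<parallel>f\<parallel>\<close> and by \<open>\<parallel>f\<parallel> / |t|^(q + 2)\<close>, against the difference of
  characteristic functions: this difference is handled by the expansion for small \<open>t\<close>, by compactness and (A3)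
  for bounded \<open>t\<close>, by (A4) with \<open>N\<close> cut into finitely many equal pieces up to \<open>|t| \<approx> N^r1\<close>, and beyond by the decay
  of the transform, since \<open>r1 q > (r + 1) / 2\<close>.
\<close>

text \<open>Finite smoothness rules out analytic perturbation theory, so everything near the origin
  is a Peano expansion at the single point \<open>0\<close>, and orders have to be counted. Of the r
  + 2 orders of \<open>L\<close>, two are consumed by \<open>\<i> A t\<close> and
  \<open>\<sigma>\<^sup>2 t\<^sup>2 / 2\<close>, which leaves \<open>k\<close> with order r. With t
  = s / sqrt N the error of the expanded characteristic function is o(N^(-r/2)) times an integrable
  function of s, and the change of variable in dt supplies the missing factor N^(-1/2). The other
  obstacle is that spectra alone give no bound on \<open>L t ^ N\<close> that is uniform in t.
  Everything is therefore reduced to one fixed power having norm at most 1/2, which survives small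
  perturbations of the operator; the passage from the spectrum to such a power averages resolvents
  over roots of unity. The same concern shapes the splitting: it is encoded by a functional
  \<open>\<phi>\<close> and an operator \<open>Q\<close> with \<open>Q ^ n\<close> tending to 0, and
  near \<open>0\<close> only the eigenvector is perturbed while \<open>\<phi>\<close> is
  kept.\<close>

subsection \<open>Neumann series and powers in Banach algebras\<close>

text \<open>\<open>norm 1 = 1\<close> cannot be assumed, since the operators on the zero space
  satisfy \<open>1 = 0\<close>; hence the constant \<open>norm 1\<close> in bounds on
  powers.\<close>

lemma norm_power_le_algebra:
  fixes x :: "'a::{real_normed_algebra, monoid_mult}"
  shows "norm (x ^ n) \<le> norm (1::'a) * norm x ^ n"
proof (induction n)
  case (Suc n)
  have "norm (x ^ Suc n) \<le> norm x * norm (x ^ n)" by (simp add: norm_mult_ineq)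
  also have "\<dots> \<le> norm x * (norm (1::'a) * norm x ^ n)" by (intro mult_left_mono Suc) auto
  finally show ?case by (simp add: algebra_simps)
qed simp

lemma neumann_inverse:
  fixes x :: "'a::{real_normed_algebra, banach, monoid_mult}"
  assumes "norm x < 1"
  obtains y where "(1 - x) * y = 1" "y * (1 - x) = 1"
proof -
  have s: "summable (\<lambda>n. x ^ n)"
  proof (rule summable_comparison_test)
    show "\<exists>N. \<forall>n\<ge>N. norm (x ^ n) \<le> norm (1::'a) * norm x ^ n"
      using norm_power_le_algebra by blast
    show "summable (\<lambda>n. norm (1::'a) * norm x ^ n)"
      using assms by (intro summable_mult summable_geometric) simp
  qed
  let ?y = "\<Sum>n. x ^ n"
  have h: "?y = 1 + (\<Sum>n. x ^ Suc n)" using suminf_split_head[OF s] by simp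
  have 1: "x * ?y = (\<Sum>n. x ^ Suc n)" using suminf_mult[OF s, of x] by simp
  have 2: "?y * x = (\<Sum>n. x ^ Suc n)" using suminf_mult2[OF s, of x] by (simp add: power_commutes)
  show thesis
    by (rule that[of ?y]) (use h 1 2 in \<open>simp_all add: algebra_simps\<close>)
qed

text \<open>\<open>a' = a * (1 - x)\<close> with \<open>x = b * (a - a')\<close>, so a Neumann
  inverse \<open>y\<close> of \<open>1 - x\<close> gives the inverse \<open>y * b\<close>. Both
  bounds come from the identity \<open>y * b = b + x * (y * b)\<close>, without estimating the
  series.\<close>

lemma inverse_perturbation:
  fixes a b a' :: "'a::{real_normed_algebra, banach, monoid_mult}"
  assumes ab: "a * b = 1" and ba: "b * a = 1" and small: "norm (a' - a) * norm b \<le> 1/2"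
  obtains b' where "a' * b' = 1" "b' * a' = 1" "norm b' \<le> 2 * norm b"
    "norm (b' - b) \<le> 2 * norm b ^ 2 * norm (a' - a)"
proof -
  define x where "x = b * (a - a')"
  have nx: "norm x \<le> 1/2"
    using norm_mult_ineq[of b "a - a'"] small by (simp add: x_def norm_minus_commute mult.commute)
  then have "norm x < 1" by simp
  then obtain y where y: "(1 - x) * y = 1" "y * (1 - x) = 1" by (rule neumann_inverse)
  have a': "a * (1 - x) = a'"
    by (simp add: x_def algebra_simps ab flip: mult.assoc)
  have r: "a' * (y * b) = 1"
    by (metis a' ab mult.assoc mult.right_neutral y(1))
  have l: "(y * b) * a' = 1"
    by (metis a' ba mult.assoc mult.left_neutral y(2))
  have eq: "y * b = b + x * (y * b)"
    using arg_cong[OF y(1), of "\<lambda>t. t * b"] by (simp add: algebra_simps)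
  have n1: "norm (y * b) \<le> 2 * norm b"
  proof -
    have "norm (y * b) \<le> norm b + norm (x * (y * b))" using eq norm_triangle_ineq by metis
    also have "norm (x * (y * b)) \<le> 1/2 * norm (y * b)"
      by (rule order_trans[OF norm_mult_ineq]) (intro mult_right_mono nx norm_ge_zero)
    finally show ?thesis by simp
  qed
  have "y * b - b = b * ((a - a') * (y * b))" using eq by (simp add: x_def algebra_simps)
  then have "norm (y * b - b) \<le> norm b * norm ((a - a') * (y * b))" by (simp add: norm_mult_ineq)
  also have "\<dots> \<le> norm b * (norm (a - a') * norm (y * b))"
    by (intro mult_left_mono norm_mult_ineq norm_ge_zero)
  also have "\<dots> \<le> norm b * (norm (a - a') * (2 * norm b))"
    by (intro mult_left_mono n1 norm_ge_zero)
  finally have "norm (y * b - b) \<le> 2 * norm b ^ 2 * norm (a' - a)"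
    by (simp add: power2_eq_square norm_minus_commute algebra_simps)
  with r l n1 show thesis using that by blast
qed

lemma two_sided_inverse_unique:
  fixes a :: "'a::monoid_mult"
  assumes "b * a = 1" "a * c = 1"
  shows "b = c"
  by (metis assms mult.assoc mult.left_neutral mult.right_neutral)

text \<open>A one-sided inverse \<open>f t\<close> is enough: near the limit \<open>g t\<close> has
  a two-sided inverse, and that must be \<open>f t\<close>.\<close>

lemma tendsto_algebra_inverse:
  fixes g f :: "'t \<Rightarrow> 'a::{real_normed_algebra, banach, monoid_mult}"
  assumes lim: "(g \<longlongrightarrow> a) F" and ab: "a * b = 1" "b * a = 1"
    and inv: "\<forall>\<^sub>F t in F. g t * f t = 1"
  shows "(f \<longlongrightarrow> b) F"
proof -
  have z: "((\<lambda>t. norm (g t - a)) \<longlongrightarrow> 0) F"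
    using lim by (simp add: LIM_zero tendsto_norm_zero)
  have z2: "((\<lambda>t. norm (g t - a) * norm b) \<longlongrightarrow> 0) F"
    using tendsto_mult_right[OF z, of "norm b"] by simp
  have "\<forall>\<^sub>F t in F. norm (g t - a) * norm b < 1/2"
    by (rule order_tendstoD(2)[OF z2]) simp
  then have ev: "\<forall>\<^sub>F t in F. norm (f t - b) \<le> 2 * norm b ^ 2 * norm (g t - a)"
    using inv
  proof eventually_elim
    case (elim t)
    from elim(1) have "norm (g t - a) * norm b \<le> 1/2" by simp
    from inverse_perturbation[OF ab this] obtain b' where
      b': "g t * b' = 1" "b' * g t = 1" "norm (b' - b) \<le> 2 * norm b ^ 2 * norm (g t - a)" by blast
    have "b' = f t" using b' elim(2) two_sided_inverse_unique by blast
    with b' show ?case by simp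
  qed
  have "((\<lambda>t. 2 * norm b ^ 2 * norm (g t - a)) \<longlongrightarrow> 0) F"
    using tendsto_mult_left[OF z] by force
  with ev have "((\<lambda>t. f t - b) \<longlongrightarrow> 0) F" by (rule Lim_null_comparison)
  then show ?thesis by (simp add: LIM_zero_iff)
qed

text \<open>Since \<open>x = (g - 1) - (g - 1) * x\<close>, the norm of \<open>x\<close> is at most
  1/2 plus half of itself. This converts closeness of an averaged resolvent to 1 into a bound on a
  power of the operator.\<close>

lemma norm_le_one_of_near_inverse:
  fixes g x :: "'a::{real_normed_algebra, monoid_mult}"
  assumes "g * (1 - x) = 1" "norm (g - 1) \<le> 1/2"
  shows "norm x \<le> 1"
proof -
  have "x = (g - 1) + - ((g - 1) * x)" using assms(1) by (simp add: algebra_simps)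
  then have "norm x \<le> norm (g - 1) + norm ((g - 1) * x)" by (metis norm_minus_cancel norm_triangle_ineq)
  also have "norm ((g - 1) * x) \<le> 1/2 * norm x"
    by (rule order_trans[OF norm_mult_ineq]) (intro mult_right_mono assms norm_ge_zero)
  finally show ?thesis using assms(2) by simp
qed

text \<open>Uniformity over the set \<open>T\<close> rests on one exponent \<open>n\<close> common
  to its elements: \<open>N\<close> is divided by \<open>n\<close> with remainder, the quotient
  contributes halvings, and the remainder costs at most \<open>n\<close> factors of size
  \<open>B'\<close>.\<close>

lemma uniform_power_decay:
  fixes T :: "'a::{real_normed_algebra, monoid_mult} set"
  assumes n: "n \<ge> 1" and half: "\<And>x. x \<in> T \<Longrightarrow> norm (x ^ n) \<le> 1/2" and bd: "\<And>x. x \<in> T \<Longrightarrow> norm x \<le> B"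
  shows "\<exists>C \<kappa>. 0 < C \<and> 0 < \<kappa> \<and> \<kappa> < 1 \<and> (\<forall>x\<in>T. \<forall>N. norm (x ^ N) \<le> C * \<kappa> ^ N)"
proof -
  define B' where "B' = max B 1"
  \<comment> \<open>The final factor 2 makes up for the incomplete block:
    \<open>\<kappa> ^ (N mod n)\<close> is at least \<open>\<kappa> ^ n = 1/2\<close>.\<close>
  define C where "C = (norm (1::'a) + 1) * B' ^ n * 2"
  define \<kappa> where "\<kappa> = root n (1/2)"
  have k: "0 < \<kappa>" "\<kappa> < 1" "\<kappa> ^ n = 1/2" using n by (auto simp: \<kappa>_def)
  have B': "B' \<ge> 1" by (simp add: B'_def)
  have C: "C > 0" using B' by (simp add: C_def add_nonneg_pos)
  have "norm (x ^ N) \<le> C * \<kappa> ^ N" if x: "x \<in> T" for x N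
  proof -
    have 1: "norm (x ^ (N mod n)) \<le> (norm (1::'a) + 1) * B' ^ n"
    proof -
      have "norm (x ^ (N mod n)) \<le> norm (1::'a) * norm x ^ (N mod n)" by (rule norm_power_le_algebra)
      also have "\<dots> \<le> (norm (1::'a) + 1) * B' ^ (N mod n)"
        using bd[OF x] by (intro mult_mono power_mono) (auto simp: B'_def)
      also have "\<dots> \<le> (norm (1::'a) + 1) * B' ^ n"
        using B' n by (intro mult_left_mono power_increasing) (auto simp: less_imp_le)
      finally show ?thesis .
    qed
    have q: "norm (x ^ (N mod n) * (x ^ n) ^ m) \<le> (norm (1::'a) + 1) * B' ^ n * (1/2) ^ m" for m
    proof (induction m)
      case 0 then show ?case using 1 by simp
    next
      case (Suc m)
      have "norm (x ^ (N mod n) * (x ^ n) ^ Suc m) \<le> norm (x ^ (N mod n) * (x ^ n) ^ m) * norm (x ^ n)"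
        using norm_mult_ineq[of "x ^ (N mod n) * (x ^ n) ^ m" "x ^ n"] by (simp only: power_Suc2 mult.assoc)
      also have "\<dots> \<le> ((norm (1::'a) + 1) * B' ^ n * (1/2) ^ m) * (1/2)"
        using B' by (intro mult_mono Suc half x) auto
      finally show ?case by (simp add: algebra_simps)
    qed
    have "x ^ N = x ^ (N mod n) * (x ^ n) ^ (N div n)"
      by (metis mod_mult_div_eq power_add power_mult)
    then have "norm (x ^ N) \<le> (norm (1::'a) + 1) * B' ^ n * (1/2) ^ (N div n)" using q by metis
    also have "\<dots> = (norm (1::'a) + 1) * B' ^ n * \<kappa> ^ (n * (N div n))" by (simp add: power_mult k(3))
    also have "\<dots> \<le> (norm (1::'a) + 1) * B' ^ n * (2 * \<kappa> ^ N)"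
    proof -
      have "\<kappa> ^ n \<le> \<kappa> ^ (N mod n)" using k n by (intro power_decreasing) (auto simp: less_imp_le)
      then have "1 \<le> 2 * \<kappa> ^ (N mod n)" using k(3) by simp
      then have "\<kappa> ^ (n * (N div n)) * 1 \<le> \<kappa> ^ (n * (N div n)) * (2 * \<kappa> ^ (N mod n))"
        using k by (intro mult_left_mono) auto
      also have "\<dots> = 2 * \<kappa> ^ N" by (simp flip: power_add)
      finally show ?thesis using B' by (intro mult_left_mono) auto
    qed
    finally show ?thesis by (simp add: C_def)
  qed
  with C k show ?thesis by blast
qed

text \<open>A separate type, since \<open>'b \<Rightarrow>\<^sub>L 'b\<close> cannot be made an instance of the ring classes. All bounded
  real-linear operators are admitted; the complex scalars embed as the operators \<open>cs c\<close> below.\<close>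

typedef (overloaded) 'b endo = "UNIV :: ('b::banach \<Rightarrow>\<^sub>L 'b) set" by simp

setup_lifting type_definition_endo

instantiation endo :: (banach) "{ring, monoid_mult}"
begin
lift_definition zero_endo :: "'a endo" is 0 .
lift_definition one_endo :: "'a endo" is id_blinfun .
lift_definition plus_endo :: "'a endo \<Rightarrow> 'a endo \<Rightarrow> 'a endo" is "(+)" .
lift_definition minus_endo :: "'a endo \<Rightarrow> 'a endo \<Rightarrow> 'a endo" is "(-)" .
lift_definition uminus_endo :: "'a endo \<Rightarrow> 'a endo" is uminus .
lift_definition times_endo :: "'a endo \<Rightarrow> 'a endo \<Rightarrow> 'a endo" is "(o\<^sub>L)" .
instance
  by standard (transfer, auto intro!: blinfun_eqI simp: blinfun.bilinear_simps)+
end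

instantiation endo :: (banach) real_normed_algebra
begin
lift_definition scaleR_endo :: "real \<Rightarrow> 'a endo \<Rightarrow> 'a endo" is scaleR .
lift_definition norm_endo :: "'a endo \<Rightarrow> real" is norm .
definition dist_endo :: "'a endo \<Rightarrow> 'a endo \<Rightarrow> real" where "dist_endo a b = norm (a - b)"
definition [code del]: "(uniformity :: ('a endo \<times> 'a endo) filter) = (INF e\<in>{0<..}. principal {(x, y). dist x y < e})"
definition open_endo :: "'a endo set \<Rightarrow> bool"
  where [code del]: "open_endo S = (\<forall>x\<in>S. \<forall>\<^sub>F (x', y) in uniformity. x' = x \<longrightarrow> y \<in> S)"
definition sgn_endo :: "'a endo \<Rightarrow> 'a endo" where "sgn_endo x = scaleR (inverse (norm x)) x"
instance
  apply standard
  unfolding dist_endo_def open_endo_def sgn_endo_def uniformity_endo_def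
  apply (rule refl | (transfer, force intro!: blinfun_eqI norm_triangle_ineq norm_blinfun_compose simp: blinfun.bilinear_simps scaleR_add_right scaleR_add_left))+
  done
end

lemma dist_Rep_endo: "dist (Rep_endo x) (Rep_endo y) = dist x y"
  unfolding dist_endo_def dist_norm by transfer simp

instance endo :: (banach) banach
proof
  fix X :: "nat \<Rightarrow> 'a endo"
  assume "Cauchy X"
  then have "Cauchy (\<lambda>n. Rep_endo (X n))" by (simp add: Cauchy_def dist_Rep_endo)
  then obtain L where "(\<lambda>n. Rep_endo (X n)) \<longlonglongrightarrow> L" by (auto simp: Cauchy_convergent_iff convergent_def)
  then have "X \<longlonglongrightarrow> Abs_endo L"
    by (simp add: lim_sequentially Abs_endo_inverse flip: dist_Rep_endo)
  then show "convergent X" by (auto simp: convergent_def)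
qed

subsection \<open>The algebra of bounded operators and the spectral radius\<close>

lemma bounded_linear_scaleC: "bounded_linear (scaleC c :: 'b::complex_banach \<Rightarrow> 'b)"
  by (rule bounded_linear_intro[where K="cmod c"])
     (simp_all add: scaleC_add_right scaleR_scaleC scaleC_scaleC norm_scaleC mult.commute)

lemma scaleC_zero_left [simp]: "scaleC 0 x = (0::'b::complex_banach)"
  using norm_scaleC[of 0 x] by simp

lemma bounded_bilinear_scaleC: "bounded_bilinear (scaleC :: complex \<Rightarrow> 'b::complex_banach \<Rightarrow> 'b)"
proof
  fix r :: real and a b c :: complex and x y :: 'b
  show "scaleC (a + b) x = scaleC a x + scaleC b x" by (rule scaleC_add_left)
  show "scaleC a (x + y) = scaleC a x + scaleC a y" by (rule scaleC_add_right)
  show "scaleC (r *\<^sub>R a) x = r *\<^sub>R scaleC a x"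
    by (simp add: scaleR_scaleC scaleC_scaleC scaleR_conv_of_real)
  show "scaleC a (r *\<^sub>R x) = r *\<^sub>R scaleC a x"
    by (simp add: scaleR_scaleC scaleC_scaleC mult.commute)
  show "\<exists>K. \<forall>(a::complex) (b::'b). norm (scaleC a b) \<le> norm a * norm b * K"
    by (rule exI[of _ 1]) (simp add: norm_scaleC)
qed

interpretation scaleC: bounded_bilinear "scaleC :: complex \<Rightarrow> 'b::complex_banach \<Rightarrow> 'b"
  by (rule bounded_bilinear_scaleC)

declare scaleC_one [simp] scaleC_scaleC [simp]

definition app :: "'b::banach endo \<Rightarrow> 'b \<Rightarrow> 'b" where "app a = blinfun_apply (Rep_endo a)"

lemma bounded_linear_app: "bounded_linear (app a)"
  by (simp add: app_def blinfun.bounded_linear_right)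

lemma bounded_bilinear_app: "bounded_bilinear (app :: 'b::banach endo \<Rightarrow> 'b \<Rightarrow> 'b)"
proof
  fix r :: real and a b :: "'b endo" and x y :: 'b
  show "app (a + b) x = app a x + app b x"
    by (simp add: app_def plus_endo.rep_eq blinfun.bilinear_simps)
  show "app a (x + y) = app a x + app a y"
    by (simp add: app_def blinfun.bilinear_simps)
  show "app (r *\<^sub>R a) x = r *\<^sub>R app a x"
    by (simp add: app_def scaleR_endo.rep_eq blinfun.bilinear_simps)
  show "app a (r *\<^sub>R x) = r *\<^sub>R app a x"
    by (simp add: app_def blinfun.bilinear_simps)
  show "\<exists>K. \<forall>(a::'b endo) (b::'b). norm (app a b) \<le> norm a * norm b * K"
    by (rule exI[of _ 1]) (simp add: app_def norm_endo.rep_eq norm_blinfun)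
qed

interpretation app: bounded_bilinear "app :: 'b::banach endo \<Rightarrow> 'b \<Rightarrow> 'b"
  by (rule bounded_bilinear_app)

lemma norm_app: "norm (app a x) \<le> norm a * norm x"
  by (simp add: app_def norm_endo.rep_eq norm_blinfun)

lemma app_mult [simp]: "app (a * b) x = app a (app b x)"
  by (simp add: app_def times_endo.rep_eq)

lemma app_one [simp]: "app 1 x = x"
  by (simp add: app_def one_endo.rep_eq)

lemma endo_eqI: "(\<And>x. app a x = app b x) \<Longrightarrow> a = b"
  unfolding app_def by (metis Rep_endo_inject blinfun_eqI)

lemma app_Abs_endo [simp]: "app (Abs_endo T) = blinfun_apply T"
  by (simp add: app_def Abs_endo_inverse)

lemma norm_Abs_endo [simp]: "norm (Abs_endo T) = norm T"
  by (simp add: norm_endo.rep_eq Abs_endo_inverse)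

lemma Abs_endo_opow: "Abs_endo (opow T n) = Abs_endo T ^ n"
proof (induction n)
  case 0 show ?case by (simp add: opow_def one_endo.abs_eq)
next
  case (Suc n)
  have "opow T (Suc n) = T o\<^sub>L opow T n" by (simp add: opow_def)
  then show ?case by (simp add: Suc[symmetric] times_endo.abs_eq)
qed

lemma endo_of_bounded_linear:
  assumes "bounded_linear f"
  obtains a where "app a = f"
  by (rule that[of "Abs_endo (Blinfun f)"]) (simp add: bounded_linear_Blinfun_apply assms)

lift_definition cs :: "complex \<Rightarrow> 'b::complex_banach endo" is "\<lambda>c. Blinfun (scaleC c)" .

lemma app_cs [simp]: "app (cs c) x = scaleC c x"
  by (simp add: app_def cs.rep_eq bounded_linear_Blinfun_apply bounded_linear_scaleC)

lemma cs_mult: "cs (a * b) = cs a * cs b" by (rule endo_eqI) simp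
lemma cs_add: "cs (a + b) = cs a + cs b" by (rule endo_eqI) (simp add: app.add_left scaleC_add_left)
lemma cs_one [simp]: "cs 1 = 1" by (rule endo_eqI) simp
lemma cs_zero [simp]: "cs 0 = 0" by (rule endo_eqI) (simp add: app.zero_left)
lemma cs_diff: "cs (a - b) = cs a - cs b"
  by (rule endo_eqI) (simp add: app.diff_left scaleC.diff_left)
lemma cs_sum: "cs (\<Sum>i\<in>A. f i) = (\<Sum>i\<in>A. cs (f i))"
  by (induction A rule: infinite_finite_induct) (simp_all add: cs_add)
lemma cs_of_real: "cs (of_real r) * a = r *\<^sub>R a"
  by (rule endo_eqI) (simp add: app.scaleR_left scaleR_scaleC)

text \<open>Equality fails on the zero space, where \<open>cs c = 0\<close>.\<close>

lemma norm_cs: "norm (cs c :: 'b::complex_banach endo) \<le> cmod c"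
  unfolding norm_endo.rep_eq
proof (rule norm_blinfun_bound)
  fix x :: 'b
  show "norm (blinfun_apply (Rep_endo (cs c)) x) \<le> cmod c * norm x"
    using app_cs[of c x] by (simp add: app_def norm_scaleC)
qed simp

lemma norm_cs_mult: "norm (cs c * a) \<le> cmod c * norm a"
  by (rule order_trans[OF norm_mult_ineq]) (intro mult_right_mono norm_cs norm_ge_zero)

text \<open>Complex linearity as an identity in the algebra, in the form needed to move scalars past
  powers of the operator.\<close>

definition clin :: "'b::complex_banach endo \<Rightarrow> bool" where
  "clin a \<longleftrightarrow> (\<forall>c. a * cs c = cs c * a)"

lemma clin_power_scale: "clin a \<Longrightarrow> (cs c * a) ^ n = cs (c ^ n) * a ^ n"
proof (induction n)
  case (Suc n)
  have c: "a * cs (c ^ n) = cs (c ^ n) * a" using Suc.prems by (simp add: clin_def)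
  have "(cs c * a) ^ Suc n = cs c * (a * cs (c ^ n)) * a ^ n"
    using Suc by (simp add: mult.assoc)
  also have "\<dots> = cs (c ^ Suc n) * a ^ Suc n" by (simp only: c) (simp add: cs_mult mult.assoc)
  finally show ?case .
qed simp

definition invertible_endo :: "'b::banach endo \<Rightarrow> bool" where
  "invertible_endo a \<longleftrightarrow> (\<exists>b. a * b = 1 \<and> b * a = 1)"

section \<open>Resolvent, roots of unity and convergence of powers\<close>

lemma geometric_sum_algebra_left:
  fixes x :: "'a::{ring, monoid_mult}"
  shows "(1 - x) * (\<Sum>k<n. x ^ k) = 1 - x ^ n"
proof (induction n)
  case (Suc n)
  have "(1 - x) * (\<Sum>k<Suc n. x ^ k) = (1 - x) * (\<Sum>k<n. x ^ k) + (x ^ n - x * x ^ n)"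
    by (simp add: algebra_simps)
  then show ?case by (simp add: Suc)
qed simp

lemma sum_roots_unity_power:
  assumes "m \<ge> 1" "k < m"
  shows "(\<Sum>j<m. exp (2 * of_real pi * \<i> * of_nat j / of_nat m) ^ k) = (if k = 0 then of_nat m else 0 :: complex)"
proof (cases "k = 0")
  case False
  let ?w = "exp (2 * of_real pi * \<i> * of_nat k / of_nat m) :: complex"
  have "?w \<noteq> 1" using complex_root_unity_eq_1[OF assms(1), of k] assms(2) False by (auto dest: dvd_imp_le)
  moreover have "?w ^ m = 1" using complex_root_unity[of m k] assms by simp
  moreover have "exp (2 * of_real pi * \<i> * of_nat j / of_nat m) ^ k = ?w ^ j" for j
    by (simp add: exp_of_nat_mult[symmetric] algebra_simps)
  ultimately show ?thesis using False by (simp add: geometric_sum)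
qed simp

text \<open>Rickart's elementary form of the spectral radius formula: averaging the resolvent
  over the \<open>m\<close>-th roots of unity yields the inverse of \<open>1 - r^m T^m\<close>.\<close>

lemma resolvent_average:
  fixes T :: "'b::complex_banach endo"
  assumes T: "clin T" and m: "m \<ge> 1"
    and f: "\<And>j. j < m \<Longrightarrow> f (exp (2 * of_real pi * \<i> * of_nat j / of_nat m) * of_real r)
      * (1 - cs (exp (2 * of_real pi * \<i> * of_nat j / of_nat m) * of_real r) * T) = 1"
  shows "((1 / real m) *\<^sub>R (\<Sum>j<m. f (exp (2 * of_real pi * \<i> * of_nat j / of_nat m) * of_real r)))
      * (1 - r ^ m *\<^sub>R T ^ m) = 1"
proof -
  define w where "w j = exp (2 * of_real pi * \<i> * of_nat j / of_nat m) * complex_of_real r" for j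
  have wm: "w j ^ m = of_real r ^ m" for j
    using complex_root_unity[of m j] m by (simp add: w_def power_mult_distrib)
  \<comment> \<open>Every \<open>w j\<close> has the same \<open>m\<close>-th power, so the finite
    geometric sum turns each resolvent into a polynomial once it is multiplied by the common factor
    \<open>1 - r ^ m *\<^sub>R T ^ m\<close>.\<close>
  have one: "f (w j) * (1 - r ^ m *\<^sub>R T ^ m) = (\<Sum>k<m. cs (w j ^ k) * T ^ k)" if "j < m" for j
  proof -
    have "(1 - cs (w j) * T) * (\<Sum>k<m. (cs (w j) * T) ^ k) = 1 - r ^ m *\<^sub>R T ^ m"
      using cs_of_real[of "r ^ m" "T ^ m"]
      by (simp add: geometric_sum_algebra_left) (simp add: clin_power_scale[OF T] wm)
    then have "f (w j) * (1 - r ^ m *\<^sub>R T ^ m) = f (w j) * (1 - cs (w j) * T) * (\<Sum>k<m. (cs (w j) * T) ^ k)"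
      by (simp add: mult.assoc)
    then show ?thesis using f[OF that] by (simp add: w_def[symmetric] clin_power_scale[OF T])
  qed
  have "(\<Sum>j<m. f (w j)) * (1 - r ^ m *\<^sub>R T ^ m) = (\<Sum>j<m. \<Sum>k<m. cs (w j ^ k) * T ^ k)"
    by (simp add: sum_distrib_right one)
  also have "\<dots> = (\<Sum>k<m. cs (\<Sum>j<m. w j ^ k) * T ^ k)"
    by (subst sum.swap) (simp add: cs_sum sum_distrib_right)
  \<comment> \<open>Orthogonality of the roots of unity: the average keeps only the constant term
    \<open>k = 0\<close>.\<close>
  also have "\<dots> = (\<Sum>k<m. if k = 0 then cs (of_nat m) else 0)"
  proof (rule sum.cong[OF refl])
    fix k assume "k \<in> {..<m}"
    then have "(\<Sum>j<m. w j ^ k) = (if k = 0 then of_nat m else 0)"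
      using sum_roots_unity_power[OF m, of k]
      by (simp add: w_def power_mult_distrib sum_distrib_right[symmetric] del: sum_constant)
    then show "cs (\<Sum>j<m. w j ^ k) * T ^ k = (if k = 0 then cs (of_nat m) else 0)" by simp
  qed
  also have "\<dots> = cs (of_nat m)" using m by (simp add: sum.delta)
  finally have "(\<Sum>j<m. f (w j)) * (1 - r ^ m *\<^sub>R T ^ m) = real m *\<^sub>R 1"
    using cs_of_real[of "real m" 1] by simp
  then show ?thesis using m by (simp add: w_def)
qed

text \<open>Invertibility is an open condition and the closed unit disk is compact, so the resolvent
  exists on a disk of radius \<open>\<rho>\<close> strictly above 1. This margin and uniform
  continuity are what make the powers of \<open>T\<close> small.\<close>

lemma uniformly_continuous_resolvent:
  fixes T :: "'b::complex_banach endo"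
  assumes inv: "\<And>z. cmod z \<le> 1 \<Longrightarrow> invertible_endo (1 - cs z * T)"
  obtains f \<rho> where "\<rho> > 1" "\<And>z. cmod z \<le> \<rho> \<Longrightarrow> f z * (1 - cs z * T) = 1"
    "uniformly_continuous_on (cball 0 \<rho>) f" "bounded (f ` cball 0 \<rho>)"
proof -
  define G where "G = {z. invertible_endo (1 - cs z * T)}"
  have lim: "((\<lambda>w. 1 - cs w * T) \<longlongrightarrow> 1 - cs z * T) (at z)" for z
  proof -
    have "(\<lambda>w. cs (w - z) * T) \<midarrow>z\<rightarrow> 0"
    proof (rule Lim_null_comparison)
      show "\<forall>\<^sub>F w in at z. norm (cs (w - z) * T) \<le> cmod (w - z) * norm T"
        by (simp add: norm_cs_mult)
      show "((\<lambda>w. cmod (w - z) * norm T) \<longlongrightarrow> 0) (at z)"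
        by (rule tendsto_eq_intros refl | simp)+
    qed
    then have "(\<lambda>w. 1 - cs z * T - cs (w - z) * T) \<midarrow>z\<rightarrow> 1 - cs z * T - 0"
      by (intro tendsto_diff tendsto_const)
    then show ?thesis by (simp add: cs_diff algebra_simps)
  qed
  have "open G"
    unfolding open_dist
  proof
    fix z assume "z \<in> G"
    then obtain b where b: "(1 - cs z * T) * b = 1" "b * (1 - cs z * T) = 1"
      by (auto simp: G_def invertible_endo_def)
    \<comment> \<open>Chosen so that \<open>d * norm T * norm b \<le> 1/2\<close>, as
      \<open>inverse_perturbation\<close> requires; the added 1 avoids division by zero.\<close>
    define d where "d = 1 / (2 * (norm T * norm b + 1))"
    have d: "d > 0" by (simp add: d_def add_nonneg_pos)
    show "\<exists>e>0. \<forall>y. dist y z < e \<longrightarrow> y \<in> G"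
    proof (intro exI conjI allI impI)
      fix y assume y: "dist y z < d"
      have "norm ((1 - cs y * T) - (1 - cs z * T)) = norm (cs (y - z) * T)"
        by (simp add: cs_diff algebra_simps norm_minus_commute)
      also have "\<dots> \<le> d * norm T"
        using y by (intro order_trans[OF norm_cs_mult] mult_right_mono) (auto simp: dist_norm)
      finally have "norm ((1 - cs y * T) - (1 - cs z * T)) * norm b \<le> d * norm T * norm b"
        by (rule mult_right_mono) simp
      also have "\<dots> \<le> d * (norm T * norm b + 1)"
        using d by (simp add: algebra_simps)
      also have "\<dots> = 1/2"
      proof -
        have "norm T * norm b + 1 \<noteq> 0" by (smt (verit) mult_nonneg_nonneg norm_ge_zero)
        then show ?thesis by (simp add: d_def field_simps)
      qed
      finally have s: "norm ((1 - cs y * T) - (1 - cs z * T)) * norm b \<le> 1/2" .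
      obtain b' where "(1 - cs y * T) * b' = 1" "b' * (1 - cs y * T) = 1"
        using inverse_perturbation[OF b s] by metis
      then show "y \<in> G" by (auto simp: G_def invertible_endo_def)
    qed (rule d)
  qed
  moreover have "cball 0 1 \<subseteq> G" using inv by (auto simp: G_def)
  ultimately obtain e where e: "e > 0" "(\<Union>x\<in>cball 0 1. ball x e) \<subseteq> G"
    using compact_subset_open_imp_ball_epsilon_subset[OF compact_cball] by metis
  have sub: "cball 0 (1 + e/2) \<subseteq> G"
  proof
    fix z :: complex assume z: "z \<in> cball 0 (1 + e/2)"
    show "z \<in> G"
    proof (cases "cmod z \<le> 1")
      case True then show ?thesis using inv by (auto simp: G_def)
    next
      case False
      \<comment> \<open>For \<open>z\<close> outside the disk, \<open>sgn z\<close> is the nearest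
        point of the unit circle, at distance \<open>cmod z - 1\<close>.\<close>
      then have "dist (sgn z) z < e"
      proof -
        have "sgn z - z = of_real (1 - cmod z) * sgn z"
        proof -
          have "z \<noteq> 0" using False by auto
          then show ?thesis by (simp add: sgn_eq field_simps)
        qed
        then have "dist (sgn z) z = \<bar>1 - cmod z\<bar>"
          using False by (simp add: dist_norm norm_mult norm_sgn del: of_real_diff) (auto simp: norm_sgn)
        then show ?thesis using False z e by simp
      qed
      then have "z \<in> (\<Union>x\<in>cball 0 1. ball x e)"
        by (intro UN_I[of "sgn z"]) (auto simp: norm_sgn)
      then show ?thesis using e(2) by blast
    qed
  qed
  define f where "f z = (SOME b. (1 - cs z * T) * b = 1 \<and> b * (1 - cs z * T) = 1)" for z
  have f: "(1 - cs z * T) * f z = 1 \<and> f z * (1 - cs z * T) = 1" if "z \<in> G" for z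
    unfolding f_def by (rule someI_ex) (use that in \<open>auto simp: G_def invertible_endo_def\<close>)
  have cont: "continuous_on (cball 0 (1 + e/2)) f"
    unfolding continuous_on_def
  proof
    fix z :: complex assume z: "z \<in> cball 0 (1 + e/2)"
    show "(f \<longlongrightarrow> f z) (at z within cball 0 (1 + e/2))"
    proof (rule tendsto_algebra_inverse)
      show "((\<lambda>w. 1 - cs w * T) \<longlongrightarrow> 1 - cs z * T) (at z within cball 0 (1 + e/2))"
        using lim by (rule tendsto_within_subset) simp
      show "(1 - cs z * T) * f z = 1" "f z * (1 - cs z * T) = 1" using f z sub by blast+
      show "\<forall>\<^sub>F w in at z within cball 0 (1 + e/2). (1 - cs w * T) * f w = 1"
        using f sub by (auto simp: eventually_at_filter subset_iff intro!: always_eventually)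
    qed
  qed
  show thesis
  proof (rule that)
    show "1 + e/2 > 1" using e by simp
    show "f z * (1 - cs z * T) = 1" if "cmod z \<le> 1 + e/2" for z using f sub that by auto
    show "uniformly_continuous_on (cball 0 (1 + e/2)) f"
      by (intro compact_uniformly_continuous cont) simp
    show "bounded (f ` cball 0 (1 + e/2))"
      by (intro compact_imp_bounded compact_continuous_image cont) simp
  qed
qed

text \<open>A continuity argument in the radius, for the property \<open>A r\<close> that
  \<open>r ^ m * norm (T ^ m)\<close> tends to 0. The averaged resolvent \<open>g m r\<close>
  inverts \<open>1 - r ^ m *\<^sub>R T ^ m\<close>, so under \<open>A r\<close> it is close to 1; as
  the modulus of continuity of \<open>g m\<close> does not depend on \<open>m\<close>, it is still
  within 1/2 of 1 at \<open>r + d\<close>. This bounds \<open>(r + d) ^ m * norm (T ^ m)\<close> and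
  gives \<open>A\<close> at an intermediate radius. Finitely many such steps lead from 0 to
  1.\<close>

lemma powers_tendsto_zero:
  fixes T :: "'b::complex_banach endo"
  assumes T: "clin T" and inv: "\<And>z. cmod z \<le> 1 \<Longrightarrow> invertible_endo (1 - cs z * T)"
  shows "(\<lambda>n. T ^ n) \<longlonglongrightarrow> 0"
proof -
  obtain f \<rho> where \<rho>: "\<rho> > 1" and f: "\<And>z. cmod z \<le> \<rho> \<Longrightarrow> f z * (1 - cs z * T) = 1"
    and uc: "uniformly_continuous_on (cball 0 \<rho>) f" and bd: "bounded (f ` cball 0 \<rho>)"
    using uniformly_continuous_resolvent[OF inv] by blast
  from bd obtain C where C: "C > 0" "\<And>z. cmod z \<le> \<rho> \<Longrightarrow> norm (f z) \<le> C"
    by (force simp: bounded_pos)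
  \<comment> \<open>1/4 for moving the radius and 1/4 for the distance of \<open>g m r\<close> from
    1 add up to the 1/2 in \<open>norm_le_one_of_near_inverse\<close>.\<close>
  from uc obtain \<eta> where \<eta>: "\<eta> > 0"
    "\<And>z w. cmod z \<le> \<rho> \<Longrightarrow> cmod w \<le> \<rho> \<Longrightarrow> cmod (z - w) < \<eta> \<Longrightarrow> norm (f z - f w) < 1/4"
    unfolding uniformly_continuous_on_def dist_norm by (force dest: spec[of _ "1/4"])
  define w where "w m j = exp (2 * of_real pi * \<i> * of_nat j / of_nat m)" for m j :: nat
  have nw [simp]: "cmod (w m j) = 1" for m j
    by (simp add: w_def)
  define g where "g m r = (1 / real m) *\<^sub>R (\<Sum>j<m. f (w m j * of_real r))" for m r
  have g1: "g m r * (1 - r ^ m *\<^sub>R T ^ m) = 1" if "0 \<le> r" "r \<le> \<rho>" "m \<ge> 1" for m r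
    unfolding g_def w_def
  proof (rule resolvent_average[OF T \<open>m \<ge> 1\<close>], rule f)
    fix j
    show "cmod (exp (2 * of_real pi * \<i> * of_nat j / of_nat m) * of_real r) \<le> \<rho>"
      using that nw[of m j] by (simp add: norm_mult w_def)
  qed
  have avg: "norm ((1 / real m) *\<^sub>R (\<Sum>j<m. h j)) \<le> B"
    if "m \<ge> 1" "\<And>j. norm (h j) \<le> B" for m B and h :: "nat \<Rightarrow> 'b endo"
  proof -
    have "norm (\<Sum>j<m. h j) \<le> real m * B"
      using sum_norm_bound[of "{..<m}" h B] that by simp
    then show ?thesis using that(1) by (simp add: field_simps)
  qed
  have gC: "norm (g m r) \<le> C" if "0 \<le> r" "r \<le> \<rho>" "m \<ge> 1" for m r
    unfolding g_def by (rule avg[OF that(3)]) (use that in \<open>auto intro!: C simp: norm_mult\<close>)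
  have gd: "norm (g m r - g m r') \<le> 1/4"
    if "0 \<le> r" "r \<le> \<rho>" "0 \<le> r'" "r' \<le> \<rho>" "\<bar>r - r'\<bar> < \<eta>" "m \<ge> 1" for m r r'
  proof -
    have "g m r - g m r' = (1 / real m) *\<^sub>R (\<Sum>j<m. f (w m j * of_real r) - f (w m j * of_real r'))"
      by (simp add: g_def sum_subtractf scaleR_diff_right)
    also have "norm \<dots> \<le> 1/4"
    proof (rule avg[OF that(6)])
      fix j
      have "cmod (w m j * of_real r - w m j * of_real r') = \<bar>r - r'\<bar>"
        by (simp flip: right_diff_distrib of_real_diff add: norm_mult)
      then show "norm (f (w m j * of_real r) - f (w m j * of_real r')) \<le> 1/4"
        using that \<eta>(2)[of "w m j * of_real r" "w m j * of_real r'"] by (auto simp: norm_mult)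
    qed
    finally show ?thesis .
  qed
  define A where "A r \<longleftrightarrow> (\<lambda>m. r ^ m * norm (T ^ m)) \<longlonglongrightarrow> 0" for r
  have step: "A (r + d/2)" if "A r" "0 \<le> r" "r + d \<le> \<rho>" "0 < d" "d < \<eta>" for r d
  proof -
    have "(\<lambda>m. C * (r ^ m * norm (T ^ m))) \<longlonglongrightarrow> 0"
      using tendsto_mult_left[OF \<open>A r\<close>[unfolded A_def], of C] by simp
    then have "\<forall>\<^sub>F m in sequentially. C * (r ^ m * norm (T ^ m)) < 1/4"
      by (rule order_tendstoD) simp
    then have ev: "\<forall>\<^sub>F m in sequentially. (r + d) ^ m * norm (T ^ m) \<le> 1"
      using eventually_ge_at_top[of 1]
    proof eventually_elim
      case (elim m)
      have "g m r - 1 = g m r * (r ^ m *\<^sub>R T ^ m)"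
        using g1[of r m] elim that by (simp add: algebra_simps)
      then have "norm (g m r - 1) \<le> norm (g m r) * norm (r ^ m *\<^sub>R T ^ m)"
        by (simp only: norm_mult_ineq)
      also have "\<dots> \<le> C * norm (r ^ m *\<^sub>R T ^ m)"
        using gC[of r m] elim that by (intro mult_right_mono) auto
      also have "\<dots> < 1/4" using elim that by simp
      finally have "norm (g m r - 1) < 1/4" .
      moreover have "norm (g m (r + d) - g m r) \<le> 1/4"
        using that elim by (intro gd) auto
      ultimately have "norm (g m (r + d) - 1) \<le> 1/2"
        using norm_triangle_ineq[of "g m (r + d) - g m r" "g m r - 1"] by simp
      moreover have "g m (r + d) * (1 - (r + d) ^ m *\<^sub>R T ^ m) = 1"
        using that elim by (intro g1) auto
      ultimately have "norm ((r + d) ^ m *\<^sub>R T ^ m) \<le> 1" using norm_le_one_of_near_inverse by blast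
      then show ?case using that by simp
    qed
    \<comment> \<open>Half of the gain \<open>d\<close> is given up: boundedness at
      \<open>r + d\<close> becomes geometric decay at \<open>r + d/2\<close>, with ratio
      \<open>q\<close>.\<close>
    define q where "q = (r + d/2) / (r + d)"
    have q: "0 \<le> q" "q < 1" using that by (auto simp: q_def)
    show ?thesis unfolding A_def
    proof (rule Lim_null_comparison)
      show "(\<lambda>m. q ^ m) \<longlonglongrightarrow> 0" using q by (intro LIMSEQ_power_zero) auto
      show "\<forall>\<^sub>F m in sequentially. norm ((r + d/2) ^ m * norm (T ^ m)) \<le> q ^ m"
        using ev
      proof eventually_elim
        case (elim m)
        have "(r + d/2) ^ m * norm (T ^ m) = q ^ m * ((r + d) ^ m * norm (T ^ m))"
          using that by (simp add: q_def power_divide)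
        also have "\<dots> \<le> q ^ m * 1" using q elim by (intro mult_left_mono) auto
        finally show ?case using that by simp
      qed
    qed
  qed
  \<comment> \<open>The step is taken with \<open>d = 2 / real n\<close>, so each one advances by
    \<open>1 / real n\<close>; the bound by \<open>\<rho> - 1\<close> keeps \<open>r + d\<close>
    inside the disk for all \<open>r\<close> up to 1.\<close>
  obtain n :: nat where n: "n > 0" "2 / real n < min \<eta> (\<rho> - 1)"
  proof -
    obtain n :: nat where "2 / min \<eta> (\<rho> - 1) < real n" using reals_Archimedean2 by blast
    moreover have "min \<eta> (\<rho> - 1) > 0" using \<eta> \<rho> by simp
    moreover from calculation have "real n > 0" by (meson divide_pos_pos less_trans zero_less_numeral)
    ultimately show thesis
      by (intro that[of n]) (simp_all only: pos_divide_less_eq mult.commute of_nat_0_less_iff)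
  qed
  have "A (real i / real n)" if "i \<le> n" for i
    using that
  proof (induction i)
    case 0
    \<comment> \<open>At radius 0 the sequence vanishes from \<open>m = 1\<close> on, although
      \<open>0 ^ 0 = 1\<close>.\<close>
    show ?case unfolding A_def
      by (rule Lim_transform_eventually[OF tendsto_const])
         (auto intro: eventually_mono[OF eventually_ge_at_top[of 1]])
  next
    case (Suc i)
    have "real i / real n + 2 / real n \<le> 1 + 2 / real n"
      using Suc n by (simp add: field_simps)
    then have "real i / real n + 2 / real n \<le> \<rho>" using n(2) by linarith
    then have "A (real i / real n + (2 / real n) / 2)"
      using Suc n by (intro step) auto
    then show ?case by (simp add: add_divide_distrib add.commute)
  qed
  from this[of n] have "A 1" using n by simp
  then show ?thesis by (simp add: A_def tendsto_norm_zero_iff)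
qed

subsection \<open>Operators with closed range\<close>

text \<open>The Baire half of the open mapping theorem, applied to \<open>range A\<close> itself,
  which is complete because it is closed. The closure of the image of some ball has interior in the
  range; differences of two approximations move the interior point to the origin.\<close>

lemma almost_preimage:
  fixes A :: "'a::banach \<Rightarrow> 'c::banach"
  assumes A: "bounded_linear A" and cl: "closed (range A)"
  shows "\<exists>C>0. \<forall>y\<in>range A. \<exists>x. norm x \<le> C * norm y \<and> norm (y - A x) \<le> norm y / 2"
proof -
  interpret A: bounded_linear A by (rule A)
  let ?Y = "range A" and ?X = "top_of_set (range A)"
  let ?G = "(\<lambda>n::nat. closure (A ` cball 0 (real n))) ` UNIV"
  have sub: "closure (A ` cball 0 r) \<subseteq> ?Y" for r using cl by (simp add: closure_minimal image_mono)
  have "\<exists>T\<in>?G. ?X interior_of T \<noteq> {}"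
  proof (rule ccontr)
    assume *: "\<not> ?thesis"
    have "?X interior_of \<Union>?G = {}"
    proof (rule Baire_category_alt)
      show "completely_metrizable_space ?X \<or> locally_compact_space ?X \<and> regular_space ?X"
        by (intro disjI1 completely_metrizable_space_closedin completely_metrizable_space_euclidean) (simp add: cl)
      show "closedin ?X T \<and> ?X interior_of T = {}" if "T \<in> ?G" for T
        using that * closed_subset[OF sub closed_closure] by blast
    qed auto
    moreover have "\<Union>?G = ?Y"
    proof
      show "?Y \<subseteq> \<Union>?G"
      proof
        fix y assume "y \<in> ?Y"
        then obtain x where "y = A x" by auto
        moreover obtain n :: nat where "norm x \<le> real n" using real_arch_simple by blast
        ultimately show "y \<in> \<Union>?G" using closure_subset by fastforce
      qed
    qed (use sub in blast)
    ultimately have "?X interior_of topspace ?X = {}" by simp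
    then show False by (simp only: interior_of_topspace) auto
  qed
  then obtain n y0 where "y0 \<in> ?X interior_of (closure (A ` cball 0 (real n)))" by auto
  then obtain U where U: "openin ?X U" "y0 \<in> U" "U \<subseteq> closure (A ` cball 0 (real n))"
    by (auto simp: interior_of_def)
  then obtain e where e: "e > 0" "\<And>y. y \<in> ?Y \<Longrightarrow> dist y y0 < e \<Longrightarrow> y \<in> U" and y0: "y0 \<in> ?Y"
    unfolding openin_euclidean_subtopology_iff by blast
  have small: "\<exists>x. norm x \<le> 2 * real n \<and> norm (y - A x) < \<eta>"
    if y: "y \<in> ?Y" "norm y < e" "\<eta> > 0" for y \<eta>
  proof -
    have "y0 + y \<in> ?Y" using y0 y by (auto simp flip: A.add)
    then have "y0 + y \<in> closure (A ` cball 0 (real n))" "y0 \<in> closure (A ` cball 0 (real n))"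
      using e(2)[of "y0 + y"] U y by (auto simp: dist_norm)
    then obtain x1 x2 where x: "norm x1 \<le> real n" "norm x2 \<le> real n"
      "dist (A x1) (y0 + y) < \<eta> / 2" "dist (A x2) y0 < \<eta> / 2"
      using y(3) unfolding closure_approachable
      by (force dest!: spec[of _ "\<eta> / 2"])
    show ?thesis
    proof (intro exI[of _ "x1 - x2"] conjI)
      show "norm (x1 - x2) \<le> 2 * real n" using x norm_triangle_ineq4[of x1 x2] by simp
      have "y - A (x1 - x2) = (A x2 - y0) - (A x1 - (y0 + y))" by (simp add: A.diff)
      then have "norm (y - A (x1 - x2)) \<le> norm (A x2 - y0) + norm (A x1 - (y0 + y))"
        by (simp only: norm_triangle_ineq4)
      then show "norm (y - A (x1 - x2)) < \<eta>" using x by (simp add: dist_norm)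
    qed
  qed
  \<comment> \<open>\<open>y\<close> is rescaled to norm \<open>e / 2\<close> and the preimage
    scaled back; \<open>n + 1\<close> instead of \<open>n\<close> keeps \<open>C\<close>
    positive.\<close>
  define C where "C = 4 * (real n + 1) / e"
  show ?thesis
  proof (intro exI[of _ C] conjI ballI)
    show "C > 0" using e by (simp add: C_def)
    fix y assume y: "y \<in> ?Y"
    show "\<exists>x. norm x \<le> C * norm y \<and> norm (y - A x) \<le> norm y / 2"
    proof (cases "y = 0")
      case True then show ?thesis by (intro exI[of _ 0]) simp
    next
      case False
      define s where "s = e / (2 * norm y)"
      have s: "s > 0" using e False by (simp add: s_def)
      have "s *\<^sub>R y \<in> ?Y" using y by (auto simp flip: A.scaleR)
      moreover have "norm (s *\<^sub>R y) < e" using s e False by (simp add: s_def)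
      moreover have "s * norm y / 2 > 0" using s False by simp
      ultimately obtain x where x: "norm x \<le> 2 * real n" "norm (s *\<^sub>R y - A x) < s * norm y / 2"
        using small by blast
      have "y - A ((1/s) *\<^sub>R x) = (1/s) *\<^sub>R (s *\<^sub>R y - A x)"
        using s by (simp add: A.scaleR scaleR_diff_right)
      then have "norm (y - A ((1/s) *\<^sub>R x)) = norm (s *\<^sub>R y - A x) / s" using s by simp
      also have "\<dots> \<le> norm y / 2" using x(2) s by (simp add: field_simps)
      finally have 1: "norm (y - A ((1/s) *\<^sub>R x)) \<le> norm y / 2" .
      have "norm ((1/s) *\<^sub>R x) \<le> (1/s) * (2 * (real n + 1))"
        using s x(1) by (simp add: divide_right_mono)
      also have "\<dots> = C * norm y" using e False by (simp add: C_def s_def field_simps)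
      finally show ?thesis using 1 by blast
    qed
  qed
qed

text \<open>The residual is at least halved by each correction, so the corrections form an
  absolutely convergent series whose sum is an exact preimage.\<close>

lemma bounded_preimage:
  fixes A :: "'a::banach \<Rightarrow> 'c::banach"
  assumes A: "bounded_linear A" and cl: "closed (range A)"
  shows "\<exists>C>0. \<forall>y\<in>range A. \<exists>x. A x = y \<and> norm x \<le> C * norm y"
proof -
  interpret A: bounded_linear A by (rule A)
  obtain C where C: "C > 0"
    "\<And>y. y \<in> range A \<Longrightarrow> \<exists>x. norm x \<le> C * norm y \<and> norm (y - A x) \<le> norm y / 2"
    using almost_preimage[OF assms] by auto
  then obtain g where g: "\<And>y. y \<in> range A \<Longrightarrow> norm (g y) \<le> C * norm y \<and> norm (y - A (g y)) \<le> norm y / 2"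
    by metis
  show ?thesis
  proof (intro exI[of _ "2 * C"] conjI ballI)
    fix y assume y: "y \<in> range A"
    \<comment> \<open>\<open>Y k\<close> is the residual after \<open>k\<close> corrections; the
      partial sums of \<open>A (g (Y k))\<close> telescope.\<close>
    define Y where "Y k = ((\<lambda>y. y - A (g y)) ^^ k) y" for k
    have YS: "Y (Suc k) = Y k - A (g (Y k))" for k by (simp add: Y_def)
    have Yr: "Y k \<in> range A" for k
      by (induction k) (use y in \<open>auto simp: YS simp flip: A.diff, simp add: Y_def\<close>)
    have Yn: "norm (Y k) \<le> norm y * (1/2) ^ k" for k
    proof (induction k)
      case (Suc k)
      have "norm (Y (Suc k)) \<le> norm (Y k) / 2" using g[OF Yr] by (simp add: YS)
      with Suc show ?case by simp
    qed (simp add: Y_def)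
    have gn: "norm (g (Y k)) \<le> C * norm y * (1/2) ^ k" for k
    proof -
      have "norm (g (Y k)) \<le> C * norm (Y k)" using g[OF Yr] by blast
      also have "\<dots> \<le> C * (norm y * (1/2) ^ k)" using Yn C by (intro mult_left_mono) auto
      finally show ?thesis by simp
    qed
    have geo: "(\<lambda>k. C * norm y * (1/2) ^ k) sums (C * norm y * 2)"
      using sums_mult[OF geometric_sums[of "1/2::real"], of "C * norm y"] by simp
    have sg: "summable (\<lambda>k. norm (g (Y k)))"
      by (rule summable_comparison_test[OF _ sums_summable[OF geo]]) (use gn in auto)
    have s: "summable (\<lambda>k. g (Y k))" using sg by (rule summable_norm_cancel)
    have "Y \<longlonglongrightarrow> 0"
    proof (rule Lim_null_comparison)
      show "\<forall>\<^sub>F k in sequentially. norm (Y k) \<le> norm y * (1/2) ^ k" using Yn by simp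
      show "(\<lambda>k. norm y * (1/2) ^ k) \<longlonglongrightarrow> 0"
        using tendsto_mult_left[OF LIMSEQ_power_zero[of "1/2::real"], of "norm y"] by simp
    qed
    from telescope_sums'[OF this] have "(\<lambda>k. A (g (Y k))) sums y" by (simp add: YS) (simp add: Y_def)
    then have "A (\<Sum>k. g (Y k)) = y" using A.sums[OF summable_sums[OF s]] sums_unique2 by blast
    moreover have "norm (\<Sum>k. g (Y k)) \<le> 2 * C * norm y"
    proof -
      have "norm (\<Sum>k. g (Y k)) \<le> (\<Sum>k. norm (g (Y k)))" by (rule summable_norm[OF sg])
      also have "\<dots> \<le> (\<Sum>k. C * norm y * (1/2) ^ k)"
        by (rule suminf_le[OF gn sg sums_summable[OF geo]])
      also have "\<dots> = C * norm y * 2" using geo by (simp add: sums_iff)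
      finally show ?thesis by simp
    qed
    ultimately show "\<exists>x. A x = y \<and> norm x \<le> 2 * C * norm y" by blast
  qed (use C in simp)
qed

text \<open>Injectivity forces the controlled preimage of \<open>A x\<close> to be \<open>x\<close>
  itself.\<close>

lemma bounded_below_of_inj:
  fixes A :: "'a::banach \<Rightarrow> 'c::banach"
  assumes A: "bounded_linear A" and cl: "closed (range A)" and inj: "\<And>x. A x = 0 \<Longrightarrow> x = 0"
  shows "\<exists>c>0. \<forall>x. c * norm x \<le> norm (A x)"
proof -
  interpret A: bounded_linear A by (rule A)
  obtain C where C: "C > 0" "\<And>y. y \<in> range A \<Longrightarrow> \<exists>x. A x = y \<and> norm x \<le> C * norm y"
    using bounded_preimage[OF A cl] by auto
  have "norm x \<le> C * norm (A x)" for x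
  proof -
    obtain x' where x': "A x' = A x" "norm x' \<le> C * norm (A x)" using C(2) by blast
    have "A (x' - x) = 0" using x' by (simp add: A.diff)
    then show ?thesis using x' inj by force
  qed
  then show ?thesis using C by (intro exI[of _ "1/C"]) (auto simp: field_simps)
qed

lemma invertible_endo_of_bij:
  assumes inj: "\<And>x. app a x = 0 \<Longrightarrow> x = 0" and surj: "\<And>y. \<exists>x. app a x = y"
  shows "invertible_endo a"
proof -
  have r: "range (app a) = UNIV" using surj by (metis surj_def)
  obtain c where c: "c > 0" "\<And>x. c * norm x \<le> norm (app a x)"
    using bounded_below_of_inj[of "app a"] bounded_linear_app[of a] inj r by auto
  have i: "inj (app a)" using inj by (intro injI) (metis app.diff_right right_minus_eq)
  have inv: "app a (inv (app a) y) = y" for y using r by (metis UNIV_I f_inv_into_f)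
  have "bounded_linear (inv (app a))"
  proof (rule bounded_linear_intro[where K = "1/c"])
    show "inv (app a) (x + y) = inv (app a) x + inv (app a) y" for x y
      by (rule injD[OF i]) (simp add: inv app.add_right)
    show "inv (app a) (t *\<^sub>R y) = t *\<^sub>R inv (app a) y" for t y
      by (rule injD[OF i]) (simp add: inv app.scaleR_right)
    show "norm (inv (app a) y) \<le> norm y * (1/c)" for y
      using c(2)[of "inv (app a) y"] c(1) by (simp add: inv field_simps)
  qed
  then obtain b where b: "app b = inv (app a)" by (rule endo_of_bounded_linear)
  have "a * b = 1" "b * a = 1"
    by (auto intro!: endo_eqI simp: b inv inv_f_f[OF i])
  then show ?thesis by (auto simp: invertible_endo_def)
qed

lemma invertible_endoD:
  assumes "invertible_endo a"
  shows "app a x = 0 \<Longrightarrow> x = 0" "\<exists>x. app a x = y"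
proof -
  obtain b where b: "a * b = 1" "b * a = 1" using assms by (auto simp: invertible_endo_def)
  have 1: "app a (app b x) = x" "app b (app a x) = x" for x
    using b by (metis app_mult app_one)+
  show "app a x = 0 \<Longrightarrow> x = 0" using 1(2)[of x] by (simp add: app.zero_right)
  show "\<exists>x. app a x = y" using 1 by blast
qed

text \<open>The lower bound for \<open>A\<close> keeps the solutions of the approximating equations
  bounded for large \<open>n\<close>; hence \<open>app A (x n)\<close> tends to \<open>y\<close>,
  and the lower bound applied to differences makes \<open>x\<close> Cauchy. \<open>R\<close> is a
  parameter because the lemma serves both the whole space and the range of
  \<open>T - 1\<close>.\<close>

lemma preimage_of_operator_limit:
  fixes A :: "'b::banach endo"
  assumes lim: "An \<longlonglongrightarrow> A" and R: "closed R" "\<And>x y. x \<in> R \<Longrightarrow> y \<in> R \<Longrightarrow> x - y \<in> R"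
    and c: "c > 0" "\<And>x. x \<in> R \<Longrightarrow> c * norm x \<le> norm (app A x)"
    and pre: "\<And>n. \<exists>x\<in>R. app (An n) x = y"
  shows "\<exists>x\<in>R. app A x = y"
proof -
  from pre obtain x where x: "\<And>n. x n \<in> R" "\<And>n. app (An n) (x n) = y" by metis
  define B where "B = 2 * norm y / c"
  have null: "(\<lambda>n. norm (A - An n)) \<longlonglongrightarrow> 0"
    using tendsto_norm_zero[OF LIM_zero[OF lim]] by (simp add: norm_minus_commute)
  have "\<forall>\<^sub>F n in sequentially. norm (A - An n) < c / 2"
    by (rule order_tendstoD(2)[OF null]) (use c in simp)
  then have evb: "\<forall>\<^sub>F n in sequentially. norm (x n) \<le> B"
  proof (rule eventually_mono)
    fix n assume n: "norm (A - An n) < c / 2"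
    have "app A (x n) = y + app (A - An n) (x n)" using x by (simp add: app.diff_left)
    then have "c * norm (x n) \<le> norm y + norm (app (A - An n) (x n))"
      using c(2)[OF x(1), of n] norm_triangle_ineq[of y "app (A - An n) (x n)"] by simp
    also have "norm (app (A - An n) (x n)) \<le> c/2 * norm (x n)"
      using n by (intro order_trans[OF norm_app] mult_right_mono) auto
    finally show "norm (x n) \<le> B" using c(1) by (simp add: B_def field_simps)
  qed
  have B: "B \<ge> 0" using c by (simp add: B_def)
  have err: "(\<lambda>n. app (A - An n) (x n)) \<longlonglongrightarrow> 0"
  proof (rule Lim_null_comparison)
    show "(\<lambda>n. norm (A - An n) * B) \<longlonglongrightarrow> 0" using tendsto_mult_right[OF null, of B] by simp
    show "\<forall>\<^sub>F n in sequentially. norm (app (A - An n) (x n)) \<le> norm (A - An n) * B"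
      using evb by eventually_elim (meson mult_left_mono norm_app norm_ge_zero order_trans)
  qed
  have Ax: "app A (x n) = y + app (A - An n) (x n)" for n using x by (simp add: app.diff_left)
  have limA: "(\<lambda>n. app A (x n)) \<longlonglongrightarrow> y"
    using tendsto_add[OF tendsto_const[of y] err] by (simp add: Ax)
  have "Cauchy x"
  proof (rule metric_CauchyI)
    fix e :: real assume "e > 0"
    then have "e * c > 0" using c by simp
    with LIMSEQ_imp_Cauchy[OF limA] obtain M where M:
      "\<And>m n. m \<ge> M \<Longrightarrow> n \<ge> M \<Longrightarrow> dist (app A (x m)) (app A (x n)) < e * c"
      unfolding Cauchy_def by blast
    have "dist (x m) (x n) < e" if "m \<ge> M" "n \<ge> M" for m n
    proof -
      have "c * norm (x m - x n) \<le> norm (app A (x m - x n))" by (intro c R x)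
      also have "\<dots> < e * c" using M[OF that] by (simp add: dist_norm app.diff_right)
      finally show ?thesis using c by (simp add: dist_norm mult.commute)
    qed
    then show "\<exists>M. \<forall>m\<ge>M. \<forall>n\<ge>M. dist (x m) (x n) < e" by blast
  qed
  then obtain z where z: "x \<longlonglongrightarrow> z" by (auto simp: Cauchy_convergent_iff convergent_def)
  have "z \<in> R" using R(1) x(1) z by (meson closed_sequentially)
  moreover have "app A z = y"
    using LIMSEQ_unique[OF limA] app.tendsto[OF tendsto_const z] by blast
  ultimately show ?thesis by blast
qed

subsection \<open>Splitting off the simple eigenvalue\<close>

lemma clin_app: "clin a \<Longrightarrow> app a (scaleC c x) = scaleC c (app a x)"
  unfolding clin_def by (metis app_cs app_mult)

lemma clinI: "(\<And>c x. app a (scaleC c x) = scaleC c (app a x)) \<Longrightarrow> clin a"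
  unfolding clin_def by (intro allI endo_eqI) simp

text \<open>Everything is read off from \<open>R = range (T - 1)\<close>. Algebraic simplicity makes
  \<open>R\<close> meet the eigenline only in 0; isolation makes \<open>T - 1\<close> map
  \<open>R\<close> onto \<open>R\<close>, as a limit of the invertible operators
  \<open>T - 1 - \<epsilon>\<close>. This gives the splitting: \<open>\<phi>\<close> is the
  coefficient of \<open>v0\<close>, and \<open>Q\<close> is \<open>T\<close> on \<open>R\<close> and
  0 on \<open>v0\<close>. For the other \<open>z\<close> on or outside the unit circle, surjectivity
  of \<open>T - z\<close> comes from the approximations \<open>Lm\<close>.\<close>

lemma spectral_gap:
  fixes T :: "'b::complex_banach endo"
  assumes T: "clin T"
    and ev: "x1 \<noteq> 0" "app T x1 = x1"
    and simple: "{x. \<exists>k. ((\<lambda>x. app T x - x) ^^ k) x = 0} = range (\<lambda>c. scaleC c v0)"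
    and cl: "\<And>z. cmod z \<ge> 1 \<Longrightarrow> closed (range (app (T - cs z)))"
    and noev: "\<And>z x. cmod z \<ge> 1 \<Longrightarrow> z \<noteq> 1 \<Longrightarrow> app T x = scaleC z x \<Longrightarrow> x = 0"
    and iso: "e > 0" "\<And>z. z \<noteq> 1 \<Longrightarrow> cmod (z - 1) < e \<Longrightarrow> invertible_endo (T - cs z)"
    and lim: "Lm \<longlonglongrightarrow> T" and inv: "\<And>n z. cmod z \<ge> 1 \<Longrightarrow> invertible_endo (Lm n - cs z)"
  shows "\<exists>\<phi> :: 'b \<Rightarrow>\<^sub>L complex. \<exists>Q. clinear_functional \<phi> \<and> \<phi> v0 = 1 \<and> app T v0 = v0
     \<and> (\<forall>x. \<phi> (app T x) = \<phi> x) \<and> (\<forall>x. app Q x = app T x - scaleC (\<phi> x) v0) \<and> (\<lambda>n. Q ^ n) \<longlonglongrightarrow> 0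
     \<and> invertible_endo (1 - Q)"
proof -
  let ?A = "T - 1"
  define R where "R = range (app ?A)"
  have appA: "app ?A x = app T x - x" for x by (simp add: app.diff_left)
  have Tc: "app T (scaleC c x) = scaleC c (app T x)" for c x using T by (rule clin_app)
  \<comment> \<open>The second iterate suffices: a preimage under \<open>?A\<close> of an element of
    the eigenline is killed by the square of \<open>?A\<close>.\<close>
  have ker: "\<exists>c. x = scaleC c v0" if "app ?A (app ?A x) = 0" for x
  proof -
    have "((\<lambda>x. app T x - x) ^^ 2) x = 0" using that by (simp add: appA numeral_2_eq_2)
    then have "x \<in> range (\<lambda>c. scaleC c v0)" using simple by blast
    then show ?thesis by auto
  qed
  have ker1: "\<exists>c. x = scaleC c v0" if "app ?A x = 0" for x
    using that by (intro ker) (simp add: app.zero_right)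
  \<comment> \<open>\<open>simple\<close> leaves open whether \<open>v0\<close> is nonzero; this and
    \<open>app T v0 = v0\<close> are inherited from the eigenvector \<open>x1\<close>.\<close>
  obtain c1 where x1: "x1 = scaleC c1 v0" using ker1[of x1] ev by (auto simp: appA)
  then have "c1 \<noteq> 0" using ev by auto
  then have "v0 = scaleC (1/c1) x1" using x1 by simp
  then have "app T v0 = v0" by (metis Tc ev(2))
  moreover have "v0 \<noteq> 0" using ev(1) x1 by (auto simp: scaleC.zero_right)
  ultimately have v0: "v0 \<noteq> 0" "app T v0 = v0" by auto
  then have Av0: "app ?A (scaleC c v0) = 0" for c by (simp add: appA Tc)
  have Rdiff: "x - y \<in> R" if "x \<in> R" "y \<in> R" for x y
    using that by (auto simp: R_def simp flip: app.diff_right)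
  have R0: "0 \<in> R" unfolding R_def by (metis app.zero_right rangeI)
  have Radd: "x + y \<in> R" if "x \<in> R" "y \<in> R" for x y
    using that by (auto simp: R_def simp flip: app.add_right)
  have Rsc: "scaleC c x \<in> R" if "x \<in> R" for c x
  proof -
    from that obtain u where "x = app ?A u" by (auto simp: R_def)
    then have "scaleC c x = app ?A (scaleC c u)" by (simp add: appA Tc scaleC.diff_right)
    then show ?thesis by (auto simp: R_def)
  qed
  have Rcl: "closed R" using cl[of 1] by (simp add: R_def)
  have Rv: "c = 0" if "scaleC c v0 \<in> R" for c
  proof -
    from that obtain u where u: "scaleC c v0 = app ?A u" by (auto simp: R_def)
    then have "app ?A (app ?A u) = 0" using Av0 by metis
    then obtain b where "u = scaleC b v0" using ker by blast
    then have "scaleC c v0 = 0" using u Av0 by simp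
    then show ?thesis using v0 norm_scaleC[of c v0] by simp
  qed
  have "v0 \<notin> R" using Rv[of 1] by auto
  \<comment> \<open>A lower bound for the distance from \<open>v0\<close> to the closed set
    \<open>R\<close>; its inverse will bound the functional \<open>f\<close>.\<close>
  then obtain d where d: "d > 0" "\<And>y. y \<in> R \<Longrightarrow> d \<le> dist y v0"
    using Rcl unfolding closed_def open_dist by (metis ComplI not_le ComplD)
  have dist: "cmod c * d \<le> norm (y - scaleC c v0)" if "y \<in> R" for c y
  proof (cases "c = 0")
    case False
    have "y - scaleC c v0 = scaleC c (scaleC (1/c) y - v0)" using False by (simp add: scaleC.diff_right)
    then have "norm (y - scaleC c v0) = cmod c * dist (scaleC (1/c) y) v0" by (simp add: norm_scaleC dist_norm)
    also have "\<dots> \<ge> cmod c * d" using that by (intro mult_left_mono d Rsc) auto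
    finally show ?thesis .
  qed simp
  obtain C where C: "C > 0" "\<And>y. y \<in> R \<Longrightarrow> \<exists>x. app ?A x = y \<and> norm x \<le> C * norm y"
    using bounded_preimage[OF bounded_linear_app Rcl[unfolded R_def]] by (auto simp: R_def)
  \<comment> \<open>The controlled preimage \<open>u\<close> of \<open>app ?A y\<close> differs from
    \<open>y\<close> by a multiple of \<open>v0\<close>, whose coefficient is at most
    \<open>norm u / d\<close> because \<open>y\<close> lies in \<open>R\<close>; this gives the
    factor \<open>1 + norm v0 / d\<close>.\<close>
  define c where "c = 1 / ((1 + norm v0 / d) * C)"
  have c: "c > 0" using C d by (auto simp: c_def intro!: mult_pos_pos add_pos_nonneg)
  have below: "c * norm y \<le> norm (app ?A y)" if y: "y \<in> R" for y
  proof -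
    have "app ?A y \<in> R" by (simp add: R_def)
    then obtain u where u: "app ?A u = app ?A y" "norm u \<le> C * norm (app ?A y)" using C by blast
    then have "app ?A (y - u) = 0" by (simp add: app.diff_right)
    then obtain b where b: "y - u = scaleC b v0" using ker1 by blast
    then have "u = y - scaleC b v0" by (simp add: algebra_simps)
    then have "cmod b * d \<le> norm u" using dist[OF y] by simp
    then have "cmod b * norm v0 \<le> norm u / d * norm v0" using d by (intro mult_right_mono) (auto simp: field_simps)
    moreover have "norm y \<le> norm u + cmod b * norm v0"
    proof -
      have "y = u + scaleC b v0" using b by (simp add: algebra_simps)
      then show ?thesis using norm_triangle_ineq[of u "scaleC b v0"] by (simp add: norm_scaleC)
    qed
    ultimately have "norm y \<le> (1 + norm v0 / d) * norm u" by (simp add: algebra_simps)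
    also have "\<dots> \<le> (1 + norm v0 / d) * (C * norm (app ?A y))" using u d by (intro mult_left_mono) auto
    finally have "norm y \<le> norm (app ?A y) * ((1 + norm v0 / d) * C)" by (simp only: mult_ac)
    moreover have "(1 + norm v0 / d) * C > 0" using C d by (intro mult_pos_pos add_pos_nonneg) auto
    ultimately show ?thesis by (simp only: c_def times_divide_eq_left mult_1_left pos_divide_le_eq)
  qed
  have AR: "\<exists>x\<in>R. app ?A x = y" if y: "y \<in> R" for y
  proof (rule preimage_of_operator_limit[OF _ Rcl Rdiff c below])
    \<comment> \<open>\<open>n + 2\<close> keeps \<open>\<epsilon> n\<close> strictly below
      \<open>e\<close> also for \<open>n = 0\<close>, inside the punctured disk of
      invertibility.\<close>
    define \<epsilon> where "\<epsilon> n = e / real (n + 2)" for n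
    have \<epsilon>: "\<epsilon> n > 0" "\<epsilon> n < e" for n using iso by (auto simp: \<epsilon>_def field_simps intro!: add_pos_nonneg)
    have "\<epsilon> \<longlonglongrightarrow> 0" unfolding \<epsilon>_def by real_asymp
    then have "(\<lambda>n. ?A - \<epsilon> n *\<^sub>R 1) \<longlonglongrightarrow> ?A - 0 *\<^sub>R 1" by (intro tendsto_intros)
    then show "(\<lambda>n. ?A - \<epsilon> n *\<^sub>R 1) \<longlonglongrightarrow> ?A" by simp
    fix n
    have eqn: "T - cs (1 + of_real (\<epsilon> n)) = ?A - \<epsilon> n *\<^sub>R 1"
      using cs_of_real[of "\<epsilon> n" 1] by (simp add: cs_add)
    have "invertible_endo (T - cs (1 + of_real (\<epsilon> n)))"
      by (rule iso(2)) (use \<epsilon>[of n] in simp_all)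
    then have "invertible_endo (?A - \<epsilon> n *\<^sub>R 1)" by (simp only: eqn)
    then obtain x where x: "app (?A - \<epsilon> n *\<^sub>R 1) x = y" using invertible_endoD(2) by blast
    \<comment> \<open>Solving the equation for \<open>\<epsilon> n *\<^sub>R x\<close> shows that a
      solution with right side in \<open>R\<close> lies in \<open>R\<close> itself.\<close>
    have "\<epsilon> n *\<^sub>R x = app ?A x - app (?A - \<epsilon> n *\<^sub>R 1) x"
      by (simp only: app.diff_left app.scaleR_left app_one) simp
    then have "\<epsilon> n *\<^sub>R x = app ?A x - y" by (simp only: x)
    then have "\<epsilon> n *\<^sub>R x \<in> R" using Rdiff[OF _ y, of "app ?A x"] by (simp add: R_def)
    then have "scaleC (of_real (1 / \<epsilon> n)) (\<epsilon> n *\<^sub>R x) \<in> R" by (rule Rsc)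
    then have "x \<in> R" using \<epsilon>[of n] by (simp add: scaleR_scaleC flip: of_real_mult)
    then show "\<exists>x\<in>R. app (?A - \<epsilon> n *\<^sub>R 1) x = y" using x by blast
  qed
  have ex: "\<exists>c. x - scaleC c v0 \<in> R" for x
  proof -
    have "app ?A x \<in> R" by (simp add: R_def)
    then obtain y where y: "y \<in> R" "app ?A y = app ?A x" using AR by blast
    then have "app ?A (x - y) = 0" by (simp add: app.diff_right)
    then obtain b where "x - y = scaleC b v0" using ker1 by blast
    then have "x - scaleC b v0 = y" by (simp add: algebra_simps)
    then show ?thesis using y by auto
  qed
  then obtain f where f: "\<And>x. x - scaleC (f x) v0 \<in> R" by metis
  have funi: "f x = c" if "x - scaleC c v0 \<in> R" for c x
  proof -
    have "(x - scaleC c v0) - (x - scaleC (f x) v0) \<in> R" using that f by (rule Rdiff)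
    then have "scaleC (f x - c) v0 \<in> R" by (simp add: scaleC.diff_left)
    then show ?thesis using Rv by fastforce
  qed
  have fsc: "f (scaleC c x) = c * f x" for c x
  proof (rule funi)
    have "scaleC c (x - scaleC (f x) v0) \<in> R" using f by (rule Rsc)
    then show "scaleC c x - scaleC (c * f x) v0 \<in> R" by (simp add: scaleC.diff_right)
  qed
  have bl: "bounded_linear f"
  proof (rule bounded_linear_intro[where K = "1/d"])
    fix x y show "f (x + y) = f x + f y"
    proof (rule funi)
      have "(x - scaleC (f x) v0) + (y - scaleC (f y) v0) \<in> R" using f f by (rule Radd)
      then show "x + y - scaleC (f x + f y) v0 \<in> R" by (simp add: scaleC.add_left algebra_simps)
    qed
  next
    fix r x show "f (r *\<^sub>R x) = r *\<^sub>R f x" by (simp add: scaleR_scaleC fsc scaleR_conv_of_real)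
  next
    fix x
    have "cmod (- f x) * d \<le> norm (x - scaleC (f x) v0 - scaleC (- f x) v0)" by (rule dist[OF f])
    then show "norm (f x) \<le> norm x * (1/d)" using d by (simp add: scaleC.minus_left field_simps)
  qed
  define \<phi> where "\<phi> = Blinfun f"
  have \<phi>: "blinfun_apply \<phi> = f" using bl by (simp add: \<phi>_def bounded_linear_Blinfun_apply)
  interpret f: bounded_linear f by (rule bl)
  have fv: "f v0 = 1" by (rule funi) (simp add: R0)
  have fR: "f x = 0" if "x \<in> R" for x by (rule funi) (simp add: that)
  have fT: "f (app T x) = f x" for x
  proof -
    have "f (app ?A x) = 0" by (rule fR) (simp add: R_def)
    then show ?thesis by (simp add: appA f.diff)
  qed
  have "bounded_linear (\<lambda>x. app T x - scaleC (f x) v0)"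
    by (intro bounded_linear_sub bounded_linear_app bounded_linear_compose[OF scaleC.bounded_linear_left bl])
  then obtain Q where Q: "app Q = (\<lambda>x. app T x - scaleC (f x) v0)" by (rule endo_of_bounded_linear)
  have fQ: "f (app Q x) = 0" for x by (simp add: Q f.diff fT fsc fv)
  have Qv: "app Q (scaleC c v0) = 0" for c by (simp add: Q Tc v0 fsc fv)
  have clQ: "clin Q" by (rule clinI) (simp add: Q Tc fsc scaleC.diff_right)
  have invT: "invertible_endo (T - cs z)" if z: "cmod z \<ge> 1" "z \<noteq> 1" for z
  proof (rule invertible_endo_of_bij)
    show inj: "x = 0" if "app (T - cs z) x = 0" for x
      using noev[OF z, of x] that by (simp add: app.diff_left)
    obtain c where c: "c > 0" "\<And>x. c * norm x \<le> norm (app (T - cs z) x)"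
      using bounded_below_of_inj[OF bounded_linear_app cl[OF z(1)] inj] by auto
    fix y
    have "\<exists>x\<in>UNIV. app (T - cs z) x = y"
    proof (rule preimage_of_operator_limit[of "\<lambda>n. Lm n - cs z"])
      show "(\<lambda>n. Lm n - cs z) \<longlonglongrightarrow> T - cs z" using lim by (intro tendsto_intros)
    qed (use c invertible_endoD(2)[OF inv[OF z(1)]] in auto)
    then show "\<exists>x. app (T - cs z) x = y" by auto
  qed
  have main: "invertible_endo (1 - cs z * Q)" if z: "cmod z \<le> 1" for z
  proof (cases "z = 0")
    case True then show ?thesis by (auto simp: invertible_endo_def intro: exI[of _ 1])
  next
    case z0: False
    define w where "w = 1 / z"
    have w: "cmod w \<ge> 1" "w \<noteq> 0" using z z0 by (auto simp: w_def norm_divide field_simps)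
    have zw: "z * w = 1" using z0 by (simp add: w_def)
    have E: "app (1 - cs z * Q) x = x - scaleC z (app Q x)" for x by (simp add: app.diff_left)
    show ?thesis
    proof (rule invertible_endo_of_bij)
      fix x assume "app (1 - cs z * Q) x = 0"
      then have x: "x = scaleC z (app Q x)" by (simp add: E)
      then have "f x = z * f (app Q x)" by (metis fsc)
      then have fx: "f x = 0" by (simp add: fQ)
      then have "x = scaleC z (app T x)" using x by (simp add: Q)
      then have Tx: "app T x = scaleC w x" using zw by (metis scaleC_scaleC scaleC_one mult.commute)
      show "x = 0"
      proof (cases "w = 1")
        case True
        then obtain b where "x = scaleC b v0" using ker1[of x] Tx by (auto simp: appA)
        then show ?thesis using fx by (simp add: fsc fv)
      qed (use noev w Tx in blast)
    next
      fix y
      \<comment> \<open>\<open>y\<close> is split into its part \<open>y'\<close> in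
        \<open>R\<close> and a multiple of \<open>v0\<close>; \<open>Q\<close> vanishes on the
        latter, which is therefore its own solution.\<close>
      define y' where "y' = y - scaleC (f y) v0"
      have fy': "f y' = 0" by (simp add: y'_def f.diff fsc fv)
      have y'R: "y' \<in> R" by (simp add: y'_def f)
      \<comment> \<open>For \<open>w = 1\<close> solvability inside \<open>R\<close> is used;
        otherwise \<open>T - cs w\<close> is invertible, and applying \<open>f\<close> to the
        equation forces \<open>f x = 0\<close>.\<close>
      have "\<exists>x. f x = 0 \<and> app (T - cs w) x = scaleC (- w) y'"
      proof (cases "w = 1")
        case True
        obtain x where "x \<in> R" "app ?A x = scaleC (- w) y'" using AR[OF Rsc[OF y'R]] by blast
        then show ?thesis using True fR by auto
      next
        case False
        then obtain x where x: "app (T - cs w) x = scaleC (- w) y'"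
          using invertible_endoD(2)[OF invT[OF w(1)]] by blast
        then have "f (app (T - cs w) x) = 0" by (simp add: fsc fy')
        then have "(1 - w) * f x = 0" by (simp add: app.diff_left f.diff fT fsc algebra_simps)
        then show ?thesis using False x by auto
      qed
      then obtain x where x: "f x = 0" "app T x - scaleC w x = scaleC (- w) y'" by (auto simp: app.diff_left)
      have "scaleC z (app T x - scaleC w x) = - y'" using zw by (simp add: x scaleC.minus_left scaleC.minus_right)
      then have "x - scaleC z (app Q x) = y'" using zw x(1) by (simp add: Q scaleC.diff_right algebra_simps)
      then have "(x - scaleC z (app Q x)) + scaleC (f y) v0 = y" by (simp only: y'_def) simp
      moreover have "app (1 - cs z * Q) (x + scaleC (f y) v0) = (x - scaleC z (app Q x)) + scaleC (f y) v0"
        by (simp add: E app.add_right Qv scaleC.zero_right)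
      ultimately have "app (1 - cs z * Q) (x + scaleC (f y) v0) = y" by simp
      then show "\<exists>x. app (1 - cs z * Q) x = y" by blast
    qed
  qed
  have "(\<lambda>n. Q ^ n) \<longlonglongrightarrow> 0" using powers_tendsto_zero[OF clQ main] .
  moreover have "invertible_endo (1 - Q)" using main[of 1] by simp
  ultimately show ?thesis
    using fv v0 fT by (intro exI[of _ \<phi>] exI[of _ Q]) (simp add: \<phi> Q clinear_functional_def fsc)
qed

subsection \<open>Finite Peano expansions at the origin\<close>

text \<open>This is an expansion of degree \<open>k\<close> at 0 with error o(t^k), see
  \<open>peano_iff_expansion\<close>. Recursion through the difference quotient \<open>h\<close>
  makes the closure properties plain inductions on the order.\<close>

primrec peano :: "nat \<Rightarrow> (real \<Rightarrow> 'a::real_normed_vector) \<Rightarrow> bool" where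
  "peano 0 g \<longleftrightarrow> isCont g 0"
| "peano (Suc k) g \<longleftrightarrow> (\<exists>h. peano k h \<and> (\<forall>t. g t = g 0 + t *\<^sub>R h t))"

text \<open>As a rewrite rule the quantified equation loops, since \<open>g 0\<close> is again an instance of \<open>g t\<close>.\<close>

declare peano.simps(2) [simp del]

lemma peano_SucE:
  assumes "peano (Suc k) g"
  obtains h where "peano k h" "\<And>t. g t = g 0 + t *\<^sub>R h t"
  using assms unfolding peano.simps(2) by blast

lemma peano_SucI: "peano k h \<Longrightarrow> (\<And>t. g t = g 0 + t *\<^sub>R h t) \<Longrightarrow> peano (Suc k) g"
  unfolding peano.simps(2) by blast

lemma isCont_iff_nhds: "isCont g a \<longleftrightarrow> (g \<longlongrightarrow> g a) (nhds a)"
  by (simp add: isCont_def tendsto_at_iff_tendsto_nhds)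

lemma isCont_iff_eventually_le:
  fixes g :: "'a::t2_space \<Rightarrow> 'b::real_normed_vector"
  shows "isCont g a \<longleftrightarrow> (\<forall>e>0. \<forall>\<^sub>F t in nhds a. norm (g t - g a) \<le> e)"
proof
  assume "isCont g a"
  then have "\<forall>\<^sub>F t in nhds a. dist (g t) (g a) < e" if "e > 0" for e
    using that by (simp add: isCont_iff_nhds tendsto_iff)
  then show "\<forall>e>0. \<forall>\<^sub>F t in nhds a. norm (g t - g a) \<le> e"
    unfolding dist_norm by (metis (mono_tags, lifting) eventually_mono less_imp_le)
next
  assume R: "\<forall>e>0. \<forall>\<^sub>F t in nhds a. norm (g t - g a) \<le> e"
  show "isCont g a"
    unfolding isCont_iff_nhds tendsto_iff dist_norm
  proof (intro allI impI)
    fix e :: real assume "e > 0"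
    then have "\<forall>\<^sub>F t in nhds a. norm (g t - g a) \<le> e/2" using R half_gt_zero by blast
    then show "\<forall>\<^sub>F t in nhds a. norm (g t - g a) < e" by eventually_elim (use \<open>e > 0\<close> in simp)
  qed
qed

lemma peano_isCont: "peano k g \<Longrightarrow> isCont g 0"
proof (induction k arbitrary: g)
  case (Suc k)
  then obtain h where h: "isCont h 0" "\<And>t. g t = g 0 + t *\<^sub>R h t" by (metis peano_SucE)
  have eq: "g = (\<lambda>t. g 0 + t *\<^sub>R h t)" by (rule ext) (rule h(2))
  have "isCont (\<lambda>t. g 0 + t *\<^sub>R h t) 0" using h(1) by (intro continuous_intros)
  then show ?case by (subst eq)
qed simp

lemma peano_Suc_imp: "peano (Suc k) g \<Longrightarrow> peano k g"
proof (induction k arbitrary: g)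
  case 0 show ?case using peano_isCont[OF 0] by simp
next
  case (Suc k)
  then show ?case unfolding peano.simps(2)[of "Suc k"] peano.simps(2)[of k] by blast
qed

lemma peano_mono: "peano k g \<Longrightarrow> j \<le> k \<Longrightarrow> peano j g"
  by (induction k) (auto simp del: peano.simps simp: le_Suc_eq dest: peano_Suc_imp)

lemma peano_const [simp, intro]: "peano k (\<lambda>_. c)"
  by (induction k arbitrary: c) (auto intro!: peano_SucI[where h="\<lambda>_. 0"])

lemma peano_linear:
  assumes "bounded_linear f"
  shows "peano k g \<Longrightarrow> peano k (\<lambda>t. f (g t))"
proof (induction k arbitrary: g)
  case 0 then show ?case using bounded_linear.isCont[OF assms] by simp
next
  case (Suc k)
  then obtain h where h: "peano k h" "\<And>t. g t = g 0 + t *\<^sub>R h t" by (metis peano_SucE)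
  interpret f: bounded_linear f by (rule assms)
  have "f (g t) = f (g 0) + t *\<^sub>R f (h t)" for t
    using h(2)[of t] by (metis f.add f.scaleR)
  with Suc.IH[OF h(1)] show ?case by (rule peano_SucI)
qed

lemma peano_add:
  "peano k f \<Longrightarrow> peano k g \<Longrightarrow> peano k (\<lambda>t. f t + g t)"
proof (induction k arbitrary: f g)
  case (Suc k)
  then obtain f' g' where h: "peano k f'" "peano k g'"
    "\<And>t. f t = f 0 + t *\<^sub>R f' t" "\<And>t. g t = g 0 + t *\<^sub>R g' t" by (metis peano_SucE)
  have "f t + g t = f 0 + g 0 + t *\<^sub>R (f' t + g' t)" for t
  proof -
    have "f t + g t = (f 0 + t *\<^sub>R f' t) + (g 0 + t *\<^sub>R g' t)" using h(3,4)[of t] by (rule arg_cong2)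
    then show ?thesis by (simp only: scaleR_add_right add_ac)
  qed
  with Suc.IH[OF h(1,2)] show ?case by (rule peano_SucI)
qed (simp add: continuous_add)

lemma peano_minus: "peano k g \<Longrightarrow> peano k (\<lambda>t. - g t)"
  by (rule peano_linear[OF bounded_linear_minus[OF bounded_linear_ident]])

lemma peano_diff: "peano k f \<Longrightarrow> peano k g \<Longrightarrow> peano k (\<lambda>t. f t - g t)"
  using peano_add[OF _ peano_minus] by fastforce

lemma peano_bilinear:
  assumes "bounded_bilinear pr"
  shows "peano k f \<Longrightarrow> peano k g \<Longrightarrow> peano k (\<lambda>t. pr (f t) (g t))"
proof (induction k arbitrary: f g)
  case 0
  then have "isCont f 0" "isCont g 0" by simp_all
  then have "isCont (\<lambda>t. pr (f t) (g t)) 0" by (rule bounded_bilinear.isCont[OF assms])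
  then show ?case by simp
next
  case (Suc k)
  then obtain f' g' where h: "peano k f'" "peano k g'"
    "\<And>t. f t = f 0 + t *\<^sub>R f' t" "\<And>t. g t = g 0 + t *\<^sub>R g' t" by (metis peano_SucE)
  interpret pr: bounded_bilinear pr by (rule assms)
  have "pr (f t) (g t) = pr (f 0) (g 0) + t *\<^sub>R (pr (f 0) (g' t) + pr (f' t) (g t))" for t
  proof -
    have "pr (f t) (g t) = pr (f 0) (g t) + t *\<^sub>R pr (f' t) (g t)"
      using h(3)[of t] by (metis pr.add_left pr.scaleR_left)
    also have "pr (f 0) (g t) = pr (f 0) (g 0) + t *\<^sub>R pr (f 0) (g' t)"
      using h(4)[of t] by (metis pr.add_right pr.scaleR_right)
    finally show ?thesis by (simp add: scaleR_add_right)
  qed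
  moreover have "peano k (\<lambda>t. pr (f 0) (g' t) + pr (f' t) (g t))"
    by (rule peano_add[OF Suc.IH[OF peano_const h(2)] Suc.IH[OF h(1) peano_Suc_imp[OF Suc.prems(2)]]])
  ultimately show ?case by (rule peano_SucI[rotated])
qed

text \<open>A factor that vanishes at 0 contributes a factor \<open>t\<close>, so the product has
  one order more than \<open>g\<close>. This gain drives all bootstraps below: inverse, power series
  and eigenvector.\<close>

lemma peano_bilinear_Suc:
  assumes "bounded_bilinear pr" "peano (Suc k) f" "f 0 = 0" "peano k g"
  shows "peano (Suc k) (\<lambda>t. pr (f t) (g t))"
proof -
  interpret pr: bounded_bilinear pr by (rule assms)
  obtain f' where f': "peano k f'" "\<And>t. f t = f 0 + t *\<^sub>R f' t" using peano_SucE[OF assms(2)] by blast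
  have "pr (f t) (g t) = pr (f 0) (g 0) + t *\<^sub>R pr (f' t) (g t)" for t
    using f'(2)[of t] assms(3) by (metis add_0 pr.scaleR_left pr.zero_left)
  with peano_bilinear[OF assms(1) f'(1) assms(4)] show ?thesis by (rule peano_SucI)
qed

lemma peano_cong:
  "peano k g \<Longrightarrow> \<forall>\<^sub>F t in nhds 0. f t = g t \<Longrightarrow> peano k f"
proof (induction k arbitrary: f g)
  case 0 then show ?case by (simp add: isCont_cong)
next
  case (Suc k)
  then obtain h where h: "peano k h" "\<And>t. g t = g 0 + t *\<^sub>R h t" by (metis peano_SucE)
  have fg: "f 0 = g 0" using Suc.prems(2) by (rule eventually_nhds_x_imp_x)
  \<comment> \<open>The quotient carries no information at 0, where the division yields 0, so the
    value of \<open>h\<close> is inserted.\<close>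
  define h' where "h' t = (if t = 0 then h 0 else (f t - f 0) /\<^sub>R t)" for t
  have "\<forall>\<^sub>F t in nhds 0. h' t = h t"
    using Suc.prems(2)
  proof eventually_elim
    case (elim t)
    have "f t - f 0 = t *\<^sub>R h t" using elim fg h(2)[of t] by (metis add_diff_cancel_left')
    then show ?case by (simp add: h'_def)
  qed
  then have "peano k h'" using Suc.IH[OF h(1)] by blast
  moreover have "f t = f 0 + t *\<^sub>R h' t" for t by (simp add: h'_def)
  ultimately show ?case by (rule peano_SucI)
qed

lemma peano_iff_expansion:
  "peano k g \<longleftrightarrow> (\<exists>c. c 0 = g 0 \<and> (\<forall>e>0. \<forall>\<^sub>F t in nhds 0. norm (g t - (\<Sum>j\<le>k. t ^ j *\<^sub>R c j)) \<le> e * \<bar>t\<bar> ^ k))"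
proof (induction k arbitrary: g)
  case 0
  show ?case by (auto simp: isCont_iff_eventually_le intro: exI[of _ "\<lambda>_. g 0"])
next
  case (Suc k)
  have shift: "(\<Sum>j\<le>Suc k. t ^ j *\<^sub>R c j) = c 0 + t *\<^sub>R (\<Sum>j\<le>k. t ^ j *\<^sub>R c (Suc j))" for c :: "nat \<Rightarrow> 'a" and t
    by (simp add: sum.atMost_Suc_shift scaleR_sum_right del: sum.atMost_Suc)
  show ?case
  proof
    assume "peano (Suc k) g"
    then obtain h where h: "peano k h" "\<And>t. g t = g 0 + t *\<^sub>R h t" by (metis peano_SucE)
    obtain c where c: "\<And>e. e > 0 \<Longrightarrow> \<forall>\<^sub>F t in nhds 0. norm (h t - (\<Sum>j\<le>k. t ^ j *\<^sub>R c j)) \<le> e * \<bar>t\<bar> ^ k"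
      using h(1)[unfolded Suc.IH] by blast
    define c' where "c' = case_nat (g 0) c"
    have eq: "g t - (\<Sum>j\<le>Suc k. t ^ j *\<^sub>R c' j) = t *\<^sub>R (h t - (\<Sum>j\<le>k. t ^ j *\<^sub>R c j))" for t
    proof -
      have "g t - g 0 = t *\<^sub>R h t" using h(2)[of t] by (metis add_diff_cancel_left')
      then show ?thesis unfolding shift by (simp add: c'_def scaleR_diff_right algebra_simps)
    qed
    have "\<forall>\<^sub>F t in nhds 0. norm (g t - (\<Sum>j\<le>Suc k. t ^ j *\<^sub>R c' j)) \<le> e * \<bar>t\<bar> ^ Suc k" if "e > 0" for e
      using c[OF that]
    proof eventually_elim
      case (elim t)
      show ?case unfolding eq using mult_left_mono[OF elim abs_ge_zero[of t]] by (simp add: mult_ac)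
    qed
    then show "\<exists>c. c 0 = g 0 \<and> (\<forall>e>0. \<forall>\<^sub>F t in nhds 0. norm (g t - (\<Sum>j\<le>Suc k. t ^ j *\<^sub>R c j)) \<le> e * \<bar>t\<bar> ^ Suc k)"
      by (intro exI[of _ c']) (auto simp: c'_def)
  next
    assume "\<exists>c. c 0 = g 0 \<and> (\<forall>e>0. \<forall>\<^sub>F t in nhds 0. norm (g t - (\<Sum>j\<le>Suc k. t ^ j *\<^sub>R c j)) \<le> e * \<bar>t\<bar> ^ Suc k)"
    then obtain c where c0: "c 0 = g 0" and
      c: "\<And>e. e > 0 \<Longrightarrow> \<forall>\<^sub>F t in nhds 0. norm (g t - (\<Sum>j\<le>Suc k. t ^ j *\<^sub>R c j)) \<le> e * \<bar>t\<bar> ^ Suc k"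
      by blast
    define h where "h t = (if t = 0 then c 1 else (g t - g 0) /\<^sub>R t)" for t
    have gh: "g t = g 0 + t *\<^sub>R h t" for t by (simp add: h_def)
    have eq: "g t - (\<Sum>j\<le>Suc k. t ^ j *\<^sub>R c j) = t *\<^sub>R (h t - (\<Sum>j\<le>k. t ^ j *\<^sub>R c (Suc j)))" for t
    proof -
      have "g t - g 0 = t *\<^sub>R h t" by (simp add: h_def)
      then show ?thesis unfolding shift by (simp add: c0 scaleR_diff_right algebra_simps)
    qed
    have "\<forall>\<^sub>F t in nhds 0. norm (h t - (\<Sum>j\<le>k. t ^ j *\<^sub>R c (Suc j))) \<le> e * \<bar>t\<bar> ^ k" if e: "e > 0" for e
      using c[OF that]
    proof eventually_elim
      case (elim t)
      show ?case
      proof (cases "t = 0")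
        case True
        have "(\<Sum>j\<le>k. (0::real) ^ j *\<^sub>R c (Suc j)) = c 1"
          by (induction k) auto
        then show ?thesis using True e by (simp add: h_def)
      next
        case False
        from elim have "\<bar>t\<bar> * norm (h t - (\<Sum>j\<le>k. t ^ j *\<^sub>R c (Suc j))) \<le> \<bar>t\<bar> * (e * \<bar>t\<bar> ^ k)"
          unfolding eq by (simp add: mult_ac)
        then show ?thesis using False by simp
      qed
    qed
    moreover have "h 0 = c (Suc 0)" by (simp add: h_def)
    ultimately have "peano k h" unfolding Suc.IH by (intro exI[of _ "\<lambda>j. c (Suc j)"]) auto
    then show "peano (Suc k) g" using gh by (rule peano_SucI)
  qed
qed

text \<open>Taylor's theorem with Peano remainder, by induction on the number \<open>k\<close> of
  remaining derivatives: the remainder of \<open>D m\<close> has the remainder of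
  \<open>D (Suc m)\<close> as its derivative, and the mean value inequality integrates the
  bound.\<close>

lemma peano_of_derivatives:
  fixes D :: "nat \<Rightarrow> real \<Rightarrow> 'a::real_normed_vector"
  assumes \<delta>: "\<delta> > 0"
    and der: "\<And>j t. j < s \<Longrightarrow> t \<in> {-\<delta>..\<delta>} \<Longrightarrow> (D j has_vector_derivative D (Suc j) t) (at t within {-\<delta>..\<delta>})"
    and cont: "continuous_on {-\<delta>..\<delta>} (D s)"
  shows "peano s (D 0)"
proof -
  have "\<forall>e>0. \<forall>\<^sub>F t in nhds 0. norm (D m t - (\<Sum>j\<le>k. (t ^ j / fact j) *\<^sub>R D (m + j) 0)) \<le> e * \<bar>t\<bar> ^ k"
    if "m + k = s" for m k
    using that
  proof (induction k arbitrary: m)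
    case 0
    have "isCont (D s) 0" using cont \<delta> by (simp add: continuous_on_interior)
    then show ?case using 0 by (simp add: isCont_iff_eventually_le)
  next
    case (Suc k)
    show ?case
    proof (intro allI impI)
      fix e :: real assume e: "e > 0"
      from Suc.IH[of "Suc m"] Suc.prems e
      have "\<forall>\<^sub>F t in nhds 0. norm (D (Suc m) t - (\<Sum>j\<le>k. (t ^ j / fact j) *\<^sub>R D (Suc m + j) 0)) \<le> e * \<bar>t\<bar> ^ k" by simp
      then obtain d where d: "d > 0" "\<And>t. \<bar>t\<bar> < d \<Longrightarrow>
          norm (D (Suc m) t - (\<Sum>j\<le>k. (t ^ j / fact j) *\<^sub>R D (Suc m + j) 0)) \<le> e * \<bar>t\<bar> ^ k"
        unfolding eventually_nhds_metric by (auto simp: dist_norm)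
      define R where "R t = D m t - (\<Sum>j\<le>Suc k. (t ^ j / fact j) *\<^sub>R D (m + j) 0)" for t
      have R0: "R 0 = 0"
        by (simp add: R_def sum.atMost_Suc_shift del: sum.atMost_Suc)
      have "norm (R t) \<le> e * \<bar>t\<bar> ^ Suc k" if t: "\<bar>t\<bar> < min d \<delta>" for t
      proof -
        let ?S = "{-\<bar>t\<bar>..\<bar>t\<bar>}"
        have derR: "(R has_derivative (\<lambda>x. x *\<^sub>R (D (Suc m) s - (\<Sum>j\<le>k. (s ^ j / fact j) *\<^sub>R D (Suc m + j) 0)))) (at s within ?S)"
          if s: "s \<in> ?S" for s
        proof -
          have "(D m has_vector_derivative D (Suc m) s) (at s within {-\<delta>..\<delta>})"
            using s t Suc.prems by (intro der) auto
          then have "(D m has_vector_derivative D (Suc m) s) (at s within ?S)"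
            by (rule has_vector_derivative_within_subset) (use t in auto)
          moreover have "((\<lambda>t. \<Sum>j\<le>Suc k. (t ^ j / fact j) *\<^sub>R D (m + j) 0) has_vector_derivative
              (\<Sum>j\<le>k. (s ^ j / fact j) *\<^sub>R D (Suc m + j) 0)) (at s within ?S)"
          proof -
            have pj: "((\<lambda>t. t ^ Suc j / fact (Suc j)) has_real_derivative s ^ j / fact j) (at s within ?S)" for j
            proof -
              have "((\<lambda>t. t ^ Suc j / fact (Suc j)) has_real_derivative (real (Suc j) * s ^ j) / fact (Suc j)) (at s within ?S)"
                by (rule derivative_eq_intros refl | simp)+
              moreover have "(real (Suc j) * s ^ j) / fact (Suc j) = s ^ j / fact j"
                by (simp add: field_simps del: of_nat_Suc)
              ultimately show ?thesis by simp
            qed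
            have "((\<lambda>t. \<Sum>j\<le>k. (t ^ Suc j / fact (Suc j)) *\<^sub>R D (m + Suc j) 0) has_vector_derivative
              (\<Sum>j\<le>k. (s ^ j / fact j) *\<^sub>R D (m + Suc j) 0)) (at s within ?S)"
            proof (intro has_vector_derivative_sum)
              fix j
              show "((\<lambda>t. (t ^ Suc j / fact (Suc j)) *\<^sub>R D (m + Suc j) 0) has_vector_derivative
                (s ^ j / fact j) *\<^sub>R D (m + Suc j) 0) (at s within ?S)"
                using has_vector_derivative_scaleR[OF pj has_vector_derivative_const, of j "D (m + Suc j) 0"] by simp
            qed
            then have "((\<lambda>t. D m 0 + (\<Sum>j\<le>k. (t ^ Suc j / fact (Suc j)) *\<^sub>R D (m + Suc j) 0)) has_vector_derivative
              0 + (\<Sum>j\<le>k. (s ^ j / fact j) *\<^sub>R D (m + Suc j) 0)) (at s within ?S)"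
              by (intro has_vector_derivative_add has_vector_derivative_const)
            then show ?thesis by (simp add: sum.atMost_Suc_shift del: sum.atMost_Suc)
          qed
          ultimately show ?thesis unfolding R_def has_vector_derivative_def[symmetric]
            by (rule has_vector_derivative_diff)
        qed
        have "norm (R t - R 0) \<le> (e * \<bar>t\<bar> ^ k) * norm (t - 0)"
        proof (rule differentiable_bound[OF _ derR])
          show "convex ?S" by simp
          fix s assume s: "s \<in> ?S"
          show "onorm (\<lambda>x. x *\<^sub>R (D (Suc m) s - (\<Sum>j\<le>k. (s ^ j / fact j) *\<^sub>R D (Suc m + j) 0))) \<le> e * \<bar>t\<bar> ^ k"
          proof (rule onorm_bound)
            fix x :: real
            have "norm (D (Suc m) s - (\<Sum>j\<le>k. (s ^ j / fact j) *\<^sub>R D (Suc m + j) 0)) \<le> e * \<bar>s\<bar> ^ k"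
              using s t by (intro d) auto
            also have "\<dots> \<le> e * \<bar>t\<bar> ^ k" using s e by (intro mult_left_mono power_mono) auto
            finally show "norm (x *\<^sub>R (D (Suc m) s - (\<Sum>j\<le>k. (s ^ j / fact j) *\<^sub>R D (Suc m + j) 0))) \<le> e * \<bar>t\<bar> ^ k * norm x"
              by (simp add: mult.commute[of _ "\<bar>x\<bar>"] mult_left_mono)
          qed (use e in simp)
        qed auto
        then show ?thesis using R0 by (simp add: mult_ac)
      qed
      then show "\<forall>\<^sub>F t in nhds 0. norm (D m t - (\<Sum>j\<le>Suc k. (t ^ j / fact j) *\<^sub>R D (m + j) 0)) \<le> e * \<bar>t\<bar> ^ Suc k"
        unfolding eventually_nhds_metric using d \<delta>
        by (intro exI[of _ "min d \<delta>"]) (auto simp: dist_norm R_def)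
    qed
  qed
  from this[of 0 s] show ?thesis
    unfolding peano_iff_expansion
    by (intro exI[of _ "\<lambda>j. (1 / fact j) *\<^sub>R D j 0"]) simp
qed

text \<open>Bootstrap through \<open>b' t = b - b * ((B t - B 0) * b' t)\<close>: the factor
  \<open>B t - B 0\<close> vanishes at 0, so each order of \<open>b'\<close> yields the next.
  Continuity starts the induction.\<close>

lemma peano_algebra_inverse:
  fixes B :: "real \<Rightarrow> 'a::{real_normed_algebra, banach, monoid_mult}"
  assumes B: "peano k B" and b: "B 0 * b = 1" "b * B 0 = 1"
  shows "\<exists>b'. b' 0 = b \<and> peano k b' \<and> (\<forall>\<^sub>F t in nhds 0. B t * b' t = 1 \<and> b' t * B t = 1)"
proof -
  define b' where "b' t = (SOME x. B t * x = 1 \<and> x * B t = 1)" for t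
  have cont: "(B \<longlongrightarrow> B 0) (nhds 0)"
    using peano_isCont[OF B] by (simp add: isCont_iff_nhds)
  have "((\<lambda>t. norm (B t - B 0) * norm b) \<longlongrightarrow> 0) (nhds 0)"
    using tendsto_mult_right[OF tendsto_norm_zero[OF LIM_zero[OF cont]], of "norm b"] by simp
  then have "\<forall>\<^sub>F t in nhds 0. norm (B t - B 0) * norm b < 1/2"
    by (rule order_tendstoD(2)) simp
  then have inv: "\<forall>\<^sub>F t in nhds 0. B t * b' t = 1 \<and> b' t * B t = 1"
  proof eventually_elim
    case (elim t)
    have "norm (B t - B 0) * norm b \<le> 1/2" using elim by simp
    from inverse_perturbation[OF b this] have "\<exists>x. B t * x = 1 \<and> x * B t = 1" by metis
    then show ?case unfolding b'_def by (rule someI_ex)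
  qed
  have "b' 0 = b"
    using eventually_nhds_x_imp_x[OF inv] b two_sided_inverse_unique by metis
  have eq: "\<forall>\<^sub>F t in nhds 0. b' t = b - b * ((B t - B 0) * b' t)"
    using inv by eventually_elim (simp add: algebra_simps b flip: mult.assoc)
  have "peano j b'" if "j \<le> k" for j
    using that
  proof (induction j)
    case 0
    have "(b' \<longlongrightarrow> b) (nhds 0)"
      by (rule tendsto_algebra_inverse[OF cont b]) (use inv in \<open>auto elim: eventually_mono\<close>)
    then show ?case using \<open>b' 0 = b\<close> by (simp add: isCont_iff_nhds)
  next
    case (Suc j)
    have "peano (Suc j) (\<lambda>t. B t - B 0)"
      by (intro peano_diff peano_const peano_mono[OF B]) (use Suc in simp)
    then have "peano (Suc j) (\<lambda>t. (B t - B 0) * b' t)"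
      using Suc by (intro peano_bilinear_Suc[OF bounded_bilinear_mult]) auto
    then have "peano (Suc j) (\<lambda>t. b - b * ((B t - B 0) * b' t))"
      by (intro peano_diff peano_const peano_linear[OF bounded_linear_mult_right])
    then show ?case using eq by (rule peano_cong)
  qed
  with inv \<open>b' 0 = b\<close> show ?thesis by blast
qed

text \<open>The induction runs over all shifted coefficient sequences \<open>a (n + m)\<close>:
  splitting off the first term leaves \<open>x t\<close> times the series shifted once more, and
  \<open>x\<close> vanishes at 0.\<close>

lemma peano_powser:
  fixes a :: "nat \<Rightarrow> complex"
  assumes s: "summable (\<lambda>n. a n * z0 ^ n)" "z0 \<noteq> 0"
    and x: "peano k x" "x 0 = 0"
  shows "peano k (\<lambda>t. \<Sum>n. a n * x t ^ n)"
proof -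
  have sm: "summable (\<lambda>n. a (n + m) * z0 ^ n)" for m
  proof -
    have "summable (\<lambda>n. a (n + m) * z0 ^ (n + m))" by (rule summable_ignore_initial_segment[OF s(1)])
    then have "summable (\<lambda>n. (a (n + m) * z0 ^ (n + m)) * (1 / z0 ^ m))" by (rule summable_mult2)
    then show ?thesis using s(2) by (simp add: power_add)
  qed
  have "peano j (\<lambda>t. \<Sum>n. a (n + m) * x t ^ n)" if "j \<le> k" for j m
    using that
  proof (induction j arbitrary: m)
    case 0
    have "isCont (\<lambda>z. \<Sum>n. a (n + m) * z ^ n) (x 0)"
      by (rule isCont_powser[OF sm]) (simp add: x s)
    moreover have "isCont x 0" using x by (simp add: peano_isCont)
    ultimately show ?case using isCont_o2 by auto
  next
    case (Suc j)
    have "(x \<longlongrightarrow> 0) (nhds 0)" using peano_isCont[OF x(1)] x(2) by (simp add: isCont_iff_nhds)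
    then have "\<forall>\<^sub>F t in nhds 0. norm (x t) < norm z0"
      using s(2) tendsto_norm_zero order_tendstoD(2) by (metis zero_less_norm_iff)
    then have eq: "\<forall>\<^sub>F t in nhds 0. (\<Sum>n. a (n + m) * x t ^ n) = a m + x t * (\<Sum>n. a (n + Suc m) * x t ^ n)"
    proof eventually_elim
      case (elim t)
      have s1: "summable (\<lambda>n. a (n + m) * x t ^ n)" for m
        by (rule powser_inside[OF sm elim])
      have "(\<Sum>n. a (n + m) * x t ^ n) = a m + (\<Sum>n. a (Suc n + m) * x t ^ Suc n)"
        using suminf_split_head[OF s1] by simp
      also have "(\<Sum>n. a (Suc n + m) * x t ^ Suc n) = (\<Sum>n. x t * (a (n + Suc m) * x t ^ n))"
        by (simp add: mult_ac)
      also have "\<dots> = x t * (\<Sum>n. a (n + Suc m) * x t ^ n)" by (rule suminf_mult[OF s1])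
      finally show ?case .
    qed
    have "peano (Suc j) (\<lambda>t. x t * (\<Sum>n. a (n + Suc m) * x t ^ n))"
      using Suc.IH[of "Suc m"] Suc.prems x
      by (intro peano_bilinear_Suc[OF bounded_bilinear_mult] peano_mono[OF x(1)]) simp_all
    then have "peano (Suc j) (\<lambda>t. a m + x t * (\<Sum>n. a (n + Suc m) * x t ^ n))"
      by (intro peano_add peano_const)
    then show ?case using eq by (rule peano_cong)
  qed
  from this[of k 0] show ?thesis by simp
qed

lemma peano_Ln:
  assumes "peano k g" "g 0 = 1"
  shows "peano k (\<lambda>t. Ln (g t))"
proof -
  \<comment> \<open>At \<open>n = 0\<close> the division by zero gives the coefficient 0, as the
    logarithm series requires.\<close>
  define a :: "nat \<Rightarrow> complex" where "a n = (-1) ^ Suc n / of_nat n" for n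
  define x where "x t = g t - 1" for t
  have x: "peano k x" "x 0 = 0" unfolding x_def using assms by (auto intro: peano_diff)
  have ser: "(\<lambda>n. a n * z ^ n) sums Ln (1 + z)" if "norm z < 1" for z :: complex
    using Ln_series[OF that] by (simp add: a_def)
  have "peano k (\<lambda>t. \<Sum>n. a n * x t ^ n)"
    using sums_summable[OF ser[of "1/2"]] x by (intro peano_powser[of a "1/2"]) auto
  moreover have "\<forall>\<^sub>F t in nhds 0. Ln (g t) = (\<Sum>n. a n * x t ^ n)"
  proof -
    have "(x \<longlongrightarrow> 0) (nhds 0)" using peano_isCont[OF x(1)] x(2) by (simp add: isCont_iff_nhds)
    then have "\<forall>\<^sub>F t in nhds 0. norm (x t) < 1"
      using tendsto_norm_zero order_tendstoD(2) zero_less_one by blast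
    then show ?thesis
      by eventually_elim (use ser in \<open>auto simp: sums_iff x_def\<close>)
  qed
  ultimately show ?thesis by (rule peano_cong)
qed

subsection \<open>Perturbation of the simple eigenvalue\<close>

lemma peano_clinear_apply: "peano k g \<Longrightarrow> peano k (\<lambda>t. blinfun_apply l (g t))"
  by (rule peano_linear[OF blinfun.bounded_linear_right])

lemma peano_locally_bounded:
  assumes "peano s g"
  shows "\<exists>B\<ge>0. \<forall>\<^sub>F t in nhds 0. norm (g t) \<le> B"
proof (intro exI[of _ "norm (g 0) + 1"] conjI)
  have "(g \<longlongrightarrow> g 0) (nhds 0)" using peano_isCont[OF assms] by (simp add: isCont_iff_nhds)
  then have "\<forall>\<^sub>F t in nhds 0. norm (g t) < norm (g 0) + 1"
    by (intro order_tendstoD(2)[OF tendsto_norm]) auto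
  then show "\<forall>\<^sub>F t in nhds 0. norm (g t) \<le> norm (g 0) + 1" by eventually_elim simp
qed simp

text \<open>With the normalisation \<open>\<phi> (w t) = 0\<close> the eigenvalue must be
  \<open>1 + \<phi> z\<close>, where \<open>z = app (E t) (v0 + w t)\<close>, and the eigenvalue
  equation becomes \<open>w - app Q w = app Pr z - scaleC (\<phi> z) w\<close>. Its right side is of
  the size of \<open>E t\<close>, so inverting \<open>1 - Q\<close> gives a contraction of the unit
  ball for small \<open>t\<close>.\<close>

lemma perturbed_eigenvector:
  fixes T Q :: "'b::complex_banach endo" and \<phi> :: "'b \<Rightarrow>\<^sub>L complex"
  assumes \<phi>: "clinear_functional \<phi>" "\<phi> v0 = 1"
    and T: "app T v0 = v0" "\<And>x. \<phi> (app T x) = \<phi> x"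
    and Q: "\<And>x. app Q x = app T x - scaleC (\<phi> x) v0" "invertible_endo (1 - Q)"
    and E: "peano s E" "E 0 = 0"
  shows "\<exists>w. peano s w \<and> w 0 = 0 \<and> (\<forall>\<^sub>F t in nhds 0. \<phi> (w t) = 0 \<and>
     app (T + E t) (v0 + w t) = scaleC (1 + \<phi> (app (E t) (v0 + w t))) (v0 + w t))"
proof -
  have \<phi>c: "\<phi> (scaleC c x) = c * \<phi> x" for c x using \<phi> by (simp add: clinear_functional_def)
  have \<phi>Q: "\<phi> (app Q x) = 0" for x by (simp add: Q T blinfun.diff_right \<phi>c \<phi>)
  obtain S where S: "(1 - Q) * S = 1" "S * (1 - Q) = 1" using Q(2) by (auto simp: invertible_endo_def)
  have S1: "app S x - app Q (app S x) = x" for x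
    using arg_cong[OF S(1), of "\<lambda>a. app a x"] by (simp add: app.diff_left)
  have \<phi>S: "\<phi> (app S x) = \<phi> x" for x
    using arg_cong[OF S1, of \<phi>] by (simp add: blinfun.diff_right \<phi>Q)
  have "bounded_linear (\<lambda>x. x - scaleC (\<phi> x) v0)"
    by (intro bounded_linear_sub bounded_linear_ident
        bounded_linear_compose[OF scaleC.bounded_linear_left blinfun.bounded_linear_right])
  then obtain Pr where Pr: "app Pr = (\<lambda>x. x - scaleC (\<phi> x) v0)" by (rule endo_of_bounded_linear)
  define G where "G A w = app S (app Pr (app A (v0 + w)) - scaleC (\<phi> (app A (v0 + w))) w)" for A w
  define n where "n = norm v0 + 1"
  \<comment> \<open>\<open>n\<close> bounds \<open>v0 + w\<close> on the unit ball. The first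
    summand covers the size and the Lipschitz constant of \<open>G A\<close>; the second gives
    \<open>cmod (\<phi> z) \<le> 1/2\<close> later, hence a nonzero eigenvalue.\<close>
  define K where "K = norm S * ((norm Pr + 2 * norm \<phi>) * n) + (norm \<phi> * n + 1)"
  have n1: "n \<ge> 1" by (simp add: n_def)
  have K1: "K \<ge> 1" using n1 by (simp add: K_def)
  have En: "norm (app A (v0 + w)) \<le> norm A * n" if "norm w \<le> 1" for A w
  proof -
    have "norm (app A (v0 + w)) \<le> norm A * norm (v0 + w)" by (rule norm_app)
    also have "\<dots> \<le> norm A * n"
      using that norm_triangle_ineq[of v0 w] by (intro mult_left_mono) (auto simp: n_def)
    finally show ?thesis .
  qed
  have G1: "norm (G A w) \<le> K * norm A" if w: "norm w \<le> 1" for A w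
  proof -
    have "norm (G A w) \<le> norm S * norm (app Pr (app A (v0 + w)) - scaleC (\<phi> (app A (v0 + w))) w)"
      unfolding G_def by (rule norm_app)
    also have "\<dots> \<le> norm S * (norm Pr * (norm A * n) + (norm \<phi> * (norm A * n)) * 1)"
    proof (intro mult_left_mono norm_ge_zero order_trans[OF norm_triangle_ineq4] add_mono)
      show "norm (app Pr (app A (v0 + w))) \<le> norm Pr * (norm A * n)"
        by (rule order_trans[OF norm_app]) (intro mult_left_mono En w norm_ge_zero)
      show "norm (scaleC (\<phi> (app A (v0 + w))) w) \<le> (norm \<phi> * (norm A * n)) * 1"
        unfolding norm_scaleC
      proof (rule mult_mono)
        show "cmod (\<phi> (app A (v0 + w))) \<le> norm \<phi> * (norm A * n)"
          by (rule order_trans[OF norm_blinfun]) (intro mult_left_mono En w norm_ge_zero)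
      qed (use w n1 in auto)
    qed
    also have "\<dots> = norm S * ((norm Pr + norm \<phi>) * n) * norm A" by (simp add: algebra_simps)
    also have "\<dots> \<le> K * norm A"
    proof (rule mult_right_mono)
      have "norm S * ((norm Pr + norm \<phi>) * n) \<le> norm S * ((norm Pr + 2 * norm \<phi>) * n)"
        using n1 by (intro mult_left_mono mult_right_mono) auto
      moreover have "0 \<le> norm \<phi> * n + 1" using n1 by simp
      ultimately show "norm S * ((norm Pr + norm \<phi>) * n) \<le> K" by (simp add: K_def)
    qed simp
    finally show ?thesis .
  qed
  have G2: "norm (G A w - G A w') \<le> K * norm A * norm (w - w')" if w: "norm w \<le> 1" "norm w' \<le> 1" for A w w'
  proof -
    have "G A w - G A w' = app S (app Pr (app A (w - w'))
       - (scaleC (\<phi> (app A (v0 + w))) (w - w') + scaleC (\<phi> (app A (w - w'))) w'))"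
      by (simp add: G_def app.add_right app.diff_right blinfun.diff_right blinfun.add_right
          scaleC.add_left scaleC.diff_left scaleC.diff_right)
    also have "norm \<dots> \<le> norm S * norm (app Pr (app A (w - w'))
       - (scaleC (\<phi> (app A (v0 + w))) (w - w') + scaleC (\<phi> (app A (w - w'))) w'))"
      by (rule norm_app)
    also have "\<dots> \<le> norm S * (norm Pr * (norm A * norm (w - w'))
        + ((norm \<phi> * (norm A * n)) * norm (w - w') + norm \<phi> * (norm A * norm (w - w')) * 1))"
    proof (intro mult_left_mono norm_ge_zero order_trans[OF norm_triangle_ineq4] add_mono order_trans[OF norm_triangle_ineq])
      show "norm (app Pr (app A (w - w'))) \<le> norm Pr * (norm A * norm (w - w'))"
        by (rule order_trans[OF norm_app]) (intro mult_left_mono norm_app norm_ge_zero)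
      show "norm (scaleC (\<phi> (app A (v0 + w))) (w - w')) \<le> (norm \<phi> * (norm A * n)) * norm (w - w')"
        unfolding norm_scaleC
        by (intro mult_right_mono order_trans[OF norm_blinfun] mult_left_mono En w norm_ge_zero)
      show "norm (scaleC (\<phi> (app A (w - w'))) w') \<le> norm \<phi> * (norm A * norm (w - w')) * 1"
        unfolding norm_scaleC
      proof (rule mult_mono)
        show "cmod (\<phi> (app A (w - w'))) \<le> norm \<phi> * (norm A * norm (w - w'))"
          by (intro order_trans[OF norm_blinfun] mult_left_mono norm_app norm_ge_zero)
      qed (use w in auto)
    qed
    also have "\<dots> = norm S * (norm Pr + norm \<phi> * n + norm \<phi>) * (norm A * norm (w - w'))"
      by (simp add: algebra_simps)
    also have "\<dots> \<le> K * (norm A * norm (w - w'))"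
    proof (intro mult_right_mono)
      have "norm Pr * 1 + norm \<phi> * n + norm \<phi> * 1 \<le> norm Pr * n + norm \<phi> * n + norm \<phi> * n"
        using n1 by (intro add_mono mult_left_mono) auto
      also have "\<dots> = (norm Pr + 2 * norm \<phi>) * n" by (simp add: algebra_simps)
      finally show "norm S * (norm Pr + norm \<phi> * n + norm \<phi>) \<le> K"
        using n1 unfolding K_def by (intro add_increasing2 mult_left_mono) auto
    qed simp
    finally show ?thesis by (simp add: mult_ac)
  qed
  have fix_ex: "\<exists>w. norm w \<le> 1 \<and> G A w = w" if A: "K * norm A \<le> 1/2" for A
  proof -
    have "\<exists>!w\<in>cball 0 1. G A w = w"
    proof (rule Banach_fix[where c="1/2", OF iffD2[OF complete_eq_closed closed_cball]])
      show "G A ` cball 0 1 \<subseteq> cball 0 1"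
      proof (rule image_subsetI)
        fix x :: 'b assume "x \<in> cball 0 1"
        then have "norm (G A x) \<le> K * norm A" by (intro G1) auto
        then show "G A x \<in> cball 0 1" using A by simp
      qed
      fix x y :: 'b assume xy: "x \<in> cball 0 1" "y \<in> cball 0 1"
      then have "norm (G A x - G A y) \<le> K * norm A * norm (x - y)" by (intro G2) auto
      also have "\<dots> \<le> 1/2 * norm (x - y)" by (intro mult_right_mono A) auto
      finally show "dist (G A x) (G A y) \<le> 1/2 * dist x y" by (simp add: dist_norm)
    qed auto
    then show ?thesis by auto
  qed
  define w where "w t = (SOME w. norm w \<le> 1 \<and> G (E t) w = w)" for t
  have w: "norm (w t) \<le> 1" "G (E t) (w t) = w t" if "K * norm (E t) \<le> 1/2" for t
    using someI_ex[OF fix_ex[OF that]] by (auto simp: w_def)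
  have w0: "w 0 = 0"
    using w(2)[of 0] E by (simp add: G_def app.zero_left app.zero_right blinfun.zero_right)
  have Elim: "((\<lambda>t. norm (E t)) \<longlongrightarrow> 0) (nhds 0)"
    using peano_isCont[OF E(1)] E(2) by (simp add: isCont_iff_nhds tendsto_norm_zero)
  have "((\<lambda>t. K * norm (E t)) \<longlongrightarrow> 0) (nhds 0)"
    using tendsto_mult_left[OF Elim, of K] by simp
  then have "\<forall>\<^sub>F t in nhds 0. K * norm (E t) < 1/2" by (rule order_tendstoD) simp
  then have ev: "\<forall>\<^sub>F t in nhds 0. K * norm (E t) \<le> 1/2" by eventually_elim simp
  have eqw: "\<forall>\<^sub>F t in nhds 0. w t = G (E t) (w t)" using ev by eventually_elim (simp add: w)
  have pw: "peano j w" if "j \<le> s" for j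
    using that
  proof (induction j)
    case 0
    have "(w \<longlongrightarrow> 0) (nhds 0)"
    proof (rule Lim_null_comparison)
      show "((\<lambda>t. K * norm (E t)) \<longlongrightarrow> 0) (nhds 0)" by fact
      show "\<forall>\<^sub>F t in nhds 0. norm (w t) \<le> K * norm (E t)"
        using ev
      proof eventually_elim
        case (elim t)
        show ?case using G1[OF w(1)[OF elim], of "E t"] w(2)[OF elim] by simp
      qed
    qed
    then show ?case by (simp add: isCont_iff_nhds w0)
  next
    case (Suc j)
    then have IH: "peano j w" by simp
    \<comment> \<open>Since \<open>E 0 = 0\<close>, order \<open>j\<close> of \<open>w\<close> gives
      order \<open>Suc j\<close> of this product; the fixed-point equation returns the gain to
      \<open>w\<close>.\<close>
    have EW: "peano (Suc j) (\<lambda>t. app (E t) (v0 + w t))"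
      using Suc by (intro peano_bilinear_Suc[OF bounded_bilinear_app peano_mono[OF E(1)] E(2)] peano_add peano_const IH) auto
    have "peano (Suc j) (\<lambda>t. scaleC (\<phi> (app (E t) (v0 + w t))) (w t))"
      by (intro peano_bilinear_Suc[OF bounded_bilinear_scaleC] peano_clinear_apply EW IH)
        (simp add: E app.zero_left blinfun.zero_right)
    then have "peano (Suc j) (\<lambda>t. G (E t) (w t))"
      unfolding G_def by (intro peano_linear[OF bounded_linear_app] peano_diff EW)
    then show ?case using eqw by (rule peano_cong)
  qed
  have "\<forall>\<^sub>F t in nhds 0. \<phi> (w t) = 0 \<and>
     app (T + E t) (v0 + w t) = scaleC (1 + \<phi> (app (E t) (v0 + w t))) (v0 + w t)"
    using ev
  proof eventually_elim
    case (elim t)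
    define z where "z = app (E t) (v0 + w t)"
    have wS: "w t = app S (app Pr z - scaleC (\<phi> z) (w t))"
      using w(2)[OF elim] by (simp add: G_def z_def)
    \<comment> \<open>The normalisation is not built into the fixed point: \<open>\<phi>\<close>
      annihilates \<open>app Pr z\<close> and is preserved by \<open>S\<close>, which leaves
      \<open>(1 + \<phi> z) * \<phi> (w t) = 0\<close>.\<close>
    have "\<phi> (w t) = \<phi> (app Pr z - scaleC (\<phi> z) (w t))"
      by (subst wS) (rule \<phi>S)
    then have "\<phi> (w t) = - (\<phi> z * \<phi> (w t))"
      by (simp add: blinfun.diff_right blinfun.add_right Pr \<phi>c \<phi>)
    then have "(1 + \<phi> z) * \<phi> (w t) = 0"
      by (simp only: distrib_right mult_1 eq_neg_iff_add_eq_0)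
    moreover have "1 + \<phi> z \<noteq> 0"
    proof
      assume "1 + \<phi> z = 0"
      then have "cmod (\<phi> z) = 1" by (metis add_eq_0_iff norm_minus_cancel norm_one)
      have "cmod (\<phi> z) \<le> norm \<phi> * (norm (E t) * n)"
        unfolding z_def by (intro order_trans[OF norm_blinfun] mult_left_mono En w elim norm_ge_zero)
      also have "\<dots> = norm \<phi> * n * norm (E t)" by simp
      also have "\<dots> \<le> K * norm (E t)"
        using n1 by (intro mult_right_mono) (auto simp: K_def)
      finally show False using elim \<open>cmod (\<phi> z) = 1\<close> by simp
    qed
    ultimately have \<phi>w: "\<phi> (w t) = 0" by simp
    have "w t - app Q (w t) = app Pr z - scaleC (\<phi> z) (w t)"
      by (subst (1 2) wS) (rule S1)
    then have Tw: "app T (w t) = w t - (z - scaleC (\<phi> z) v0 - scaleC (\<phi> z) (w t))"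
      by (simp add: Q \<phi>w Pr algebra_simps)
    have "app (T + E t) (v0 + w t) = v0 + app T (w t) + z"
      by (simp add: app.add_left app.add_right T z_def)
    also have "\<dots> = scaleC (1 + \<phi> z) (v0 + w t)"
      by (simp add: Tw scaleC.add_left scaleC.add_right algebra_simps)
    finally show ?case using \<phi>w by (simp add: z_def)
  qed
  with pw[of s] w0 show ?thesis by blast
qed

text \<open>The kernel of \<open>\<phi>\<close> need not be invariant under \<open>L t\<close>.
  Instead of perturbing \<open>\<phi>\<close>, the proof takes for \<open>D t\<close> the operator
  \<open>L t\<close> followed by the projection along \<open>vt t\<close>, and the vectors
  \<open>rest t N\<close> carry a multiple of \<open>vt t\<close> that corrects the difference.
  \<open>D t\<close> is close to \<open>Q\<close>, so its powers decay uniformly near 0.\<close>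

lemma perturbed_powers:
  fixes T Q :: "'b::complex_banach endo" and \<phi> l :: "'b \<Rightarrow>\<^sub>L complex" and L :: "real \<Rightarrow> 'b endo"
  assumes \<phi>: "clinear_functional \<phi>" "\<phi> v0 = 1"
    and T: "app (L 0) v0 = v0" "\<And>x. \<phi> (app (L 0) x) = \<phi> x"
    and Q: "\<And>x. app Q x = app (L 0) x - scaleC (\<phi> x) v0" "invertible_endo (1 - Q)" "(\<lambda>n. Q ^ n) \<longlonglongrightarrow> 0"
    and L: "peano s L" "\<And>t. clin (L t)"
    and l: "clinear_functional l"
  shows "\<exists>\<mu> Z C \<kappa>. peano s \<mu> \<and> \<mu> 0 = 1 \<and> peano s Z \<and> 0 < C \<and> 0 < \<kappa> \<and> \<kappa> < 1 \<and>
    (\<forall>\<^sub>F t in nhds 0. \<forall>N. cmod (l (app (L t ^ N) v) - \<mu> t ^ N * Z t) \<le> C * \<kappa> ^ N)"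
proof -
  have \<phi>c: "\<phi> (scaleC c x) = c * \<phi> x" for c x using \<phi> by (simp add: clinear_functional_def)
  have lc: "l (scaleC c x) = c * l x" for c x using l by (simp add: clinear_functional_def)
  have Lc: "app (L t) (scaleC c x) = scaleC c (app (L t) x)" for t c x using L(2) by (rule clin_app)
  define E where "E t = L t - L 0" for t
  have E: "peano s E" "E 0 = 0" unfolding E_def by (auto intro: peano_diff L)
  obtain w where w: "peano s w" "w 0 = 0" and wev: "\<forall>\<^sub>F t in nhds 0. \<phi> (w t) = 0 \<and>
     app (L 0 + E t) (v0 + w t) = scaleC (1 + \<phi> (app (E t) (v0 + w t))) (v0 + w t)"
    using perturbed_eigenvector[OF \<phi> T Q(1,2) E] by blast
  define vt where "vt t = v0 + w t" for t
  define \<mu> where "\<mu> t = 1 + \<phi> (app (E t) (vt t))" for t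
  have pvt: "peano s vt" unfolding vt_def by (intro peano_add peano_const w)
  have p\<mu>: "peano s \<mu>" unfolding \<mu>_def
    by (intro peano_add peano_const peano_clinear_apply peano_bilinear[OF bounded_bilinear_app] E pvt)
  have \<mu>0: "\<mu> 0 = 1" by (simp add: \<mu>_def E app.zero_left blinfun.zero_right)
  have eig: "\<forall>\<^sub>F t in nhds 0. \<phi> (vt t) = 1 \<and> app (L t) (vt t) = scaleC (\<mu> t) (vt t)"
    using wev by eventually_elim (simp add: vt_def \<mu>_def blinfun.add_right \<phi> E_def)
  have "\<exists>a. app a = (\<lambda>x. scaleC (\<phi> x) u)" for u
    using endo_of_bounded_linear[OF bounded_linear_compose[OF scaleC.bounded_linear_left blinfun.bounded_linear_right]]
    by metis
  then obtain rk where rk: "\<And>u x. app (rk u) x = scaleC (\<phi> x) u" by metis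
  have rk_lin: "bounded_linear rk"
  proof (rule bounded_linear_intro[where K = "norm \<phi>"])
    show "rk (x + y) = rk x + rk y" for x y
      by (rule endo_eqI) (simp add: rk app.add_left scaleC.add_right)
    show "rk (r *\<^sub>R x) = r *\<^sub>R rk x" for r x
      by (rule endo_eqI) (simp add: rk app.scaleR_left scaleC.scaleR_right)
    fix u
    show "norm (rk u) \<le> norm u * norm \<phi>"
      unfolding norm_endo.rep_eq
    proof (rule norm_blinfun_bound)
      fix x
      have "norm (scaleC (\<phi> x) u) \<le> norm u * norm \<phi> * norm x"
        using mult_right_mono[OF norm_blinfun[of \<phi> x] norm_ge_zero[of u]]
        by (simp add: norm_scaleC mult_ac)
      then show "norm (blinfun_apply (Rep_endo (rk u)) x) \<le> norm u * norm \<phi> * norm x"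
        using rk[of u x] by (simp add: app_def)
    qed simp
  qed
  have cs_lin: "bounded_linear (cs :: complex \<Rightarrow> 'b endo)"
  proof (rule bounded_linear_intro[where K = 1])
    show "cs (r *\<^sub>R x) = r *\<^sub>R (cs x :: 'b endo)" for r x
      using cs_of_real[of r "cs x"] by (simp add: scaleR_conv_of_real cs_mult)
  qed (use norm_cs in \<open>auto simp: cs_add\<close>)
  define D where "D t = L t - rk (vt t) * L t" for t
  have appD: "app (D t) x = app (L t) x - scaleC (\<phi> (app (L t) x)) (vt t)" for t x
    by (simp add: D_def app.diff_left rk)
  have pD: "peano s D" unfolding D_def
    by (intro peano_diff L peano_bilinear[OF bounded_bilinear_mult] peano_linear[OF rk_lin] pvt)
  have D0: "D 0 = Q" by (rule endo_eqI) (simp add: appD Q vt_def w T)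
  define y where "y t = v - scaleC (\<phi> v) (vt t)" for t
  have py: "peano s y" unfolding y_def
    by (intro peano_diff peano_const peano_linear[OF scaleC.bounded_linear_right] pvt)
  obtain b where b: "(1 - Q) * b = 1" "b * (1 - Q) = 1" using Q(2) by (auto simp: invertible_endo_def)
  have "peano s (\<lambda>t. cs (\<mu> t) - D t)" by (intro peano_diff peano_linear[OF cs_lin] p\<mu> pD)
  from peano_algebra_inverse[OF this, of b] b obtain B where B: "peano s B"
    "\<forall>\<^sub>F t in nhds 0. (cs (\<mu> t) - D t) * B t = 1 \<and> B t * (cs (\<mu> t) - D t) = 1"
    by (auto simp: \<mu>0 D0)
  \<comment> \<open>Near 0 this solves \<open>scaleC (\<mu> t) u - app (D t) u = y t\<close>; it
    supplies the correction to the coefficient of \<open>vt t\<close> in the spectral projection of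
    \<open>v\<close>.\<close>
  define u where "u t = app (B t) (y t)" for t
  have pu: "peano s u" unfolding u_def by (intro peano_bilinear[OF bounded_bilinear_app] B py)
  define Z where "Z t = (\<phi> v + \<phi> (app (L t) (u t))) * l (vt t)" for t
  have pZ: "peano s Z" unfolding Z_def
    by (intro peano_bilinear[OF bounded_bilinear_mult] peano_add peano_const peano_clinear_apply
        peano_bilinear[OF bounded_bilinear_app] L pu pvt)
  text \<open>the part of \<open>v\<close> killed by the spectral projection of \<open>L t\<close> at \<open>\<mu> t\<close>, propagated \<open>N\<close> times\<close>
  define rest where "rest t N = app (D t ^ N) (y t) - scaleC (\<phi> (app (L t) (app (D t ^ N) (u t)))) (vt t)" for t N
  have dec: "\<forall>\<^sub>F t in nhds 0. \<forall>N. l (app (L t ^ N) v) - \<mu> t ^ N * Z t = l (rest t N)"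
    using eig B(2)
  proof eventually_elim
    case (elim t)
    have uy: "y t = scaleC (\<mu> t) (u t) - app (D t) (u t)"
    proof -
      have "app ((cs (\<mu> t) - D t) * B t) (y t) = y t" using elim by simp
      then show ?thesis by (simp add: u_def app.diff_left)
    qed
    have Dc: "app (D t) (scaleC c x) = scaleC c (app (D t) x)" for c x
      by (simp add: appD Lc \<phi>c scaleC.diff_right)
    have DNc: "app (D t ^ N) (scaleC c x) = scaleC c (app (D t ^ N) x)" for c x N
      by (induction N) (simp_all add: Dc)
    \<comment> \<open>The equation for \<open>u\<close> makes the multiples of \<open>vt t\<close>
      combine, so that \<open>L t\<close> just advances the index; on \<open>vt t\<close> it
      multiplies by \<open>\<mu> t\<close>.\<close>
    have rS: "app (L t) (rest t N) = rest t (Suc N)" for N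
    proof -
      let ?a = "app (D t ^ N) (y t)" and ?c = "app (D t ^ N) (u t)"
      have a: "?a = scaleC (\<mu> t) ?c - app (D t) ?c"
        by (subst uy) (simp add: app.diff_right DNc flip: app_mult power_Suc2 power_Suc)
      have "app (L t) (rest t N) = app (L t) ?a - scaleC (\<mu> t * \<phi> (app (L t) ?c)) (vt t)"
        using elim by (simp add: rest_def app.diff_right Lc mult.commute)
      also have "app (L t) ?a = app (D t) ?a + scaleC (\<phi> (app (L t) ?a)) (vt t)" by (simp add: appD)
      also have "\<phi> (app (L t) ?a) = \<mu> t * \<phi> (app (L t) ?c) - \<phi> (app (L t) (app (D t) ?c))"
        by (subst a) (simp add: app.diff_right Lc blinfun.diff_right \<phi>c)
      finally show ?thesis by (simp add: rest_def scaleC.diff_left)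
    qed
    have LN: "app (L t ^ N) v = scaleC (\<mu> t ^ N * (\<phi> v + \<phi> (app (L t) (u t)))) (vt t) + rest t N" for N
    proof (induction N)
      case 0 show ?case by (simp add: rest_def y_def scaleC.add_left)
    next
      case (Suc N)
      have "app (L t ^ Suc N) v = app (L t) (app (L t ^ N) v)" by simp
      also have "\<dots> = scaleC (\<mu> t ^ N * (\<phi> v + \<phi> (app (L t) (u t)))) (scaleC (\<mu> t) (vt t)) + rest t (Suc N)"
        using elim by (simp only: Suc app.add_right Lc rS)
      finally show ?case by (simp add: mult_ac)
    qed
    show ?case by (simp add: LN blinfun.add_right lc Z_def)
  qed
  \<comment> \<open>1/4 at the origin leaves room for 1/2 in a neighbourhood.\<close>
  have "\<forall>\<^sub>F n in sequentially. norm (Q ^ n) < 1/4 \<and> n \<ge> 1"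
  proof -
    have "\<forall>\<^sub>F n in sequentially. dist (Q ^ n) 0 < 1/4" by (rule tendstoD[OF Q(3)]) simp
    with eventually_ge_at_top[of 1] show ?thesis by eventually_elim simp
  qed
  then obtain n where n: "norm (Q ^ n) < 1/4" "n \<ge> 1" using eventually_happens by force
  have cD: "(D \<longlongrightarrow> Q) (nhds 0)" using peano_isCont[OF pD] by (simp add: isCont_iff_nhds D0)
  have cDn: "((\<lambda>t. D t ^ m) \<longlongrightarrow> Q ^ m) (nhds 0)" for m
    by (induction m) (auto intro!: tendsto_mult cD)
  have "\<forall>\<^sub>F t in nhds 0. norm (D t ^ n) < 1/2"
    by (rule order_tendstoD(2)[OF tendsto_norm[OF cDn]]) (use n in simp)
  moreover have "\<forall>\<^sub>F t in nhds 0. norm (D t) < norm Q + 1"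
    by (rule order_tendstoD(2)[OF tendsto_norm[OF cD]]) simp
  ultimately have evD: "\<forall>\<^sub>F t in nhds 0. norm (D t ^ n) \<le> 1/2 \<and> norm (D t) \<le> norm Q + 1"
    by eventually_elim simp
  obtain C \<kappa> where C: "0 < C" "0 < \<kappa>" "\<kappa> < 1"
    and Cn: "\<forall>x\<in>{x :: 'b endo. norm (x ^ n) \<le> 1/2 \<and> norm x \<le> norm Q + 1}. \<forall>N. norm (x ^ N) \<le> C * \<kappa> ^ N"
    using uniform_power_decay[OF n(2), of "{x :: 'b endo. norm (x ^ n) \<le> 1/2 \<and> norm x \<le> norm Q + 1}" "norm Q + 1"]
    by blast
  obtain My where My: "My \<ge> 0" "\<forall>\<^sub>F t in nhds 0. norm (y t) \<le> My" using peano_locally_bounded[OF py] by auto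
  obtain Mu where Mu: "Mu \<ge> 0" "\<forall>\<^sub>F t in nhds 0. norm (u t) \<le> Mu" using peano_locally_bounded[OF pu] by auto
  obtain Mv where Mv: "Mv \<ge> 0" "\<forall>\<^sub>F t in nhds 0. norm (vt t) \<le> Mv" using peano_locally_bounded[OF pvt] by auto
  obtain BL where BL: "BL \<ge> 0" "\<forall>\<^sub>F t in nhds 0. norm (L t) \<le> BL" using peano_locally_bounded[OF L(1)] by auto
  define C' where "C' = norm l * (C * My + norm \<phi> * (BL * (C * Mu)) * Mv) + 1"
  have C': "C' > 0" using C My Mu Mv BL by (auto simp: C'_def intro!: add_nonneg_pos mult_nonneg_nonneg add_nonneg_nonneg)
  have "\<forall>\<^sub>F t in nhds 0. \<forall>N. cmod (l (app (L t ^ N) v) - \<mu> t ^ N * Z t) \<le> C' * \<kappa> ^ N"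
    using dec evD My(2) Mu(2) Mv(2) BL(2)
  proof eventually_elim
    case (elim t)
    show ?case
    proof
      fix N
      let ?k = "C * \<kappa> ^ N"
      have k: "norm (D t ^ N) \<le> ?k" using elim Cn by blast
      have k0: "?k \<ge> 0" using C by simp
      have 1: "norm (app (D t ^ N) (y t)) \<le> ?k * My"
        by (rule order_trans[OF norm_app]) (intro mult_mono k elim k0 norm_ge_zero)
      have 2: "norm (app (D t ^ N) (u t)) \<le> ?k * Mu"
        by (rule order_trans[OF norm_app]) (intro mult_mono k elim k0 norm_ge_zero)
      have 3: "norm (app (L t) (app (D t ^ N) (u t))) \<le> BL * (?k * Mu)"
        by (rule order_trans[OF norm_app]) (intro mult_mono 2 elim BL norm_ge_zero)
      have 4: "cmod (\<phi> (app (L t) (app (D t ^ N) (u t)))) \<le> norm \<phi> * (BL * (?k * Mu))"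
        by (rule order_trans[OF norm_blinfun]) (intro mult_left_mono 3 norm_ge_zero)
      have 5: "norm (scaleC (\<phi> (app (L t) (app (D t ^ N) (u t)))) (vt t)) \<le> norm \<phi> * (BL * (?k * Mu)) * Mv"
        unfolding norm_scaleC using k0 BL Mu
        by (intro mult_mono 4 elim norm_ge_zero mult_nonneg_nonneg) (use C in auto)
      have "norm (rest t N) \<le> ?k * My + norm \<phi> * (BL * (?k * Mu)) * Mv"
        unfolding rest_def by (rule order_trans[OF norm_triangle_ineq4 add_mono[OF 1 5]])
      then have "cmod (l (rest t N)) \<le> norm l * (?k * My + norm \<phi> * (BL * (?k * Mu)) * Mv)"
        by (intro order_trans[OF norm_blinfun] mult_left_mono) auto
      also have "\<dots> = (C' - 1) * \<kappa> ^ N" by (simp add: C'_def algebra_simps)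
      also have "\<dots> \<le> C' * \<kappa> ^ N" using C by (intro mult_right_mono) auto
      finally show "cmod (l (app (L t ^ N) v) - \<mu> t ^ N * Z t) \<le> C' * \<kappa> ^ N" using elim(1) by simp
    qed
  qed
  with p\<mu> \<mu>0 pZ C C' show ?thesis by blast
qed

section \<open>Uniform decay away from the origin, and use of the spectral hypotheses\<close>

lemma compact_uniform_decay:
  fixes L :: "real \<Rightarrow> 'b::banach endo"
  assumes L: "continuous_on UNIV L" and S: "compact S" and conv: "\<And>t. t \<in> S \<Longrightarrow> (\<lambda>n. L t ^ n) \<longlonglongrightarrow> 0"
  shows "\<exists>C \<kappa>. 0 < C \<and> 0 < \<kappa> \<and> \<kappa> < 1 \<and> (\<forall>t\<in>S. \<forall>N. norm (L t ^ N) \<le> C * \<kappa> ^ N)"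
proof -
  have Lc: "(L \<longlongrightarrow> L t) (nhds t)" for t
    using L by (simp add: continuous_on_eq_continuous_at isCont_def tendsto_at_iff_tendsto_nhds)
  \<comment> \<open>A power with norm below 1/4 at \<open>t\<close> stays below 1/2 on a
    neighbourhood, which controls all further powers there.\<close>
  have "\<exists>U C \<kappa>. open U \<and> t \<in> U \<and> 0 < C \<and> 0 < \<kappa> \<and> \<kappa> < 1 \<and> (\<forall>s\<in>U. \<forall>N. norm (L s ^ N) \<le> C * \<kappa> ^ N)"
    if t: "t \<in> S" for t
  proof -
    have "\<forall>\<^sub>F n in sequentially. dist (L t ^ n) 0 < 1/4" by (rule tendstoD[OF conv[OF t]]) simp
    with eventually_ge_at_top[of 1] have "\<forall>\<^sub>F n in sequentially. n \<ge> 1 \<and> norm (L t ^ n) < 1/4"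
      by eventually_elim simp
    then obtain n where n: "n \<ge> 1" "norm (L t ^ n) < 1/4" using eventually_happens by force
    have Ln: "((\<lambda>s. L s ^ m) \<longlongrightarrow> L t ^ m) (nhds t)" for m
      by (induction m) (auto intro!: tendsto_mult Lc)
    have "\<forall>\<^sub>F s in nhds t. norm (L s ^ n) < 1/2"
      by (rule order_tendstoD(2)[OF tendsto_norm[OF Ln]]) (use n in simp)
    moreover have "\<forall>\<^sub>F s in nhds t. norm (L s) < norm (L t) + 1"
      by (rule order_tendstoD(2)[OF tendsto_norm[OF Lc]]) simp
    ultimately have "\<forall>\<^sub>F s in nhds t. norm (L s ^ n) < 1/2 \<and> norm (L s) < norm (L t) + 1"
      by eventually_elim simp
    then obtain U where U: "open U" "t \<in> U" "\<And>s. s \<in> U \<Longrightarrow> norm (L s ^ n) < 1/2 \<and> norm (L s) < norm (L t) + 1"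
      unfolding eventually_nhds by blast
    from uniform_power_decay[OF n(1), of "L ` U" "norm (L t) + 1"] U(3)
    obtain C \<kappa> where "0 < C" "0 < \<kappa>" "\<kappa> < 1" "\<forall>x\<in>L ` U. \<forall>N. norm (x ^ N) \<le> C * \<kappa> ^ N"
      by (force simp: less_imp_le)
    with U show ?thesis by blast
  qed
  then obtain U C \<kappa> where U: "\<And>t. t \<in> S \<Longrightarrow> open (U t) \<and> t \<in> U t \<and> 0 < C t \<and> 0 < \<kappa> t \<and> \<kappa> t < 1
      \<and> (\<forall>s\<in>U t. \<forall>N. norm (L s ^ N) \<le> C t * (\<kappa> t :: real) ^ N)" by metis
  obtain D where D: "D \<subseteq> S" "finite D" "S \<subseteq> (\<Union>t\<in>D. U t)"
    by (rule compactE_image[OF S, of S U]) (use U in blast)+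
  define C' where "C' = (\<Sum>t\<in>D. C t) + 1"
  \<comment> \<open>Inserting 1/2 keeps the maximum meaningful for an empty cover, which can occur
    for empty \<open>S\<close>.\<close>
  define k where "k = Max (insert (1/2) (\<kappa> ` D))"
  have C': "C' > 0" unfolding C'_def using U D(1) by (intro add_nonneg_pos sum_nonneg) (auto simp: less_imp_le subset_iff)
  have k: "0 < k" "k < 1"
  proof -
    have "1/2 \<le> k" unfolding k_def by (intro Max_ge) (use D in auto)
    then show "0 < k" by linarith
    show "k < 1" unfolding k_def using D U by (subst Max_less_iff) auto
  qed
  have "norm (L s ^ N) \<le> C' * k ^ N" if s: "s \<in> S" for s N
  proof -
    obtain t where t: "t \<in> D" "s \<in> U t" using D s by blast
    then have tS: "t \<in> S" using D by blast
    have "norm (L s ^ N) \<le> C t * \<kappa> t ^ N" using U[OF tS] t by blast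
    also have "\<dots> \<le> C' * k ^ N"
    proof (intro mult_mono power_mono)
      have "C t \<le> (\<Sum>t\<in>D. C t)" by (rule member_le_sum) (use t D U in \<open>auto simp: less_imp_le subset_iff\<close>)
      then show "C t \<le> C'" by (simp add: C'_def)
      show "\<kappa> t \<le> k" unfolding k_def by (intro Max_ge) (use t D in auto)
    qed (use U[OF tS] C' in auto)
    finally show ?thesis .
  qed
  with C' k show ?thesis by blast
qed

lemma clin_Abs_endo: "clinear_op T \<Longrightarrow> clin (Abs_endo T)"
  by (rule clinI) (simp add: clinear_op_def)

lemma app_shift: "app (Abs_endo T - cs z) = shift_op T z"
  by (rule ext) (simp add: shift_op_def app.diff_left)

lemma invertible_of_not_spectrum:
  assumes "z \<notin> op_spectrum T"
  shows "invertible_endo (Abs_endo T - cs z)"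
proof -
  obtain S where S: "\<And>x. blinfun_apply S (shift_op T z x) = x" "\<And>x. shift_op T z (blinfun_apply S x) = x"
    using assms by (auto simp: op_spectrum_def)
  show ?thesis unfolding invertible_endo_def
    by (rule exI[of _ "Abs_endo S"]) (auto intro!: endo_eqI simp: app_shift S)
qed

text \<open>For \<open>z \<noteq> 0\<close> in the closed disk, \<open>1 / z\<close> lies outside
  the spectrum, and \<open>1 - cs z * Abs_endo T\<close> is a scalar multiple of
  \<open>Abs_endo T - cs (1/z)\<close>.\<close>

lemma powers_tendsto_zero_of_spectrum:
  assumes T: "clinear_op T" and sp: "op_spectrum T \<subseteq> {z. cmod z < 1}"
  shows "(\<lambda>n. Abs_endo T ^ n) \<longlonglongrightarrow> 0"
proof (rule powers_tendsto_zero[OF clin_Abs_endo[OF T]])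
  fix z :: complex assume z: "cmod z \<le> 1"
  show "invertible_endo (1 - cs z * Abs_endo T)"
  proof (cases "z = 0")
    case True then show ?thesis by (auto simp: invertible_endo_def intro: exI[of _ 1])
  next
    case False
    have "1 / z \<notin> op_spectrum T" using sp z False by (auto simp: norm_divide divide_less_eq)
    then obtain b where b: "(Abs_endo T - cs (1/z)) * b = 1" "b * (Abs_endo T - cs (1/z)) = 1"
      using invertible_of_not_spectrum by (auto simp: invertible_endo_def)
    have eq: "1 - cs z * Abs_endo T = cs (- z) * (Abs_endo T - cs (1/z))"
      using False by (intro endo_eqI) (simp add: app.diff_left scaleC.diff_right scaleC.minus_left)
    show ?thesis unfolding invertible_endo_def
    proof (intro exI[of _ "b * cs (- 1 / z)"] conjI)
      let ?A = "Abs_endo T - cs (1/z)"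
      have zz: "cs (- z) * cs (- 1 / z) = (1 :: 'a endo)" "cs (- 1 / z) * cs (- z) = (1 :: 'a endo)"
        using False by (simp_all flip: cs_mult)
      have "cs (- z) * ?A * (b * cs (- 1 / z)) = cs (- z) * (?A * b) * cs (- 1 / z)" by (simp only: mult.assoc)
      then show "(1 - cs z * Abs_endo T) * (b * cs (- 1 / z)) = 1" by (simp only: eq b zz mult_1_right)
      have "b * cs (- 1 / z) * (cs (- z) * ?A) = b * (cs (- 1 / z) * cs (- z)) * ?A" by (simp only: mult.assoc)
      then show "b * cs (- 1 / z) * (1 - cs z * Abs_endo T) = 1" by (simp only: eq b zz mult_1_right)
    qed
  qed
qed

lemma bounded_linear_Abs_endo: "bounded_linear (Abs_endo :: ('b::banach \<Rightarrow>\<^sub>L 'b) \<Rightarrow> 'b endo)"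
  by (rule bounded_linear_intro[where K=1]) (simp_all add: plus_endo.abs_eq scaleR_endo.abs_eq eq_onp_same_args)

lemmas continuous_on_Abs_endo = bounded_linear.continuous_on[OF bounded_linear_Abs_endo]

lemma leading_eigenvalue_expansion:
  fixes L :: "real \<Rightarrow> ('b::complex_banach \<Rightarrow>\<^sub>L 'b)" and l :: "'b \<Rightarrow>\<^sub>L complex"
  assumes lin_L: "\<And>t. clinear_op (L t)" and lin_l: "clinear_functional l"
    and A1_cont: "continuous_on UNIV L"
    and A1_diff: "\<exists>\<delta>>0. Ck_on s {-\<delta>..\<delta>} L"
    and A2_one: "op_eigenvalue (L 0) 1 \<and> isolated_in_spectrum (L 0) 1 \<and> simple_eigenvalue (L 0) 1"
    and A2_other: "\<And>z. op_eigenvalue (L 0) z \<Longrightarrow> z \<noteq> 1 \<Longrightarrow> cmod z < 1"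
    and A2_ess: "\<exists>\<rho><1. \<forall>z\<in>ess_spectrum (L 0). cmod z \<le> \<rho>"
    and A3: "\<And>t. t \<noteq> 0 \<Longrightarrow> op_spectrum (L t) \<subseteq> {z. cmod z < 1}"
  shows "\<exists>\<mu> Z C \<kappa>. peano s \<mu> \<and> \<mu> 0 = 1 \<and> peano s Z \<and> 0 < C \<and> 0 < \<kappa> \<and> \<kappa> < 1 \<and>
    (\<forall>\<^sub>F t in nhds 0. \<forall>N. cmod (l (opow (L t) N v) - \<mu> t ^ N * Z t) \<le> C * \<kappa> ^ N)"
proof -
  let ?T = "Abs_endo (L 0)"
  have sh: "(\<lambda>x. app ?T x - x) = shift_op (L 0) 1" by (rule ext) (simp add: shift_op_def)
  obtain x1 where x1: "x1 \<noteq> 0" "app ?T x1 = x1" using A2_one by (auto simp: op_eigenvalue_def)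
  obtain v0 where v0: "{x. \<exists>k. ((\<lambda>x. app ?T x - x) ^^ k) x = 0} = range (\<lambda>c. scaleC c v0)"
    using A2_one unfolding simple_eigenvalue_def sh by blast
  obtain e where e: "e > 0" "op_spectrum (L 0) \<inter> ball 1 e = {1}"
    using A2_one by (auto simp: isolated_in_spectrum_def)
  have "\<exists>\<phi> :: 'b \<Rightarrow>\<^sub>L complex. \<exists>Q. clinear_functional \<phi> \<and> \<phi> v0 = 1 \<and> app ?T v0 = v0
     \<and> (\<forall>x. \<phi> (app ?T x) = \<phi> x) \<and> (\<forall>x. app Q x = app ?T x - scaleC (\<phi> x) v0) \<and> (\<lambda>n. Q ^ n) \<longlonglongrightarrow> 0
     \<and> invertible_endo (1 - Q)"
  proof (rule spectral_gap[OF clin_Abs_endo[OF lin_L] x1 v0 _ _ e(1)])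
    fix z :: complex assume z: "1 \<le> cmod z"
    then have "z \<notin> ess_spectrum (L 0)" using A2_ess by force
    then show "closed (range (app (?T - cs z)))" by (simp add: ess_spectrum_def fredholm_def app_shift)
  next
    fix z x assume "1 \<le> cmod z" "z \<noteq> 1" "app ?T x = scaleC z x"
    then show "x = 0" using A2_other[of z] by (force simp: op_eigenvalue_def)
  next
    fix z :: complex assume z: "z \<noteq> 1" "cmod (z - 1) < e"
    then have "z \<in> ball 1 e" by (simp add: dist_norm norm_minus_commute[of 1 z])
    then have "z \<notin> op_spectrum (L 0)" using e(2) z(1) by blast
    then show "invertible_endo (?T - cs z)" by (rule invertible_of_not_spectrum)
  next
    have c: "continuous_on UNIV (\<lambda>t. Abs_endo (L t))" by (rule continuous_on_Abs_endo[OF A1_cont])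
    \<comment> \<open>The approximations of \<open>L 0\<close> are the operators \<open>L t\<close>
      at \<open>t = 1 / (n + 1)\<close>, to which (A3) applies because \<open>t\<close> is
      nonzero.\<close>
    have "(\<lambda>n. inverse (real (Suc n))) \<longlonglongrightarrow> 0" by (rule LIMSEQ_inverse_real_of_nat)
    then show "(\<lambda>n. Abs_endo (L (inverse (real (Suc n))))) \<longlonglongrightarrow> ?T"
      using c by (intro continuous_on_tendsto_compose[OF c]) auto
  next
    fix n and z :: complex assume z: "1 \<le> cmod z"
    have "z \<notin> op_spectrum (L (inverse (real (Suc n))))"
      using A3[of "inverse (real (Suc n))"] z by auto
    then show "invertible_endo (Abs_endo (L (inverse (real (Suc n)))) - cs z)" by (rule invertible_of_not_spectrum)
  qed
  then obtain \<phi> Q where \<phi>: "clinear_functional \<phi>" "\<phi> v0 = 1" "app ?T v0 = v0" "\<And>x. \<phi> (app ?T x) = \<phi> x"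
    "\<And>x. app Q x = app ?T x - scaleC (\<phi> x) v0" "(\<lambda>n. Q ^ n) \<longlonglongrightarrow> 0" "invertible_endo (1 - Q)"
    by blast
  obtain \<delta> D where D: "\<delta> > 0" "D 0 = L"
    "\<And>j t. j < s \<Longrightarrow> t \<in> {-\<delta>..\<delta>} \<Longrightarrow> (D j has_vector_derivative D (Suc j) t) (at t within {-\<delta>..\<delta>})"
    "continuous_on {-\<delta>..\<delta>} (D s)"
    using A1_diff unfolding Ck_on_def by blast
  have "peano s L" using peano_of_derivatives[OF D(1,3,4)] D(2) by simp
  then have "peano s (\<lambda>t. Abs_endo (L t))" by (rule peano_linear[OF bounded_linear_Abs_endo])
  from perturbed_powers[OF \<phi>(1-5,7,6) this clin_Abs_endo[OF lin_L] lin_l, of v] show ?thesis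
    by (simp flip: Abs_endo_opow)
qed

text \<open>\<open>N\<close> is cut into \<open>N mod k\<close> pieces of length
  \<open>N div k + 1\<close> and the others of length \<open>N div k\<close>. With \<open>b\<close>
  a negative power of the piece length this multiplies the decay exponent by \<open>k\<close>. One
  piece serves as first factor of each product, so that \<open>norm 1\<close> never appears.\<close>

lemma norm_power_le_of_pieces:
  fixes x :: "'a::{real_normed_algebra, monoid_mult}"
  assumes k: "k \<ge> 1" and B: "\<And>n. n = N div k \<or> n = Suc (N div k) \<Longrightarrow> norm (x ^ n) \<le> b" and b: "b \<ge> 0"
  shows "norm (x ^ N) \<le> b ^ k"
proof -
  let ?m = "N div k"
  have piece: "norm (x ^ (?m * (k - j) + Suc ?m * j)) \<le> b ^ k" if "j \<le> k" for j
  proof -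
    have p: "norm (y * (x ^ n) ^ i) \<le> norm y * b ^ i" if "n = ?m \<or> n = Suc ?m" for y n i
    proof (induction i)
      case (Suc i)
      have "norm (y * (x ^ n) ^ Suc i) \<le> norm (y * (x ^ n) ^ i) * norm (x ^ n)"
        by (simp only: power_Suc2 mult.assoc[symmetric] norm_mult_ineq)
      also have "\<dots> \<le> (norm y * b ^ i) * b" using b by (intro mult_mono Suc B that) auto
      finally show ?case by (simp add: mult_ac)
    qed simp
    show ?thesis
    proof (cases "j = k")
      case True
      have "norm (x ^ Suc ?m * (x ^ Suc ?m) ^ (k - 1)) \<le> norm (x ^ Suc ?m) * b ^ (k - 1)" by (rule p) simp
      also have "\<dots> \<le> b * b ^ (k - 1)" using b by (intro mult_right_mono B) auto
      also have "\<dots> = b ^ k" using k by (simp add: power_eq_if)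
      also have "x ^ Suc ?m * (x ^ Suc ?m) ^ (k - 1) = (x ^ Suc ?m) ^ k" using k by (metis power_eq_if not_one_le_zero)
      finally show ?thesis by (simp only: True diff_self_eq_0 mult_0_right add_0 power_mult)
    next
      case False
      then have "j < k" using that by simp
      then have e: "Suc (k - j - 1) = k - j" by simp
      have "norm (x ^ ?m * (x ^ ?m) ^ (k - j - 1)) \<le> norm (x ^ ?m) * b ^ (k - j - 1)" by (rule p) simp
      also have "\<dots> \<le> b * b ^ (k - j - 1)" using b by (intro mult_right_mono B) auto
      also have "\<dots> = b ^ (k - j)" by (simp only: e power_Suc[symmetric])
      also have "x ^ ?m * (x ^ ?m) ^ (k - j - 1) = (x ^ ?m) ^ (k - j)" by (simp only: e power_Suc[symmetric])
      finally have 1: "norm ((x ^ ?m) ^ (k - j)) \<le> b ^ (k - j)" .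
      have "norm ((x ^ ?m) ^ (k - j) * (x ^ Suc ?m) ^ j) \<le> norm ((x ^ ?m) ^ (k - j)) * b ^ j" by (rule p) simp
      also have "\<dots> \<le> b ^ (k - j) * b ^ j" using b by (intro mult_right_mono 1) auto
      also have "\<dots> = b ^ k" using \<open>j < k\<close> by (simp flip: power_add)
      finally show ?thesis by (simp only: power_add power_mult)
    qed
  qed
  have "?m * (k - N mod k) + Suc ?m * (N mod k) = ?m * (k - N mod k + N mod k) + N mod k"
    by (simp only: distrib_left mult_Suc)
  also have "\<dots> = N" using k by (simp add: less_imp_le)
  finally have N: "?m * (k - N mod k) + Suc ?m * (N mod k) = N" .
  show ?thesis using piece[of "N mod k"] k unfolding N by (simp add: less_imp_le)
qed

subsection \<open>Fourier inversion\<close>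

lemma measurable_cis [measurable (raw)]:
  "f \<in> borel_measurable M \<Longrightarrow> (\<lambda>x. cis (f x)) \<in> borel_measurable M"
  unfolding cis_conv_exp by measurable

lemma integrable_mult_cis:
  fixes a :: "'a \<Rightarrow> complex"
  assumes "integrable M a" "f \<in> borel_measurable M"
  shows "integrable M (\<lambda>x. a x * cis (f x))"
  by (rule Bochner_Integration.integrable_bound[OF assms(1)])
     (use assms in \<open>auto simp: norm_mult\<close>)

lemma Fubini_cis:
  fixes a :: "'a \<Rightarrow> complex" and F :: "real \<Rightarrow> complex"
  assumes M: "sigma_finite_measure M" and a: "integrable M a" and Y[measurable]: "Y \<in> borel_measurable M"
    and F: "integrable lborel F"
  shows "(LINT t|lborel. F t * (LINT w|M. a w * cis (t * Y w))) = (LINT w|M. a w * (LINT t|lborel. F t * cis (t * Y w)))"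
proof -
  interpret M: sigma_finite_measure M by (rule M)
  interpret P: pair_sigma_finite lborel M ..
  have [measurable]: "a \<in> borel_measurable M" "F \<in> borel_measurable lborel" using a F by auto
  have int: "integrable (lborel \<Otimes>\<^sub>M M) (case_prod (\<lambda>t w. F t * (a w * cis (t * Y w))))"
  proof (rule P.Fubini_integrable)
    show "integrable lborel (\<lambda>t. LINT w|M. cmod (case (t, w) of (t, w) \<Rightarrow> F t * (a w * cis (t * Y w))))"
      using F by (simp add: norm_mult)
    show "AE t in lborel. integrable M (\<lambda>w. case (t, w) of (t, w) \<Rightarrow> F t * (a w * cis (t * Y w)))"
      by (auto intro!: AE_I2 integrable_mult_right integrable_mult_cis a)
  qed measurable
  have "(LINT t|lborel. F t * (LINT w|M. a w * cis (t * Y w))) = (LINT t|lborel. (LINT w|M. F t * (a w * cis (t * Y w))))"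
    by simp
  also have "\<dots> = (LINT w|M. (LINT t|lborel. F t * (a w * cis (t * Y w))))"
    by (rule P.Fubini_integral[OF int, symmetric])
  also have "\<dots> = (LINT w|M. a w * (LINT t|lborel. F t * cis (t * Y w)))"
    by (subst mult.left_commute) simp
  finally show ?thesis .
qed

text \<open>Integrating \<open>g (x + 1) - g x\<close> over the line gives \<open>0\<close> on the one hand and, by Fubini,
  the integral of \<open>g'\<close> on the other; this needs no a priori decay of \<open>g\<close>.\<close>

lemma integral_derivative_eq_0:
  fixes g g' :: "real \<Rightarrow> complex"
  assumes g: "integrable lborel g" and g': "integrable lborel g'"
    and der: "\<And>x. (g has_vector_derivative g' x) (at x)" and cont: "continuous_on UNIV g'"
  shows "(LINT x|lborel. g' x) = 0"
proof -
  have [measurable]: "g' \<in> borel_measurable borel" using g' by auto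
  have int: "integrable (lborel \<Otimes>\<^sub>M lborel) (case_prod (\<lambda>u x. indicator {0..1} u *\<^sub>R g' (x + u)))"
  proof (rule lborel_pair.Fubini_integrable)
    have "(LINT x|lborel. norm (g' (x + u))) = (LINT x|lborel. norm (g' x))" for u
      using lborel_integral_real_affine[of 1 "\<lambda>x. norm (g' x)" u] by (simp add: add.commute)
    then show "integrable lborel (\<lambda>u. LINT x|lborel. norm (case (u, x) of (u, x) \<Rightarrow> indicator {0..1} u *\<^sub>R g' (x + u)))"
      by simp
    have "integrable lborel (\<lambda>x. g' (x + u))" for u
      using lborel_integrable_real_affine[OF g', of 1 u] by (simp add: add.commute)
    then show "AE u in lborel. integrable lborel (\<lambda>x. case (u, x) of (u, x) \<Rightarrow> indicator {0..1} u *\<^sub>R g' (x + u))"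
      by simp
  qed measurable
  have 1: "(LINT x|lborel. (LINT u|lborel. indicator {0..1} u *\<^sub>R g' (x + u))) = (LINT x|lborel. g (x + 1) - g x)"
  proof (rule Bochner_Integration.integral_cong[OF refl])
    fix x
    have "((\<lambda>u. g (x + u)) has_vector_derivative g' (x + u)) (at u within {0..1})" for u
    proof -
      have "((g \<circ> (\<lambda>u. x + u)) has_vector_derivative 1 *\<^sub>R g' (x + u)) (at u within {0..1})"
        by (rule vector_diff_chain_within)
          (auto intro!: derivative_eq_intros has_vector_derivative_at_within[OF der])
      then show ?thesis by (simp add: o_def)
    qed
    moreover have "continuous_on {0..1} (\<lambda>u. g' (x + u))"
      by (rule continuous_on_compose2[OF cont]) (auto intro!: continuous_intros)
    ultimately show "(LINT u|lborel. indicator {0..1} u *\<^sub>R g' (x + u)) = g (x + 1) - g x"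
      using integral_FTC_Icc[of 0 1 "\<lambda>u. g (x + u)" "\<lambda>u. g' (x + u)"] by simp
  qed
  have shift: "integrable lborel (\<lambda>x. g (x + 1))" "(LINT x|lborel. g (x + 1)) = (LINT x|lborel. g x)"
    using lborel_integrable_real_affine[OF g, of 1 1] lborel_integral_real_affine[of 1 g 1]
    by (simp_all add: add.commute)
  have 2: "(LINT u|lborel. (LINT x|lborel. indicator {0..1} u *\<^sub>R g' (x + u))) = (LINT x|lborel. g' x)"
  proof -
    have "(LINT x|lborel. g' (x + u)) = (LINT x|lborel. g' x)" for u
      using lborel_integral_real_affine[of 1 g' u] by (simp add: add.commute)
    then show ?thesis by simp
  qed
  have "(LINT x|lborel. g' x) = (LINT x|lborel. g (x + 1) - g x)"
    using lborel_pair.Fubini_integral[OF int] 1 2 by simp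
  also have "\<dots> = 0" using shift g by simp
  finally show ?thesis .
qed

text \<open>Integration by parts: the derivative of \<open>g x * cis (s * x)\<close> integrates to
  0, so no boundary terms arise.\<close>

lemma integral_derivative_mult_cis:
  fixes g g' :: "real \<Rightarrow> complex"
  assumes g: "integrable lborel g" and g': "integrable lborel g'"
    and der: "\<And>x. (g has_vector_derivative g' x) (at x)" and cont: "continuous_on UNIV g'"
  shows "(LINT x|lborel. g' x * cis (s * x)) = - \<i> * of_real s * (LINT x|lborel. g x * cis (s * x))"
proof -
  have cg: "continuous_on UNIV g"
    by (meson der continuous_at_imp_continuous_on has_vector_derivative_continuous)
  have cis_der: "((\<lambda>x. cis (s * x)) has_vector_derivative (\<i> * of_real s * cis (s * x))) (at x)" for x
  proof -
    have "((\<lambda>z. exp (\<i> * of_real s * z)) has_field_derivative \<i> * of_real s * exp (\<i> * of_real s * of_real x)) (at (of_real x))"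
      by (auto intro!: derivative_eq_intros)
    from has_vector_derivative_real_field[OF this]
    have "((\<lambda>x. exp (\<i> * of_real (s * x))) has_vector_derivative (\<i> * of_real s * exp (\<i> * of_real (s * x)))) (at x)"
      by (simp add: mult.assoc)
    then show ?thesis by (simp add: cis_conv_exp)
  qed
  have i1: "integrable lborel (\<lambda>x. g x * cis (s * x))" and i2: "integrable lborel (\<lambda>x. g' x * cis (s * x))"
    by (auto intro!: integrable_mult_cis g g')
  have "(LINT x|lborel. g' x * cis (s * x) + \<i> * of_real s * (g x * cis (s * x))) = 0"
  proof (rule integral_derivative_eq_0[OF i1])
    show "integrable lborel (\<lambda>x. g' x * cis (s * x) + \<i> * of_real s * (g x * cis (s * x)))"
      using i1 i2 by simp
    fix x
    show "((\<lambda>x. g x * cis (s * x)) has_vector_derivative g' x * cis (s * x) + \<i> * of_real s * (g x * cis (s * x))) (at x)"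
      using has_vector_derivative_mult[OF der cis_der, of x] by (simp add: mult_ac add.commute)
  next
    show "continuous_on UNIV (\<lambda>x. g' x * cis (s * x) + \<i> * of_real s * (g x * cis (s * x)))"
      unfolding cis_conv_exp by (intro continuous_intros cont cg)
  qed
  then show ?thesis using i1 i2 by (simp add: eq_neg_iff_add_eq_0)
qed

lemma integral_gaussian_cis:
  assumes a: "a > 0"
  shows "integrable lborel (\<lambda>t. complex_of_real (exp (- (a * t)\<^sup>2 / 2)))"
    and "(LINT t|lborel. of_real (exp (- (a * t)\<^sup>2 / 2)) * cis (t * s)) = of_real (sqrt (2 * pi) / a * exp (- (s / a)\<^sup>2 / 2))"
proof -
  have e: "exp (- (t\<^sup>2) / 2) = sqrt (2 * pi) * std_normal_density t" for t
    by (simp add: std_normal_density_def)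
  have i0: "integrable lborel (\<lambda>t. complex_of_real (exp (- (t\<^sup>2) / 2)))"
    unfolding e by simp
  show "integrable lborel (\<lambda>t. complex_of_real (exp (- (a * t)\<^sup>2 / 2)))"
    using lborel_integrable_real_affine[OF i0, of a 0] a by simp
  have c: "(LINT t|lborel. of_real (exp (- (t\<^sup>2) / 2)) * cis (t * y)) = of_real (sqrt (2 * pi) * exp (- y\<^sup>2 / 2))" for y
  proof -
    have "complex_of_real (exp (- (y\<^sup>2) / 2)) = char std_normal_distribution y"
      by (simp add: char_std_normal_distribution)
    also have "\<dots> = (LINT t|lborel. std_normal_density t *\<^sub>R iexp (y * t))"
      unfolding char_def by (subst integral_density) auto
    also have "\<dots> = (LINT t|lborel. of_real (std_normal_density t) * cis (t * y))"
      by (simp add: cis_conv_exp scaleR_conv_of_real mult_ac)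
    finally have "(LINT t|lborel. of_real (std_normal_density t) * cis (t * y)) = complex_of_real (exp (- (y\<^sup>2) / 2))" ..
    then show ?thesis unfolding e by (simp add: mult.assoc)
  qed
  have "(LINT t|lborel. of_real (exp (- (t\<^sup>2) / 2)) * cis (t * (s / a)))
     = a *\<^sub>R (LINT t|lborel. of_real (exp (- (a * t)\<^sup>2 / 2)) * cis (a * t * (s / a)))"
    using lborel_integral_real_affine[of a "\<lambda>t. of_real (exp (- (t\<^sup>2) / 2)) * cis (t * (s / a))" 0] a by simp
  then have "a *\<^sub>R (LINT t|lborel. of_real (exp (- (a * t)\<^sup>2 / 2)) * cis (t * s)) = complex_of_real (sqrt (2 * pi) * exp (- (s / a)\<^sup>2 / 2))"
    using a c[of "s / a"] by (simp add: mult_ac)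
  then have "(1 / a) *\<^sub>R (a *\<^sub>R (LINT t|lborel. of_real (exp (- (a * t)\<^sup>2 / 2)) * cis (t * s))) = (1 / a) *\<^sub>R complex_of_real (sqrt (2 * pi) * exp (- (s / a)\<^sup>2 / 2))"
    by simp
  then show "(LINT t|lborel. of_real (exp (- (a * t)\<^sup>2 / 2)) * cis (t * s)) = of_real (sqrt (2 * pi) / a * exp (- (s / a)\<^sup>2 / 2))"
    using a by (simp add: scaleR_conv_of_real)
qed

text \<open>Without a normalising factor, so inversion produces \<open>2 * pi\<close>.\<close>

definition fourier :: "(real \<Rightarrow> complex) \<Rightarrow> real \<Rightarrow> complex" where
  "fourier f t = (LINT x|lborel. f x * cis (- t * x))"

lemma norm_fourier_le: "integrable lborel f \<Longrightarrow> cmod (fourier f t) \<le> (LINT x|lborel. cmod (f x))"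
  unfolding fourier_def
  by (rule order_trans[OF integral_norm_bound]) (simp add: norm_mult)

lemma measurable_fourier:
  assumes "integrable lborel f"
  shows "fourier f \<in> borel_measurable borel"
proof -
  have [measurable]: "f \<in> borel_measurable borel" using assms by auto
  have "(\<lambda>t. LINT x|lborel. f x * cis (- t * x)) \<in> borel_measurable borel" by measurable
  then show ?thesis by (simp add: fourier_def[abs_def])
qed

text \<open>The factor \<open>exp (- (a t)\<^sup>2 / 2)\<close> makes Fubini applicable; it is removed by \<open>a \<rightarrow> 0\<close>.\<close>

lemma fourier_inversion:
  fixes f :: "real \<Rightarrow> complex"
  assumes f: "integrable lborel f" and cont: "continuous_on UNIV f" and bdd: "\<And>x. cmod (f x) \<le> B"
    and F: "integrable lborel (fourier f)"
  shows "(LINT t|lborel. fourier f t * cis (t * x)) = of_real (2 * pi) * f x"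
proof -
  define a where "a n = 1 / real (Suc n)" for n
  have a: "a n > 0" for n by (simp add: a_def)
  have a0: "a \<longlonglongrightarrow> 0" unfolding a_def using LIMSEQ_inverse_real_of_nat by (simp add: inverse_eq_divide)
  have [measurable]: "f \<in> borel_measurable borel" "fourier f \<in> borel_measurable borel"
    using f F by auto
  define J where "J n = (LINT t|lborel. of_real (exp (- (a n * t)\<^sup>2 / 2)) * (fourier f t * cis (t * x)))" for n
  have lim1: "J \<longlonglongrightarrow> (LINT t|lborel. fourier f t * cis (t * x))"
    unfolding J_def
  proof (rule integral_dominated_convergence[where w = "\<lambda>t. cmod (fourier f t)"])
    show "AE t in lborel. (\<lambda>n. of_real (exp (- (a n * t)\<^sup>2 / 2)) * (fourier f t * cis (t * x))) \<longlonglongrightarrow> fourier f t * cis (t * x)"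
    proof (rule AE_I2)
      fix t
      have "(\<lambda>n. complex_of_real (exp (- (a n * t)\<^sup>2 / 2)) * (fourier f t * cis (t * x))) \<longlonglongrightarrow> of_real (exp (- (0 * t)\<^sup>2 / 2)) * (fourier f t * cis (t * x))"
        by (intro tendsto_intros a0) simp
      then show "(\<lambda>n. complex_of_real (exp (- (a n * t)\<^sup>2 / 2)) * (fourier f t * cis (t * x))) \<longlonglongrightarrow> fourier f t * cis (t * x)" by simp
    qed
    show "AE t in lborel. cmod (of_real (exp (- (a n * t)\<^sup>2 / 2)) * (fourier f t * cis (t * x))) \<le> cmod (fourier f t)" for n
      by (auto simp: norm_mult intro!: mult_left_le_one_le)
  qed (use F in auto)
  \<comment> \<open>Fubini evaluates the Gaussian integral in \<open>t\<close>; substituting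
    \<open>y = x + a n * z\<close> turns the outcome into a Gaussian average of \<open>f\<close>
    around \<open>x\<close> at scale \<open>a n\<close>.\<close>
  have J: "J n = of_real (sqrt (2 * pi)) * (LINT z|lborel. f (x + a n * z) * of_real (exp (- z\<^sup>2 / 2)))" for n
  proof -
    have "J n = (LINT t|lborel. of_real (exp (- (a n * t)\<^sup>2 / 2)) * (LINT y|lborel. f y * cis (t * (x - y))))"
      unfolding J_def
    proof (rule Bochner_Integration.integral_cong[OF refl])
      fix t
      have "fourier f t * cis (t * x) = (LINT y|lborel. f y * cis (- t * y) * cis (t * x))"
        by (simp add: fourier_def)
      also have "\<dots> = (LINT y|lborel. f y * cis (t * (x - y)))"
        by (simp add: cis_mult mult.assoc algebra_simps)
      finally show "of_real (exp (- (a n * t)\<^sup>2 / 2)) * (fourier f t * cis (t * x))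
        = of_real (exp (- (a n * t)\<^sup>2 / 2)) * (LINT y|lborel. f y * cis (t * (x - y)))" by simp
    qed
    also have "\<dots> = (LINT y|lborel. f y * (LINT t|lborel. of_real (exp (- (a n * t)\<^sup>2 / 2)) * cis (t * (x - y))))"
      by (rule Fubini_cis[OF lborel.sigma_finite_measure_axioms f _ integral_gaussian_cis(1)[OF a]]) simp
    also have "\<dots> = (LINT y|lborel. f y * of_real (sqrt (2 * pi) / a n * exp (- ((x - y) / a n)\<^sup>2 / 2)))"
      by (subst integral_gaussian_cis(2)[OF a]) simp
    also have "\<dots> = \<bar>a n\<bar> *\<^sub>R (LINT z|lborel. f (x + a n * z) * of_real (sqrt (2 * pi) / a n * exp (- ((x - (x + a n * z)) / a n)\<^sup>2 / 2)))"
      using a[of n] by (subst lborel_integral_real_affine[where c = "a n" and t = x]) auto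
    also have "\<dots> = (LINT z|lborel. a n *\<^sub>R (f (x + a n * z) * of_real (sqrt (2 * pi) / a n * exp (- ((x - (x + a n * z)) / a n)\<^sup>2 / 2))))"
      using a[of n] by simp
    also have "\<dots> = (LINT z|lborel. of_real (sqrt (2 * pi)) * (f (x + a n * z) * of_real (exp (- z\<^sup>2 / 2))))"
      using a[of n] by (intro Bochner_Integration.integral_cong[OF refl]) (simp add: scaleR_conv_of_real field_simps)
    finally show ?thesis by simp
  qed
  have lim2: "(\<lambda>n. LINT z|lborel. f (x + a n * z) * of_real (exp (- z\<^sup>2 / 2))) \<longlonglongrightarrow> (LINT z|lborel. f x * of_real (exp (- z\<^sup>2 / 2)))"
  proof (rule integral_dominated_convergence[where w = "\<lambda>z. B * exp (- z\<^sup>2 / 2)"])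
    have "integrable lborel (\<lambda>t. Re (complex_of_real (exp (- (1 * t)\<^sup>2 / 2))))"
      by (rule integrable_Re[OF integral_gaussian_cis(1)]) simp
    then show "integrable lborel (\<lambda>z. B * exp (- z\<^sup>2 / 2))" by simp
    show "AE z in lborel. (\<lambda>n. f (x + a n * z) * of_real (exp (- z\<^sup>2 / 2))) \<longlonglongrightarrow> f x * of_real (exp (- z\<^sup>2 / 2))"
    proof (rule AE_I2)
      fix z
      have "(\<lambda>n. x + a n * z) \<longlonglongrightarrow> x + 0 * z" by (intro tendsto_intros a0)
      then have "(\<lambda>n. f (x + a n * z)) \<longlonglongrightarrow> f x"
        using cont by (intro continuous_on_tendsto_compose[OF cont]) auto
      then show "(\<lambda>n. f (x + a n * z) * complex_of_real (exp (- z\<^sup>2 / 2))) \<longlonglongrightarrow> f x * of_real (exp (- z\<^sup>2 / 2))"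
        by (intro tendsto_intros)
    qed
    show "AE z in lborel. cmod (f (x + a n * z) * of_real (exp (- z\<^sup>2 / 2))) \<le> B * exp (- z\<^sup>2 / 2)" for n
      by (auto simp: norm_mult intro!: mult_right_mono bdd)
  qed auto
  have g: "(LINT z|lborel. complex_of_real (exp (- z\<^sup>2 / 2))) = of_real (sqrt (2 * pi))"
    using integral_gaussian_cis(2)[of 1 0] by simp
  then have gR: "(LINT z|lborel. exp (- z\<^sup>2 / 2)) = sqrt (2 * pi)"
    by (simp only: integral_complex_of_real of_real_eq_iff)
  have "(LINT z|lborel. f x * of_real (exp (- z\<^sup>2 / 2))) = f x * of_real (sqrt (2 * pi))"
    by (simp only: integral_mult_right_zero integral_complex_of_real gR)
  then have "J \<longlonglongrightarrow> of_real (sqrt (2 * pi)) * (f x * of_real (sqrt (2 * pi)))"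
    using tendsto_mult_left[OF lim2, of "of_real (sqrt (2 * pi))"] by (simp only: J[abs_def])
  moreover have "of_real (sqrt (2 * pi)) * (f x * of_real (sqrt (2 * pi))) = of_real (2 * pi) * f x"
    by (simp add: mult_ac flip: of_real_mult mult.assoc)
  ultimately show ?thesis using LIMSEQ_unique[OF lim1] by metis
qed

text \<open>The weight \<open>a\<close> lets one identity serve twice: with weight 1 on the
  probability space it gives the expectation, and with a polynomial times the Gaussian on the line
  it gives the terms of the expansion.\<close>

lemma integral_weight_eq_fourier:
  fixes a :: "'a \<Rightarrow> complex"
  assumes M: "sigma_finite_measure M" and a: "integrable M a" and Y: "Y \<in> borel_measurable M"
    and f: "integrable lborel f" "continuous_on UNIV f" "\<And>x. cmod (f x) \<le> B" "integrable lborel (fourier f)"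
  shows "of_real (2 * pi) * (LINT w|M. a w * f (Y w)) = (LINT t|lborel. fourier f t * (LINT w|M. a w * cis (t * Y w)))"
proof -
  have "(LINT t|lborel. fourier f t * (LINT w|M. a w * cis (t * Y w)))
      = (LINT w|M. a w * (LINT t|lborel. fourier f t * cis (t * Y w)))"
    by (rule Fubini_cis[OF M a Y f(4)])
  also have "\<dots> = (LINT w|M. of_real (2 * pi) * (a w * f (Y w)))"
    by (simp only: fourier_inversion[OF f] mult.left_commute)
  finally show ?thesis by (simp only: integral_mult_right_zero)
qed

section \<open>Decay of transforms on the spaces \<open>Fspace m k\<close>\<close>

lemma integrable_inverse_1_plus_square': "integrable lborel (\<lambda>t::real. 1 / (1 + t\<^sup>2))"
  using integrable_inverse_1_plus_square by (simp add: set_integrable_def inverse_eq_divide)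

lemma FspaceD:
  assumes "f \<in> Fspace m k"
  shows "j < m \<Longrightarrow> ((deriv ^^ j) f has_real_derivative (deriv ^^ Suc j) f x) (at x)"
    and "j \<le> m \<Longrightarrow> continuous_on UNIV ((deriv ^^ j) f)"
    and "j \<le> m \<Longrightarrow> integrable lborel ((deriv ^^ j) f)"
proof -
  show d: "((deriv ^^ j) f has_real_derivative (deriv ^^ Suc j) f x) (at x)" if "j < m" for j x
    using assms that unfolding Fspace_def by blast
  show "continuous_on UNIV ((deriv ^^ j) f)" if "j \<le> m"
  proof (cases "j = m")
    case True then show ?thesis using assms by (simp add: Fspace_def)
  next
    case False
    then have "j < m" using that by simp
    then show ?thesis by (intro continuous_at_imp_continuous_on ballI DERIV_isCont[OF d])
  qed
  show "integrable lborel ((deriv ^^ j) f)" if "j \<le> m" using assms that by (simp add: Fspace_def)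
qed

lemma Cupk_bounds:
  assumes "j \<le> m"
  shows "(LINT x|lborel. \<bar>(deriv ^^ j) f x\<bar>) \<le> Cupk m k f"
proof -
  have "(LINT x|lborel. \<bar>(deriv ^^ j) f x\<bar>) \<le> Cup m f"
    unfolding Cup_def using assms by (intro Max_ge) auto
  moreover have "0 \<le> (LINT x|lborel. \<bar>x ^ 0 * f x\<bar>)" by (rule Bochner_Integration.integral_nonneg) simp
  then have "0 \<le> Clow k f"
    unfolding Clow_def by (rule order_trans) (rule Max_ge, auto intro: exI[of _ 0])
  ultimately show ?thesis by (simp add: Cupk_def)
qed

lemma Cupk_nonneg: "0 \<le> Cupk m k f"
  by (rule order_trans[OF _ Cupk_bounds[of 0]]) (auto intro: Bochner_Integration.integral_nonneg)

lemma fourier_deriv: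
  assumes "f \<in> Fspace m k" "j \<le> m"
  shows "fourier (\<lambda>x. of_real ((deriv ^^ j) f x)) t = (\<i> * of_real t) ^ j * fourier (\<lambda>x. of_real (f x)) t"
  using assms(2)
proof (induction j)
  case (Suc j)
  have "(LINT x|lborel. of_real ((deriv ^^ Suc j) f x) * cis (- t * x))
      = - \<i> * of_real (- t) * (LINT x|lborel. of_real ((deriv ^^ j) f x) * cis (- t * x))"
  proof (rule integral_derivative_mult_cis)
    show "integrable lborel (\<lambda>x. complex_of_real ((deriv ^^ j) f x))"
      "integrable lborel (\<lambda>x. complex_of_real ((deriv ^^ Suc j) f x))"
      using FspaceD(3)[OF assms(1), of j] FspaceD(3)[OF assms(1), of "Suc j"] Suc.prems by (auto simp del: funpow.simps)
    show "((\<lambda>x. complex_of_real ((deriv ^^ j) f x)) has_vector_derivative of_real ((deriv ^^ Suc j) f x)) (at x)" for x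
      using FspaceD(1)[OF assms(1), of j x] Suc.prems
      by (auto simp del: funpow.simps intro!: has_vector_derivative_of_real simp: has_real_derivative_iff_has_vector_derivative)
    show "continuous_on UNIV (\<lambda>x. complex_of_real ((deriv ^^ Suc j) f x))"
      using FspaceD(2)[OF assms(1), of "Suc j"] Suc.prems by (intro continuous_on_of_real) simp
  qed
  then show ?case using Suc by (simp add: fourier_def del: funpow.simps)
qed simp

lemma fourier_power_bound:
  assumes "f \<in> Fspace m k" "j \<le> m"
  shows "\<bar>t\<bar> ^ j * cmod (fourier (\<lambda>x. of_real (f x)) t) \<le> Cupk m k f"
proof -
  have "\<bar>t\<bar> ^ j * cmod (fourier (\<lambda>x. of_real (f x)) t) = cmod (fourier (\<lambda>x. of_real ((deriv ^^ j) f x)) t)"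
    by (simp add: fourier_deriv[OF assms] norm_mult norm_power)
  also have "\<dots> \<le> (LINT x|lborel. cmod (of_real ((deriv ^^ j) f x)))"
    by (rule norm_fourier_le) (use FspaceD(3)[OF assms] in auto)
  also have "\<dots> \<le> Cupk m k f" using Cupk_bounds[OF assms(2)] by simp
  finally show ?thesis .
qed

text \<open>Of the \<open>q + 2\<close> derivatives, \<open>q\<close> give the factor
  \<open>1 / T ^ q\<close> beyond the cut-off and two give the integrable weight.\<close>

lemma fourier_decay:
  assumes f: "f \<in> Fspace (q + 2) k" and T: "T \<ge> 1" "\<bar>t\<bar> \<ge> T"
  shows "cmod (fourier (\<lambda>x. of_real (f x)) t) \<le> 2 * Cupk (q + 2) k f / T ^ q * (1 / (1 + t\<^sup>2))"
proof -
  let ?F = "cmod (fourier (\<lambda>x. of_real (f x)) t)" and ?C = "Cupk (q + 2) k f"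
  have "T ^ q * ((1 + t\<^sup>2) * ?F) \<le> \<bar>t\<bar> ^ q * ((1 + t\<^sup>2) * ?F)"
    using T by (intro mult_right_mono power_mono) auto
  also have "\<dots> = \<bar>t\<bar> ^ q * ?F + \<bar>t\<bar> ^ (q + 2) * ?F" by (simp add: power_add algebra_simps power2_eq_square)
  also have "\<dots> \<le> ?C + ?C" by (intro add_mono fourier_power_bound[OF f]) auto
  finally have "T ^ q * ((1 + t\<^sup>2) * ?F) \<le> 2 * ?C" by simp
  moreover have "T ^ q * (1 + t\<^sup>2) > 0" using T by (auto simp: add_pos_nonneg)
  ultimately have "?F \<le> 2 * ?C / (T ^ q * (1 + t\<^sup>2))" by (simp only: pos_le_divide_eq mult_ac)
  then show ?thesis by simp
qed

lemma fourier_decay_square: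
  assumes f: "f \<in> Fspace (q + 2) k"
  shows "cmod (fourier (\<lambda>x. of_real (f x)) t) \<le> 2 * Cupk (q + 2) k f * (1 / (1 + t\<^sup>2))"
proof -
  let ?F = "cmod (fourier (\<lambda>x. of_real (f x)) t)" and ?C = "Cupk (q + 2) k f"
  have "(1 + t\<^sup>2) * ?F = \<bar>t\<bar> ^ 0 * ?F + \<bar>t\<bar> ^ 2 * ?F" by (simp add: algebra_simps)
  also have "\<dots> \<le> ?C + ?C" by (intro add_mono fourier_power_bound[OF f]) auto
  finally have "(1 + t\<^sup>2) * ?F \<le> 2 * ?C" by simp
  moreover have "1 + t\<^sup>2 > 0" by (auto simp: add_pos_nonneg)
  ultimately show ?thesis by (simp add: field_simps)
qed

lemma integrable_fourier_Fspace:
  assumes f: "f \<in> Fspace (q + 2) k"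
  shows "integrable lborel (fourier (\<lambda>x. of_real (f x)))"
proof (rule Bochner_Integration.integrable_bound)
  show "integrable lborel (\<lambda>t. 2 * Cupk (q + 2) k f * (1 / (1 + t\<^sup>2)))"
    by (intro integrable_mult_right integrable_inverse_1_plus_square')
  show "fourier (\<lambda>x. of_real (f x)) \<in> borel_measurable lborel"
    using measurable_fourier[of "\<lambda>x. of_real (f x)"] FspaceD(3)[OF f, of 0] by simp
  show "AE t in lborel. cmod (fourier (\<lambda>x. of_real (f x)) t) \<le> norm (2 * Cupk (q + 2) k f * (1 / (1 + t\<^sup>2)))"
    unfolding real_norm_def by (intro AE_I2 order_trans[OF fourier_decay_square[OF f] abs_ge_self])
qed

text \<open>The increments of \<open>f\<close> are bounded by the integral of the absolute value of
  its derivative, which is finite.\<close>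

lemma Fspace_bounded:
  assumes f: "f \<in> Fspace m k" "m \<ge> 1"
  shows "\<exists>B. \<forall>x. \<bar>f x\<bar> \<le> B"
proof -
  let ?f' = "(deriv ^^ 1) f"
  have d: "(f has_real_derivative ?f' x) (at x)" for x using FspaceD(1)[OF f(1), of 0 x] f(2) by simp
  have c: "continuous_on UNIV ?f'" and i: "integrable lborel ?f'" using FspaceD(2,3)[OF f(1), of 1] f(2) by auto
  have le: "\<bar>f b - f a\<bar> \<le> (LINT x|lborel. \<bar>?f' x\<bar>)" if "a \<le> b" for a b
  proof -
    have "f b - f a = (LINT x|lborel. indicator {a..b} x *\<^sub>R ?f' x)"
      by (rule integral_FTC_Icc[OF that, symmetric])
        (use d c in \<open>auto intro: has_vector_derivative_at_within continuous_on_subset simp: has_real_derivative_iff_has_vector_derivative\<close>)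
    also have "\<bar>\<dots>\<bar> \<le> (LINT x|lborel. \<bar>indicator {a..b} x *\<^sub>R ?f' x\<bar>)"
      using integral_norm_bound[of lborel "\<lambda>x. indicator {a..b} x *\<^sub>R ?f' x"] by simp
    also have "\<dots> \<le> (LINT x|lborel. \<bar>?f' x\<bar>)"
    proof (rule integral_mono)
      have "integrable lborel (\<lambda>x. indicator {a..b} x *\<^sub>R ?f' x)"
        by (rule integrable_mult_indicator[OF _ i]) simp
      then show "integrable lborel (\<lambda>x. \<bar>indicator {a..b} x *\<^sub>R ?f' x\<bar>)" by (rule integrable_abs)
      show "integrable lborel (\<lambda>x. \<bar>?f' x\<bar>)" using i by (rule integrable_abs)
    qed (auto simp: indicator_def)
    finally show ?thesis .
  qed
  have "\<bar>f x\<bar> \<le> \<bar>f 0\<bar> + (LINT x|lborel. \<bar>?f' x\<bar>)" for x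
    using le[of 0 x] le[of x 0] by linarith
  then show ?thesis by blast
qed

lemma Fspace_integral_weight:
  fixes a :: "'a \<Rightarrow> complex"
  assumes f: "f \<in> Fspace (q + 2) k" and M: "sigma_finite_measure M" and a: "integrable M a" and Y: "Y \<in> borel_measurable M"
  shows "of_real (2 * pi) * (LINT w|M. a w * of_real (f (Y w)))
    = (LINT t|lborel. fourier (\<lambda>x. of_real (f x)) t * (LINT w|M. a w * cis (t * Y w)))"
proof -
  obtain B where B: "\<And>x. \<bar>f x\<bar> \<le> B" using Fspace_bounded[OF f] by auto
  show ?thesis
    by (rule integral_weight_eq_fourier[OF M a Y, of "\<lambda>x. of_real (f x)" B])
      (use FspaceD(2,3)[OF f, of 0] B integrable_fourier_Fspace[OF f] in \<open>auto intro: continuous_on_of_real\<close>)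
qed

section \<open>Polynomial multiples of the Gaussian and their transforms\<close>

lemma integrable_poly_normal:
  fixes P :: "complex poly"
  assumes "\<sigma> > 0"
  shows "integrable lborel (\<lambda>z. poly P (of_real z) * of_real (normal_density 0 \<sigma> z))"
proof -
  have "integrable lborel (\<lambda>z. coeff P i * of_real (normal_density 0 \<sigma> z * z ^ i))" for i
    using integrable_normal_moment[OF assms, of 0 i] by (intro integrable_mult_right) (simp del: of_real_mult)
  then have "integrable lborel (\<lambda>z. \<Sum>i\<le>degree P. coeff P i * of_real (normal_density 0 \<sigma> z * z ^ i))"
    by (intro Bochner_Integration.integrable_sum)
  then show ?thesis by (simp add: poly_altdef sum_distrib_left sum_distrib_right mult_ac)
qed

lemma normal_density_fourier:
  assumes \<sigma>: "\<sigma> > 0"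
  shows "(LINT z|lborel. of_real (normal_density 0 \<sigma> z) * cis (s * z)) = of_real (exp (- (\<sigma> * s)\<^sup>2 / 2))"
proof -
  have n: "normal_density 0 \<sigma> z = 1 / (\<sigma> * sqrt (2 * pi)) * exp (- (1 / \<sigma> * z)\<^sup>2 / 2)" for z
    using \<sigma> by (simp add: normal_density_def real_sqrt_mult power_divide field_simps)
  have "(LINT z|lborel. of_real (normal_density 0 \<sigma> z) * cis (s * z))
      = (LINT z|lborel. of_real (1 / (\<sigma> * sqrt (2 * pi))) * (of_real (exp (- (1 / \<sigma> * z)\<^sup>2 / 2)) * cis (z * s)))"
    unfolding n by (simp add: mult_ac)
  also have "\<dots> = of_real (1 / (\<sigma> * sqrt (2 * pi))) * of_real (sqrt (2 * pi) / (1 / \<sigma>) * exp (- (s / (1 / \<sigma>))\<^sup>2 / 2))"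
    using \<sigma> by (simp only: integral_mult_right_zero integral_gaussian_cis(2)[of "1 / \<sigma>"] zero_less_divide_1_iff)
  also have "\<dots> = of_real (exp (- (\<sigma> * s)\<^sup>2 / 2))"
  proof -
    have "1 / (\<sigma> * sqrt (2 * pi)) * (sqrt (2 * pi) / (1 / \<sigma>) * exp (- (s / (1 / \<sigma>))\<^sup>2 / 2)) = exp (- (\<sigma> * s)\<^sup>2 / 2)"
      using \<sigma> by (simp add: mult.commute)
    then show ?thesis by (simp only: of_real_mult[symmetric])
  qed
  finally show ?thesis .
qed

text \<open>Multiplication by \<open>s\<close> on the Fourier side is \<open>\<i>\<close> times differentiation, so the polynomial
  multiples of the Gaussian are stable under the inverse transform.\<close>

lemma poly_normal_fourier:
  fixes A :: "complex poly"
  assumes \<sigma>: "\<sigma> > 0"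
  shows "\<exists>P :: complex poly. \<forall>s. (LINT z|lborel. (poly P (of_real z) * of_real (normal_density 0 \<sigma> z)) * cis (s * z))
     = poly A (of_real s) * of_real (exp (- (\<sigma> * s)\<^sup>2 / 2))"
proof (induction A)
  case 0 show ?case by (rule exI[of _ 0]) simp
next
  case (pCons a A)
  let ?n = "normal_density 0 \<sigma>"
  let ?G = "\<lambda>P s. (LINT z|lborel. (poly P (of_real z) * of_real (?n z)) * cis (s * z))"
  from pCons obtain P where P: "\<And>s. ?G P s = poly A (of_real s) * of_real (exp (- (\<sigma> * s)\<^sup>2 / 2))" by blast
  \<comment> \<open>Chosen so that the derivative of \<open>P\<close> times the density is
    \<open>P'\<close> times the density.\<close>
  define P' where "P' = pderiv P - smult (1 / of_real (\<sigma>\<^sup>2)) (pCons 0 P)"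
  have dn: "(?n has_real_derivative (- z / \<sigma>\<^sup>2) * ?n z) (at z)" for z
    unfolding normal_density_def using \<sigma>
    by (auto intro!: derivative_eq_intros simp: field_simps power2_eq_square)
  have G': "?G P' s = - \<i> * of_real s * ?G P s" for s
  proof (rule integral_derivative_mult_cis[OF integrable_poly_normal integrable_poly_normal, OF \<sigma> \<sigma>])
    fix z
    have "((\<lambda>z. poly P (of_real z)) has_vector_derivative poly (pderiv P) (of_real z)) (at z)"
      by (rule has_vector_derivative_real_field) (rule poly_DERIV)
    moreover have "((\<lambda>z. complex_of_real (?n z)) has_vector_derivative of_real ((- z / \<sigma>\<^sup>2) * ?n z)) (at z)"
      using dn by (intro has_vector_derivative_of_real) (simp add: has_real_derivative_iff_has_vector_derivative)
    ultimately have "((\<lambda>z. poly P (of_real z) * of_real (?n z)) has_vector_derivative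
        poly P (of_real z) * of_real ((- z / \<sigma>\<^sup>2) * ?n z) + poly (pderiv P) (of_real z) * of_real (?n z)) (at z)"
      by (rule has_vector_derivative_mult)
    then show "((\<lambda>z. poly P (of_real z) * of_real (?n z)) has_vector_derivative
        poly P' (of_real z) * of_real (?n z)) (at z)"
      by (rule back_subst[where P="\<lambda>y. (_ has_vector_derivative y) _"]) (simp add: P'_def algebra_simps)
  next
    have "continuous_on UNIV ?n" unfolding normal_density_def using \<sigma> by (intro continuous_intros) auto
    then show "continuous_on UNIV (\<lambda>z. poly P' (of_real z) * complex_of_real (?n z))"
      by (intro continuous_intros)
  qed
  have G1: "?G 1 s = of_real (exp (- (\<sigma> * s)\<^sup>2 / 2))" for s
    using normal_density_fourier[OF \<sigma>, of s] by simp
  have add: "?G (smult c P1 + smult d P2) s = c * ?G P1 s + d * ?G P2 s" for c d P1 P2 s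
  proof -
    have i: "integrable lborel (\<lambda>z. (poly P1 (of_real z) * of_real (?n z)) * cis (s * z))" for P1 :: "complex poly"
      by (intro integrable_mult_cis integrable_poly_normal \<sigma>) simp
    have "?G (smult c P1 + smult d P2) s = (LINT z|lborel. c * ((poly P1 (of_real z) * of_real (?n z)) * cis (s * z))
       + d * ((poly P2 (of_real z) * of_real (?n z)) * cis (s * z)))"
      by (simp add: algebra_simps)
    then show ?thesis using i by simp
  qed
  show ?case
  proof (intro exI allI)
    fix s
    \<comment> \<open>The constant polynomial accounts for \<open>a\<close>; \<open>\<i>\<close>
      times \<open>P'\<close> accounts for multiplication by \<open>s\<close>, because
      \<open>\<i> * (- \<i>) = 1\<close>.\<close>
    have "?G (smult a 1 + smult \<i> P') s = a * of_real (exp (- (\<sigma> * s)\<^sup>2 / 2)) + \<i> * (- \<i> * of_real s * ?G P s)"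
      unfolding add G1 G' ..
    also have "\<i> * (- \<i> * of_real s * ?G P s) = of_real s * (poly A (of_real s) * of_real (exp (- (\<sigma> * s)\<^sup>2 / 2)))"
      by (simp only: P) (simp flip: mult.assoc)
    also have "a * of_real (exp (- (\<sigma> * s)\<^sup>2 / 2)) + of_real s * (poly A (of_real s) * of_real (exp (- (\<sigma> * s)\<^sup>2 / 2)))
        = poly (pCons a A) (of_real s) * of_real (exp (- (\<sigma> * s)\<^sup>2 / 2))"
      by (simp only: poly_pCons distrib_right mult.assoc)
    finally show "?G (smult a 1 + smult \<i> P') s = poly (pCons a A) (of_real s) * of_real (exp (- (\<sigma> * s)\<^sup>2 / 2))" .
  qed
qed

lemma poly_map_Re: "poly (map_poly Re P) x = Re (poly P (of_real x))"
  by (induction P) (simp_all add: map_poly_pCons)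

subsection \<open>Expansions under the scaling of the central limit theorem\<close>

text \<open>Pairs \<open>(t, \<epsilon>)\<close> with \<open>\<epsilon> \<rightarrow> 0+\<close> and \<open>t \<epsilon> \<rightarrow> 0\<close>; here \<open>t\<close> itself may be unbounded, as long as it is \<open>o(1 / \<epsilon>)\<close>.\<close>

definition scaling :: "(real \<times> real) filter" where
  "scaling = filtercomap (\<lambda>(t, \<epsilon>). (\<epsilon>, t * \<epsilon>)) (at_right 0 \<times>\<^sub>F nhds 0)"

lemma eventually_scaling_nhds:
  assumes "\<forall>\<^sub>F u in nhds 0. P u"
  shows "\<forall>\<^sub>F x in scaling. P (fst x * snd x)"
proof -
  have "\<forall>\<^sub>F y in at_right 0 \<times>\<^sub>F nhds (0::real). P (snd y)"
    using eventually_prodI[OF eventually_True assms] by simp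
  then show ?thesis unfolding scaling_def eventually_filtercomap by fastforce
qed

lemma eventually_scaling_small:
  assumes "d > 0"
  shows "\<forall>\<^sub>F x in scaling. 0 < snd x \<and> snd x < d"
proof -
  have "\<forall>\<^sub>F \<epsilon> in at_right (0::real). 0 < \<epsilon> \<and> \<epsilon> < d"
    using assms by (auto simp: eventually_at_right_field intro: exI[of _ d])
  then have "\<forall>\<^sub>F y in at_right 0 \<times>\<^sub>F nhds (0::real). 0 < fst y \<and> fst y < d" 
    using eventually_prodI[OF _ eventually_True] by fastforce
  then show ?thesis unfolding scaling_def eventually_filtercomap by fastforce
qed

lemma eventually_scalingD:
  assumes "\<forall>\<^sub>F x in scaling. P x"
  shows "\<exists>d>0. \<forall>t \<epsilon>. 0 < \<epsilon> \<longrightarrow> \<epsilon> < d \<longrightarrow> \<bar>t * \<epsilon>\<bar> < d \<longrightarrow> P (t, \<epsilon>)"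
proof -
  from assms obtain Q where Q: "eventually Q (at_right 0 \<times>\<^sub>F nhds (0::real))" "\<And>t \<epsilon>. Q (\<epsilon>, t * \<epsilon>) \<Longrightarrow> P (t, \<epsilon>)"
    unfolding scaling_def eventually_filtercomap by auto
  from Q(1) obtain P1 P2 where P: "\<forall>\<^sub>F \<epsilon> in at_right (0::real). P1 \<epsilon>" "\<forall>\<^sub>F u in nhds (0::real). P2 u"
    "\<And>x y. P1 x \<Longrightarrow> P2 y \<Longrightarrow> Q (x, y)" unfolding eventually_prod_filter by auto
  obtain b where b: "b > 0" "\<And>\<epsilon>. 0 < \<epsilon> \<Longrightarrow> \<epsilon> < b \<Longrightarrow> P1 \<epsilon>" using P(1) by (auto simp: eventually_at_right_field)
  obtain c where c: "c > 0" "\<And>u. \<bar>u\<bar> < c \<Longrightarrow> P2 u" using P(2) by (auto simp: eventually_nhds_metric dist_real_def)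
  show ?thesis by (rule exI[of _ "min b c"]) (use b c P(3) Q(2) in auto)
qed

text \<open>The outer variable is \<epsilon>, the inner one is \<open>t\<close>, so that
  \<open>coeff P p\<close> is the polynomial in \<open>t\<close> that multiplies the
  \<open>p\<close>-th power of \<epsilon>.\<close>

definition ev2 :: "complex poly poly \<Rightarrow> real \<times> real \<Rightarrow> complex" where
  "ev2 P x = poly (poly P [:of_real (snd x):]) (of_real (fst x))"

lemma ev2_simps [simp]:
  "ev2 (P + Q) x = ev2 P x + ev2 Q x" "ev2 (P * Q) x = ev2 P x * ev2 Q x" "ev2 1 x = 1" "ev2 0 x = 0"
  "ev2 [:p:] x = poly p (of_real (fst x))"
  by (simp_all add: ev2_def)

lemma ev2_altdef: "ev2 P x = (\<Sum>p\<le>degree P. of_real (snd x) ^ p * poly (coeff P p) (of_real (fst x)))"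
  by (simp add: ev2_def poly_altdef[of P] poly_sum poly_power mult.commute)

lemma poly_growth: "\<exists>C\<ge>0. \<forall>t::real. cmod (poly p (of_real t)) \<le> C * (1 + \<bar>t\<bar>) ^ degree p"
proof (intro exI conjI allI)
  show "0 \<le> (\<Sum>i\<le>degree p. cmod (coeff p i))" by (intro sum_nonneg) simp
  fix t :: real
  have "cmod (poly p (of_real t)) \<le> (\<Sum>i\<le>degree p. cmod (coeff p i) * \<bar>t\<bar> ^ i)"
    unfolding poly_altdef by (rule order_trans[OF norm_sum]) (simp add: norm_mult norm_power)
  also have "\<dots> \<le> (\<Sum>i\<le>degree p. cmod (coeff p i) * (1 + \<bar>t\<bar>) ^ degree p)"
  proof (intro sum_mono mult_left_mono)
    fix i assume "i \<in> {..degree p}"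
    have "\<bar>t\<bar> ^ i \<le> (1 + \<bar>t\<bar>) ^ i" by (intro power_mono) auto
    also have "\<dots> \<le> (1 + \<bar>t\<bar>) ^ degree p" using \<open>i \<in> _\<close> by (intro power_increasing) auto
    finally show "\<bar>t\<bar> ^ i \<le> (1 + \<bar>t\<bar>) ^ degree p" .
  qed simp
  finally show "cmod (poly p (of_real t)) \<le> (\<Sum>i\<le>degree p. cmod (coeff p i)) * (1 + \<bar>t\<bar>) ^ degree p"
    by (simp add: sum_distrib_right)
qed

lemma poly_family_growth:
  assumes "finite I"
  shows "\<exists>C m. 0 \<le> C \<and> (\<forall>i\<in>I. \<forall>t::real. cmod (poly (p i) (of_real t)) \<le> C * (1 + \<bar>t\<bar>) ^ m)"
proof -
  obtain C where C: "\<And>i. C i \<ge> 0" "\<And>i t. cmod (poly (p i) (of_real t)) \<le> C i * (1 + \<bar>t\<bar>) ^ degree (p i)"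
  proof -
    have "\<forall>i. \<exists>C\<ge>0. \<forall>t::real. cmod (poly (p i) (of_real t)) \<le> C * (1 + \<bar>t\<bar>) ^ degree (p i)"
      using poly_growth by blast
    then show thesis using that by metis
  qed
  show ?thesis
  proof (intro exI conjI ballI allI)
    show "0 \<le> (\<Sum>i\<in>I. C i)" by (intro sum_nonneg C)
    fix i and t :: real assume i: "i \<in> I"
    have "cmod (poly (p i) (of_real t)) \<le> C i * (1 + \<bar>t\<bar>) ^ degree (p i)" by (rule C)
    also have "\<dots> \<le> (\<Sum>i\<in>I. C i) * (1 + \<bar>t\<bar>) ^ (\<Sum>i\<in>I. degree (p i))"
      using assms i by (intro mult_mono power_increasing member_le_sum C sum_nonneg) auto
    finally show "cmod (poly (p i) (of_real t)) \<le> (\<Sum>i\<in>I. C i) * (1 + \<bar>t\<bar>) ^ (\<Sum>i\<in>I. degree (p i))" .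
  qed
qed

lemma ev2_growth:
  "\<exists>C m. 0 \<le> C \<and> (\<forall>x. 0 < snd x \<longrightarrow> snd x < 1 \<longrightarrow> cmod (ev2 P x) \<le> C * (1 + \<bar>fst x\<bar>) ^ m)"
proof -
  obtain C m where C: "0 \<le> C" "\<And>p t. p \<le> degree P \<Longrightarrow> cmod (poly (coeff P p) (of_real t)) \<le> C * (1 + \<bar>t\<bar>) ^ m"
    using poly_family_growth[of "{..degree P}" "coeff P"] by auto
  show ?thesis
  proof (intro exI conjI allI impI)
    show "0 \<le> C * real (Suc (degree P))" using C by simp
    fix x :: "real \<times> real" assume x: "0 < snd x" "snd x < 1"
    have "cmod (ev2 P x) \<le> (\<Sum>p\<le>degree P. C * (1 + \<bar>fst x\<bar>) ^ m)"
      unfolding ev2_altdef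
    proof (rule sum_norm_le)
      fix p assume p: "p \<in> {..degree P}"
      have "snd x ^ p * cmod (poly (coeff P p) (of_real (fst x))) \<le> 1 * (C * (1 + \<bar>fst x\<bar>) ^ m)"
        using x p C by (intro mult_mono) (auto simp: power_le_one)
      then show "cmod (of_real (snd x) ^ p * poly (coeff P p) (of_real (fst x))) \<le> C * (1 + \<bar>fst x\<bar>) ^ m"
        using x by (simp add: norm_mult norm_power)
    qed
    then show "cmod (ev2 P x) \<le> C * real (Suc (degree P)) * (1 + \<bar>fst x\<bar>) ^ m" by (simp add: algebra_simps)
  qed
qed

text \<open>The error is o(\<epsilon>^r) up to a polynomial weight in \<open>t\<close>. The exponent
  \<open>m\<close> is fixed before \<open>e\<close>, so the weight can later be absorbed by a
  Gaussian.\<close>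

definition scaled_approx :: "nat \<Rightarrow> (real \<times> real \<Rightarrow> complex) \<Rightarrow> complex poly poly \<Rightarrow> bool" where
  "scaled_approx r F P \<longleftrightarrow> (\<exists>m. \<forall>e>0. \<forall>\<^sub>F x in scaling. cmod (F x - ev2 P x) \<le> e * (snd x ^ r * (1 + \<bar>fst x\<bar>) ^ m))"

lemma scaled_approx_ev2: "scaled_approx r (ev2 P) P"
  unfolding scaled_approx_def
  by (intro exI[of _ 0] allI impI eventually_mono[OF eventually_scaling_small[of 1]]) auto

lemma one_plus_power_mono: "m \<le> n \<Longrightarrow> (1 + \<bar>t::real\<bar>) ^ m \<le> (1 + \<bar>t\<bar>) ^ n"
  by (intro power_increasing) auto

lemma scaled_approx_add:
  assumes "scaled_approx r F P" "scaled_approx r G Q"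
  shows "scaled_approx r (\<lambda>x. F x + G x) (P + Q)"
proof -
  obtain m n where m: "\<And>e. e > 0 \<Longrightarrow> \<forall>\<^sub>F x in scaling. cmod (F x - ev2 P x) \<le> e * (snd x ^ r * (1 + \<bar>fst x\<bar>) ^ m)"
    and n: "\<And>e. e > 0 \<Longrightarrow> \<forall>\<^sub>F x in scaling. cmod (G x - ev2 Q x) \<le> e * (snd x ^ r * (1 + \<bar>fst x\<bar>) ^ n)"
    using assms unfolding scaled_approx_def by auto
  show ?thesis unfolding scaled_approx_def
  proof (intro exI[of _ "m + n"] allI impI)
    fix e :: real assume "e > 0"
    then have "e / 2 > 0" by simp
    from m[OF this] n[OF this] eventually_scaling_small[of 1, simplified]
    show "\<forall>\<^sub>F x in scaling. cmod (F x + G x - ev2 (P + Q) x) \<le> e * (snd x ^ r * (1 + \<bar>fst x\<bar>) ^ (m + n))"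
    proof eventually_elim
      case (elim x)
      let ?B = "e / 2 * (snd x ^ r * (1 + \<bar>fst x\<bar>) ^ (m + n))"
      have "e / 2 * (snd x ^ r * (1 + \<bar>fst x\<bar>) ^ m) \<le> ?B" "e / 2 * (snd x ^ r * (1 + \<bar>fst x\<bar>) ^ n) \<le> ?B"
        using elim \<open>e > 0\<close> by (auto intro!: mult_left_mono one_plus_power_mono)
      moreover have "cmod (F x + G x - ev2 (P + Q) x) \<le> cmod (F x - ev2 P x) + cmod (G x - ev2 Q x)"
        using norm_triangle_ineq[of "F x - ev2 P x" "G x - ev2 Q x"] by (simp add: algebra_simps)
      ultimately have "cmod (F x + G x - ev2 (P + Q) x) \<le> ?B + ?B" using elim by linarith
      then show ?case by (simp only: field_sum_of_halves flip: distrib_right)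
    qed
  qed
qed

lemma scaled_approx_mult:
  assumes "scaled_approx r F P" "scaled_approx r G Q"
  shows "scaled_approx r (\<lambda>x. F x * G x) (P * Q)"
proof -
  obtain m n where m: "\<And>e. e > 0 \<Longrightarrow> \<forall>\<^sub>F x in scaling. cmod (F x - ev2 P x) \<le> e * (snd x ^ r * (1 + \<bar>fst x\<bar>) ^ m)"
    and n: "\<And>e. e > 0 \<Longrightarrow> \<forall>\<^sub>F x in scaling. cmod (G x - ev2 Q x) \<le> e * (snd x ^ r * (1 + \<bar>fst x\<bar>) ^ n)"
    using assms unfolding scaled_approx_def by auto
  obtain C c where C: "0 \<le> C" "\<And>x. 0 < snd x \<Longrightarrow> snd x < 1 \<Longrightarrow> cmod (ev2 P x) \<le> C * (1 + \<bar>fst x\<bar>) ^ c"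
    using ev2_growth[of P] by blast
  obtain D d where D: "0 \<le> D" "\<And>x. 0 < snd x \<Longrightarrow> snd x < 1 \<Longrightarrow> cmod (ev2 Q x) \<le> D * (1 + \<bar>fst x\<bar>) ^ d"
    using ev2_growth[of Q] by blast
  define k where "k = m + n + c + d"
  show ?thesis unfolding scaled_approx_def
  proof (intro exI[of _ "k + k"] allI impI)
    fix e :: real assume e: "e > 0"
    \<comment> \<open>\<open>e' \<le> 1\<close> makes the product of the two errors linear in
      \<open>e'\<close>; dividing by \<open>1 + C + D\<close> accommodates the three error
      terms.\<close>
    define e' where "e' = min 1 (e / (1 + C + D))"
    have K: "1 + C + D > 0" using C D by linarith
    have e': "e' > 0" "e' \<le> 1" using e K by (auto simp: e'_def)
    have "e' \<le> e / (1 + C + D)" by (simp add: e'_def)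
    then have e'K: "e' * (1 + C + D) \<le> e" using K by (simp only: pos_le_divide_eq)
    from m[OF e'(1)] n[OF e'(1)] eventually_scaling_small[of 1, simplified]
    show "\<forall>\<^sub>F x in scaling. cmod (F x * G x - ev2 (P * Q) x) \<le> e * (snd x ^ r * (1 + \<bar>fst x\<bar>) ^ (k + k))"
    proof eventually_elim
      case (elim x)
      let ?w = "1 + \<bar>fst x\<bar>" and ?s = "snd x ^ r"
      have s: "0 \<le> ?s" "?s \<le> 1" using elim by (auto simp: power_le_one)
      have wk: "?w ^ j \<le> ?w ^ k" if "j \<le> k" for j using that by (rule one_plus_power_mono)
      have FP: "cmod (F x - ev2 P x) \<le> e' * ?s * ?w ^ k"
        by (rule order_trans[OF elim(1)]) (use e' s in \<open>auto simp: mult.assoc k_def intro!: mult_left_mono one_plus_power_mono\<close>)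
      have GQ: "cmod (G x - ev2 Q x) \<le> e' * ?s * ?w ^ k"
        by (rule order_trans[OF elim(2)]) (use e' s in \<open>auto simp: mult.assoc k_def intro!: mult_left_mono one_plus_power_mono\<close>)
      have Pb: "cmod (ev2 P x) \<le> C * ?w ^ k"
        by (rule order_trans[OF C(2)]) (use elim C in \<open>auto simp: k_def intro!: mult_left_mono one_plus_power_mono\<close>)
      have Qb: "cmod (ev2 Q x) \<le> D * ?w ^ k"
        by (rule order_trans[OF D(2)]) (use elim D in \<open>auto simp: k_def intro!: mult_left_mono one_plus_power_mono\<close>)
      have GQ': "cmod (G x - ev2 Q x) \<le> 1 * ?w ^ k"
      proof (rule order_trans[OF GQ], rule mult_right_mono)
        show "e' * ?s \<le> 1" using e' s by (simp add: mult_le_one)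
      qed simp
      have "F x * G x - ev2 (P * Q) x = (F x - ev2 P x) * (G x - ev2 Q x) + (F x - ev2 P x) * ev2 Q x + ev2 P x * (G x - ev2 Q x)"
        by (simp add: algebra_simps)
      then have "cmod (F x * G x - ev2 (P * Q) x) \<le> cmod (F x - ev2 P x) * cmod (G x - ev2 Q x)
          + cmod (F x - ev2 P x) * cmod (ev2 Q x) + cmod (ev2 P x) * cmod (G x - ev2 Q x)"
        by (metis norm_mult norm_triangle_mono norm_triangle_ineq order_refl)
      also have "\<dots> \<le> (e' * ?s * ?w ^ k) * (1 * ?w ^ k) + (e' * ?s * ?w ^ k) * (D * ?w ^ k) + (C * ?w ^ k) * (e' * ?s * ?w ^ k)"
        using e' s C D by (intro add_mono mult_mono FP GQ GQ' Pb Qb) auto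
      also have "\<dots> = (e' * (1 + C + D)) * (?s * ?w ^ (k + k))" by (simp add: algebra_simps power_add)
      also have "\<dots> \<le> e * (?s * ?w ^ (k + k))" using e'K s by (intro mult_right_mono) auto
      finally show ?case .
    qed
  qed
qed

lemma scaled_approx_power: "scaled_approx r F P \<Longrightarrow> scaled_approx r (\<lambda>x. F x ^ n) (P ^ n)"
proof (induction n)
  case 0 show ?case using scaled_approx_ev2[of r 1] by (simp add: scaled_approx_def)
next
  case (Suc n) then show ?case using scaled_approx_mult by simp
qed

lemma scaled_approx_sum:
  "(\<And>i. i \<in> I \<Longrightarrow> scaled_approx r (F i) (P i)) \<Longrightarrow> scaled_approx r (\<lambda>x. \<Sum>i\<in>I. F i x) (\<Sum>i\<in>I. P i)"
proof (induction I rule: infinite_finite_induct)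
  case (insert i I)
  then have "scaled_approx r (\<lambda>x. F i x + (\<Sum>i\<in>I. F i x)) (P i + (\<Sum>i\<in>I. P i))" by (intro scaled_approx_add) auto
  then show ?case using insert by simp
qed (use scaled_approx_ev2[of r 0] in \<open>simp_all add: scaled_approx_def\<close>)

text \<open>At \<open>u = t * \<epsilon>\<close> a power of \<open>u\<close> is a monomial in both
  variables, and the error o(u^r) becomes o(\<epsilon>^r) with weight
  \<open>(1 + \<bar>t\<bar>) ^ r\<close>.\<close>

lemma scaled_approx_peano:
  assumes "peano r g"
  shows "\<exists>P. scaled_approx r (\<lambda>x. g (fst x * snd x)) P"
proof -
  obtain c where c: "\<And>e. e > 0 \<Longrightarrow> \<forall>\<^sub>F u in nhds 0. cmod (g u - (\<Sum>j\<le>r. u ^ j *\<^sub>R c j)) \<le> e * \<bar>u\<bar> ^ r"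
    using assms unfolding peano_iff_expansion by blast
  define P where "P = (\<Sum>j\<le>r. monom (monom (c j) j) j)"
  have P: "ev2 P x = (\<Sum>j\<le>r. (fst x * snd x) ^ j *\<^sub>R c j)" for x
    by (simp add: P_def ev2_def poly_sum poly_monom poly_power scaleR_conv_of_real power_mult_distrib mult_ac)
  have "scaled_approx r (\<lambda>x. g (fst x * snd x)) P"
    unfolding scaled_approx_def
  proof (intro exI[of _ r] allI impI)
    fix e :: real assume e: "e > 0"
    from eventually_scaling_nhds[OF c[OF e]] eventually_scaling_small[of 1, simplified]
    show "\<forall>\<^sub>F x in scaling. cmod (g (fst x * snd x) - ev2 P x) \<le> e * (snd x ^ r * (1 + \<bar>fst x\<bar>) ^ r)"
    proof eventually_elim
      case (elim x)
      have "e * \<bar>fst x * snd x\<bar> ^ r = e * (snd x ^ r * \<bar>fst x\<bar> ^ r)"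
        using elim by (simp add: abs_mult power_mult_distrib mult.commute)
      also have "\<dots> \<le> e * (snd x ^ r * (1 + \<bar>fst x\<bar>) ^ r)"
        using e elim by (intro mult_left_mono power_mono) auto
      finally show ?case using elim(1) by (simp add: P)
    qed
  qed
  then show ?thesis ..
qed

text \<open>Multiplying expansions creates powers of \<epsilon> beyond \<open>r\<close>; for
  \<epsilon> below 1 they are all dominated by the power \<open>Suc r\<close>.\<close>

lemma ev2_truncate:
  "\<exists>C m. 0 \<le> C \<and> (\<forall>x. 0 < snd x \<longrightarrow> snd x < 1 \<longrightarrow>
     cmod (ev2 P x - (\<Sum>p\<le>r. of_real (snd x) ^ p * poly (coeff P p) (of_real (fst x)))) \<le> C * snd x ^ Suc r * (1 + \<bar>fst x\<bar>) ^ m)"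
proof -
  let ?I = "{..max r (degree P)}"
  obtain C m where C: "0 \<le> C" "\<And>p t. p \<in> ?I \<Longrightarrow> cmod (poly (coeff P p) (of_real t)) \<le> C * (1 + \<bar>t\<bar>) ^ m"
    using poly_family_growth[of ?I "coeff P"] by auto
  show ?thesis
  proof (intro exI conjI allI impI)
    show "0 \<le> C * real (card (?I - {..r}))" using C by simp
    fix x :: "real \<times> real" assume x: "0 < snd x" "snd x < 1"
    let ?f = "\<lambda>p. of_real (snd x) ^ p * poly (coeff P p) (of_real (fst x))"
    have "ev2 P x = (\<Sum>p\<in>?I. ?f p)"
      unfolding ev2_altdef by (rule sum.mono_neutral_left) (auto simp: coeff_eq_0)
    then have "ev2 P x - (\<Sum>p\<le>r. ?f p) = (\<Sum>p\<in>?I - {..r}. ?f p)"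
      by (subst sum_diff) auto
    also have "cmod \<dots> \<le> (\<Sum>p\<in>?I - {..r}. snd x ^ Suc r * (C * (1 + \<bar>fst x\<bar>) ^ m))"
    proof (rule sum_norm_le)
      fix p assume p: "p \<in> ?I - {..r}"
      have "snd x ^ p * cmod (poly (coeff P p) (of_real (fst x))) \<le> snd x ^ Suc r * (C * (1 + \<bar>fst x\<bar>) ^ m)"
        using x p C by (intro mult_mono power_decreasing) auto
      then show "cmod (?f p) \<le> snd x ^ Suc r * (C * (1 + \<bar>fst x\<bar>) ^ m)" using x by (simp add: norm_mult norm_power)
    qed
    finally show "cmod (ev2 P x - (\<Sum>p\<le>r. ?f p)) \<le> C * real (card (?I - {..r})) * snd x ^ Suc r * (1 + \<bar>fst x\<bar>) ^ m"
      by (simp add: mult_ac)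
  qed
qed

text \<open>Since \<open>k 0 = 0\<close>, the exponent \<open>t\<^sup>2 k(t \<epsilon>)\<close> has
  two bounds for small \<open>t * \<epsilon>\<close>: it is at most \<open>s * t\<^sup>2\<close>, so
  the exponential costs no more than \<open>exp (s * t\<^sup>2)\<close>, and it is at most a
  multiple of \<open>(1 + \<bar>t\<bar>) ^ 3 * \<epsilon>\<close>, so the exponential series may be
  cut after degree \<open>r\<close>.\<close>

lemma exp_scaled_expansion:
  assumes k: "peano r k" "k 0 = 0" and Z: "peano r Z" and r: "r \<ge> 1" and s: "s > 0"
  shows "\<exists>A :: nat \<Rightarrow> complex poly. \<exists>m. \<forall>e>0. \<exists>d>0. \<forall>t \<epsilon>. 0 < \<epsilon> \<longrightarrow> \<epsilon> < d \<longrightarrow> \<bar>t * \<epsilon>\<bar> < d \<longrightarrow>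
     cmod (exp (of_real (t\<^sup>2) * k (t * \<epsilon>)) * Z (t * \<epsilon>) - (\<Sum>p\<le>r. of_real \<epsilon> ^ p * poly (A p) (of_real t)))
       \<le> e * (\<epsilon> ^ r * (1 + \<bar>t\<bar>) ^ m * exp (s * t\<^sup>2))"
proof -
  define a where "a x = of_real ((fst x)\<^sup>2) * k (fst x * snd x)" for x :: "real \<times> real"
  define z where "z x = Z (fst x * snd x)" for x :: "real \<times> real"
  define T where "T x = (\<Sum>i\<le>r. (1 / fact i) * a x ^ i) * z x" for x
  obtain Pk where Pk: "scaled_approx r (\<lambda>x. k (fst x * snd x)) Pk" using scaled_approx_peano[OF k(1)] by blast
  obtain Pz where Pz: "scaled_approx r z Pz" using scaled_approx_peano[OF Z] unfolding z_def by blast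
  have sq: "scaled_approx r (\<lambda>x. of_real ((fst x)\<^sup>2)) [:monom 1 2:]"
    using scaled_approx_ev2[of r "[:monom 1 2:]"] by (simp add: scaled_approx_def poly_monom)
  have c: "scaled_approx r (\<lambda>x. c) [:[:c:]:]" for c
    using scaled_approx_ev2[of r "[:[:c:]:]"] by (simp add: scaled_approx_def)
  define P where "P = (\<Sum>i\<le>r. [:[:1 / fact i:]:] * ([:monom 1 2:] * Pk) ^ i) * Pz"
  have P: "scaled_approx r T P"
    unfolding T_def a_def P_def
    by (rule scaled_approx_mult[OF scaled_approx_sum[OF scaled_approx_mult[OF c scaled_approx_power[OF scaled_approx_mult[OF sq Pk]]]] Pz])
  from P obtain m where m: "\<And>e. e > 0 \<Longrightarrow> \<forall>\<^sub>F x in scaling. cmod (T x - ev2 P x) \<le> e * (snd x ^ r * (1 + \<bar>fst x\<bar>) ^ m)"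
    unfolding scaled_approx_def by blast
  obtain C n where C: "0 \<le> C" "\<And>x. 0 < snd x \<Longrightarrow> snd x < 1 \<Longrightarrow>
     cmod (ev2 P x - (\<Sum>p\<le>r. of_real (snd x) ^ p * poly (coeff P p) (of_real (fst x)))) \<le> C * snd x ^ Suc r * (1 + \<bar>fst x\<bar>) ^ n"
    using ev2_truncate[of P r] by blast
  have "peano (Suc 0) k" using peano_mono[OF k(1) r] by simp
  then obtain h where "peano 0 h" and h2: "\<And>u. k u = k 0 + u *\<^sub>R h u" by (rule peano_SucE) blast
  then have h1: "isCont h 0" by simp
  define H where "H = cmod (h 0) + 1"
  have "H > 0" by (simp add: H_def add_nonneg_pos)
  have evh: "\<forall>\<^sub>F u in nhds 0. cmod (h u) < H"
    using h1 unfolding isCont_iff_nhds by (intro order_tendstoD(2)[OF tendsto_norm]) (auto simp: H_def)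
  define B where "B = cmod (Z 0) + 1"
  have "B > 0" by (simp add: B_def add_nonneg_pos)
  have evZ: "\<forall>\<^sub>F u in nhds 0. cmod (Z u) < B"
    using peano_isCont[OF Z] unfolding isCont_iff_nhds by (intro order_tendstoD(2)[OF tendsto_norm]) (auto simp: B_def)
  have evs: "\<forall>\<^sub>F u in nhds (0::real). \<bar>u\<bar> < s / H"
    using \<open>H > 0\<close> s by (auto simp: eventually_nhds_metric dist_real_def intro!: exI[of _ "s / H"])
  have evk: "\<forall>\<^sub>F u in nhds 0. cmod (k u) \<le> H * \<bar>u\<bar> \<and> cmod (k u) \<le> s \<and> cmod (Z u) \<le> B"
    using evh evZ evs
  proof eventually_elim
    case (elim u)
    have "cmod (k u) = \<bar>u\<bar> * cmod (h u)" unfolding h2[of u] by (simp add: k(2))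
    also have "\<dots> \<le> \<bar>u\<bar> * H" using elim by (intro mult_left_mono) auto
    finally have 1: "cmod (k u) \<le> H * \<bar>u\<bar>" by (simp add: mult.commute)
    also have "\<dots> \<le> s" using elim(3) \<open>H > 0\<close> by (simp add: field_simps)
    finally show ?case using 1 elim by simp
  qed
  \<comment> \<open>Large enough for all three errors; \<open>3 * Suc r\<close> comes from the cubic
    bound on the exponent, raised to the power \<open>Suc r\<close>.\<close>
  define M where "M = m + n + 3 * Suc r"
  have main: "\<forall>\<^sub>F x in scaling. cmod (exp (a x) * z x - (\<Sum>p\<le>r. of_real (snd x) ^ p * poly (coeff P p) (of_real (fst x))))
     \<le> e * (snd x ^ r * (1 + \<bar>fst x\<bar>) ^ M * exp (s * (fst x)\<^sup>2))" if e: "e > 0" for e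
  proof -
    \<comment> \<open>Both errors of order \<open>Suc r\<close> carry a spare factor \<epsilon>, and
      \<open>\<epsilon> < e / (2 * D)\<close> turns them into at most \<open>e / 2\<close>; the
      other half is the error of \<open>ev2 P\<close>.\<close>
    define D where "D = C + H ^ Suc r * B + 1"
    have D: "D > 0" using C \<open>H > 0\<close> \<open>B > 0\<close> by (auto simp: D_def intro!: add_nonneg_pos)
    have "e / 2 > 0" "min 1 (e / (2 * D)) > 0" using e D by auto
    from m[OF this(1)] eventually_scaling_small[OF this(2)] eventually_scaling_nhds[OF evk]
    show ?thesis
    proof eventually_elim
      case (elim x)
      let ?\<epsilon> = "snd x" and ?t = "fst x"
      let ?w = "1 + \<bar>?t\<bar>" and ?E = "exp (s * ?t\<^sup>2)"
      have x: "0 < ?\<epsilon>" "?\<epsilon> < 1" "?\<epsilon> * D \<le> e / 2" using elim D by (auto simp: field_simps)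
      have E1: "1 \<le> ?E" using s by simp
      have ax: "cmod (a x) = ?t\<^sup>2 * cmod (k (?t * ?\<epsilon>))" by (simp add: a_def norm_mult norm_power)
      have a1: "cmod (a x) \<le> s * ?t\<^sup>2"
        unfolding ax using elim by (subst mult.commute) (intro mult_right_mono, auto)
      have a2: "cmod (a x) \<le> H * ?w ^ 3 * ?\<epsilon>"
      proof -
        have "cmod (a x) \<le> ?t\<^sup>2 * (H * \<bar>?t * ?\<epsilon>\<bar>)" unfolding ax using elim by (intro mult_left_mono) auto
        also have "\<dots> = \<bar>?t\<bar>\<^sup>2 * (H * (\<bar>?t\<bar> * ?\<epsilon>))" using x by (simp add: abs_mult)
        also have "\<dots> = H * \<bar>?t\<bar> ^ 3 * ?\<epsilon>" by (simp only: power2_eq_square power3_eq_cube mult_ac)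
        also have "\<dots> \<le> H * ?w ^ 3 * ?\<epsilon>" using x \<open>H > 0\<close> by (intro mult_right_mono mult_left_mono power_mono) auto
        finally show ?thesis .
      qed
      have "cmod (exp (a x) - (\<Sum>i\<le>r. a x ^ i / fact i)) \<le> exp \<bar>Re (a x)\<bar> * cmod (a x) ^ Suc r / fact r"
        by (rule Taylor_exp)
      also have "\<dots> \<le> exp \<bar>Re (a x)\<bar> * cmod (a x) ^ Suc r / 1"
        by (intro divide_left_mono) (auto simp: fact_ge_1)
      also have "\<dots> \<le> ?E * (H * ?w ^ 3 * ?\<epsilon>) ^ Suc r"
        using a1 abs_Re_le_cmod[of "a x"] unfolding div_by_1 by (intro mult_mono power_mono a2) auto
      finally have e1: "cmod (exp (a x) - (\<Sum>i\<le>r. a x ^ i / fact i)) \<le> ?E * (H * ?w ^ 3 * ?\<epsilon>) ^ Suc r" .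
      have "cmod (exp (a x) * z x - T x) = cmod (exp (a x) - (\<Sum>i\<le>r. a x ^ i / fact i)) * cmod (z x)"
        by (simp add: T_def algebra_simps flip: norm_mult)
      also have "\<dots> \<le> (?E * (H * ?w ^ 3 * ?\<epsilon>) ^ Suc r) * B"
        using elim x \<open>H > 0\<close> by (intro mult_mono e1) (auto simp: z_def)
      also have "\<dots> = (H ^ Suc r * B) * (?\<epsilon> ^ Suc r * ?w ^ (3 * Suc r) * ?E)"
        by (simp only: power_mult_distrib power_mult[of ?w 3 "Suc r"]) (simp only: mult_ac)
      also have "\<dots> \<le> (H ^ Suc r * B) * (?\<epsilon> ^ Suc r * ?w ^ M * ?E)"
        using x \<open>H > 0\<close> \<open>B > 0\<close> by (intro mult_left_mono mult_right_mono one_plus_power_mono) (auto simp: M_def)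
      finally have I1: "cmod (exp (a x) * z x - T x) \<le> (H ^ Suc r * B) * (?\<epsilon> ^ Suc r * ?w ^ M * ?E)" .
      have I2: "cmod (T x - ev2 P x) \<le> e / 2 * (?\<epsilon> ^ r * ?w ^ M * ?E)"
      proof (rule order_trans[OF elim(1)])
        have "?\<epsilon> ^ r * ?w ^ m * 1 \<le> ?\<epsilon> ^ r * ?w ^ M * ?E"
          using x E1 by (intro mult_mono mult_left_mono one_plus_power_mono) (auto simp: M_def)
        then show "e / 2 * (?\<epsilon> ^ r * ?w ^ m) \<le> e / 2 * (?\<epsilon> ^ r * ?w ^ M * ?E)" using e by (intro mult_left_mono) auto
      qed
      have I3: "cmod (ev2 P x - (\<Sum>p\<le>r. of_real ?\<epsilon> ^ p * poly (coeff P p) (of_real ?t))) \<le> C * (?\<epsilon> ^ Suc r * ?w ^ M * ?E)"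
      proof (rule order_trans[OF C(2)[OF x(1,2)]])
        have "?\<epsilon> ^ Suc r * ?w ^ n * 1 \<le> ?\<epsilon> ^ Suc r * ?w ^ M * ?E"
          using x E1 by (intro mult_mono mult_left_mono one_plus_power_mono) (auto simp: M_def)
        then have "C * (?\<epsilon> ^ Suc r * ?w ^ n * 1) \<le> C * (?\<epsilon> ^ Suc r * ?w ^ M * ?E)" using C by (intro mult_left_mono) auto
        then show "C * ?\<epsilon> ^ Suc r * ?w ^ n \<le> C * (?\<epsilon> ^ Suc r * ?w ^ M * ?E)" by (simp add: mult_ac)
      qed
      let ?X = "?\<epsilon> ^ r * ?w ^ M * ?E"
      have X: "?X \<ge> 0" using x by simp
      have XS: "?\<epsilon> ^ Suc r * ?w ^ M * ?E = ?\<epsilon> * ?X" by simp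
      have "cmod (exp (a x) * z x - (\<Sum>p\<le>r. of_real ?\<epsilon> ^ p * poly (coeff P p) (of_real ?t)))
        \<le> cmod (exp (a x) * z x - T x) + cmod (T x - ev2 P x) + cmod (ev2 P x - (\<Sum>p\<le>r. of_real ?\<epsilon> ^ p * poly (coeff P p) (of_real ?t)))"
        using norm_triangle_ineq[of "exp (a x) * z x - T x + (T x - ev2 P x)" "ev2 P x - (\<Sum>p\<le>r. of_real ?\<epsilon> ^ p * poly (coeff P p) (of_real ?t))"]
          norm_triangle_ineq[of "exp (a x) * z x - T x" "T x - ev2 P x"] by simp
      also have "\<dots> \<le> (H ^ Suc r * B) * (?\<epsilon> * ?X) + e / 2 * ?X + C * (?\<epsilon> * ?X)"
        using I1 I2 I3 unfolding XS by linarith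
      also have "\<dots> = (?\<epsilon> * (C + H ^ Suc r * B) + e / 2) * ?X" by (simp add: algebra_simps)
      also have "\<dots> \<le> e * ?X"
      proof (rule mult_right_mono[OF _ X])
        have "?\<epsilon> * (C + H ^ Suc r * B) \<le> ?\<epsilon> * D" using x by (intro mult_left_mono) (auto simp: D_def)
        then show "?\<epsilon> * (C + H ^ Suc r * B) + e / 2 \<le> e" using x by linarith
      qed
      finally show ?case .
    qed
  qed
  show ?thesis
    by (intro exI[of _ "coeff P"] exI[of _ M] allI impI)
      (use eventually_scalingD[OF main] in \<open>auto simp: a_def z_def\<close>)
qed

subsection \<open>Identification of the leading eigenvalue\<close>

lemma exp_multiples_eq_1:
  fixes c :: complex
  assumes "\<And>s::real. s \<ge> 0 \<Longrightarrow> exp (of_real s * c) = 1"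
  shows "c = 0"
proof -
  have Re: "Re c = 0" using assms[of 1] by (simp add: exp_eq_1)
  have "Im c = 0"
  proof (rule ccontr)
    assume ne: "Im c \<noteq> 0"
    \<comment> \<open>With this multiple the imaginary part is 1 or -1, which is not a multiple of
      \<open>2 * pi\<close>.\<close>
    have "exp (of_real (1 / \<bar>Im c\<bar>) * c) = 1" by (rule assms) simp
    then obtain n :: int where n: "Im (of_real (1 / \<bar>Im c\<bar>) * c) = of_int (2 * n) * pi" unfolding exp_eq_1 by blast
    have "\<bar>Im (of_real (1 / \<bar>Im c\<bar>) * c)\<bar> = 1" using ne by simp
    then have 1: "\<bar>of_int (2 * n)\<bar> * pi = (1::real)" unfolding n by (simp add: abs_mult)
    show False
    proof (cases "n = 0")
      case False
      then have "\<bar>of_int (2 * n)\<bar> \<ge> (2::real)" by linarith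
      then have "\<bar>of_int (2 * n)\<bar> * pi \<ge> 2 * pi" by (intro mult_right_mono) auto
      then show False using 1 pi_gt3 by linarith
    qed (use 1 in simp)
  qed
  with Re show ?thesis by (simp add: complex_eq_iff)
qed

lemma powers_tendsto_nonzero:
  fixes w :: complex
  assumes "(\<lambda>n. w ^ n) \<longlonglongrightarrow> L" "L \<noteq> 0"
  shows "w = 1"
proof -
  have "(\<lambda>n. w ^ Suc n) \<longlonglongrightarrow> L" using assms(1) by (rule LIMSEQ_Suc)
  moreover have "(\<lambda>n. w ^ Suc n) \<longlonglongrightarrow> w * L" using tendsto_mult_left[OF assms(1)] by simp
  ultimately have "w * L = L" by (rule LIMSEQ_unique[rotated])
  with assms(2) show ?thesis by simp
qed

text \<open>By Levy's continuity theorem; the centring by \<open>real N * A\<close> becomes a factor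
  \<open>cis\<close>.\<close>

lemma normalized_sum_char_limit:
  assumes M: "prob_space M" and S: "\<And>N. S N \<in> borel_measurable M" and \<sigma>: "\<sigma>2 > 0"
    and CLT: "weak_conv_m (\<lambda>N. distr M borel (\<lambda>w. (S N w - real N * A) / sqrt (real N)))
        (density lborel (normal_density 0 (sqrt \<sigma>2)))"
  shows "(\<lambda>N. (LINT w|M. cis (t / sqrt (real N) * S N w)) * cis (- (t * sqrt (real N) * A)))
    \<longlonglongrightarrow> of_real (exp (- (\<sigma>2 * t\<^sup>2) / 2))"
proof -
  interpret prob_space M by (rule M)
  note S[measurable]
  let ?D = "\<lambda>N. distr M borel (\<lambda>w. (S N w - real N * A) / sqrt (real N))"
  let ?G = "density lborel (\<lambda>x. ennreal (normal_density 0 (sqrt \<sigma>2) x))"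
  have "(\<lambda>N. char (?D N) t) \<longlonglongrightarrow> char ?G t"
  proof (rule levy_continuity1[OF _ _ CLT])
    show "real_distribution (?D N)" for N by (rule real_distribution_distr) measurable
    show "real_distribution ?G"
      using \<sigma> prob_space_normal_density[of "sqrt \<sigma>2" 0]
      by (auto simp: real_distribution_def real_distribution_axioms_def)
  qed
  moreover have "char ?G t = of_real (exp (- (\<sigma>2 * t\<^sup>2) / 2))"
  proof -
    have "char ?G t = (LINT z|lborel. normal_density 0 (sqrt \<sigma>2) z *\<^sub>R iexp (t * z))"
      unfolding char_def by (subst integral_density) auto
    also have "\<dots> = (LINT z|lborel. of_real (normal_density 0 (sqrt \<sigma>2) z) * cis (t * z))"
      by (simp add: cis_conv_exp scaleR_conv_of_real)
    also have "\<dots> = of_real (exp (- (sqrt \<sigma>2 * t)\<^sup>2 / 2))"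
      using \<sigma> by (intro normal_density_fourier) simp
    finally show ?thesis using \<sigma> by (simp add: power_mult_distrib)
  qed
  moreover have "char (?D N) t = (LINT w|M. cis (t / sqrt (real N) * S N w)) * cis (- (t * sqrt (real N) * A))" for N
  proof -
    have "char (?D N) t = (LINT w|M. iexp (t * ((S N w - real N * A) / sqrt (real N))))"
      unfolding char_def by (rule integral_distr) auto
    also have "\<dots> = (LINT w|M. cis (t / sqrt (real N) * S N w) * cis (- (t * sqrt (real N) * A)))"
    proof (rule Bochner_Integration.integral_cong[OF refl])
      fix w
      \<comment> \<open>For \<open>N = 0\<close> the divisions by zero make both sides 0.\<close>
      have "t * ((S N w - real N * A) / sqrt (real N)) = t / sqrt (real N) * S N w + - (t * sqrt (real N) * A)"
        by (cases "N = 0") (auto simp: field_simps)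
      then show "iexp (t * ((S N w - real N * A) / sqrt (real N))) = cis (t / sqrt (real N) * S N w) * cis (- (t * sqrt (real N) * A))"
        by (simp only: cis_conv_exp[symmetric] cis_mult)
    qed
    finally show ?thesis by simp
  qed
  ultimately show ?thesis by simp
qed

text \<open>The limit theorem fixes the first two coefficients of the logarithm of
  \<open>\<mu>\<close>. At \<open>u = t / sqrt N\<close> the \<open>N\<close>-th power has exponent
  \<open>sqrt N t c + t\<^sup>2 h2(u)\<close>: convergence after centring forces
  \<open>c = \<i> A\<close>, and the limit then determines \<open>h2 0\<close>.\<close>

lemma eigenvalue_log_expansion:
  fixes \<phi> :: "nat \<Rightarrow> real \<Rightarrow> complex"
  assumes \<mu>: "peano (r + 2) \<mu>" "\<mu> 0 = 1" and Z: "peano r Z"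
    and \<kappa>: "0 < \<kappa>" "\<kappa> < 1"
    and near: "\<forall>\<^sub>F t in nhds 0. \<forall>N\<ge>1. cmod (\<phi> N t - \<mu> t ^ N * Z t) \<le> C * \<kappa> ^ N"
    and \<phi>0: "\<And>N. \<phi> N 0 = 1"
    and lim: "\<And>t. (\<lambda>N. \<phi> N (t / sqrt (real N)) * cis (- (t * sqrt (real N) * A))) \<longlonglongrightarrow> of_real (exp (- (\<sigma>2 * t\<^sup>2) / 2))"
  shows "\<exists>k. peano r k \<and> k 0 = 0 \<and>
    (\<forall>\<^sub>F u in nhds 0. \<mu> u = exp (\<i> * of_real (A * u) + of_real (u\<^sup>2) * (k u - of_real (\<sigma>2 / 2))))"
proof -
  have \<kappa>0: "(\<lambda>N. C * \<kappa> ^ N) \<longlonglongrightarrow> 0" using \<kappa> tendsto_mult_left[OF LIMSEQ_power_zero[of \<kappa>], of C] by simp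
  \<comment> \<open>At \<open>t = 0\<close> the approximation says that \<open>1 - Z 0\<close> is
    bounded by \<open>C * \<kappa> ^ N\<close> for every \<open>N \<ge> 1\<close>.\<close>
  have Z0: "Z 0 = 1"
  proof -
    have "(\<lambda>N::nat. 1 - Z 0) \<longlonglongrightarrow> 0"
    proof (rule Lim_null_comparison[OF _ \<kappa>0])
      show "\<forall>\<^sub>F N in sequentially. norm (1 - Z 0) \<le> C * \<kappa> ^ N"
        using eventually_nhds_x_imp_x[OF near] by (auto simp: \<phi>0 \<mu> eventually_sequentially)
    qed
    then have "1 - Z 0 = 0" by (rule LIMSEQ_unique[OF tendsto_const])
    then show ?thesis by simp
  qed
  define h where "h u = Ln (\<mu> u)" for u
  have "peano (Suc (Suc r)) h" unfolding h_def using \<mu> by (intro peano_Ln) simp_all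
  then obtain h1 where h1: "peano (Suc r) h1" "\<And>u. h u = h 0 + u *\<^sub>R h1 u" by (rule peano_SucE) blast
  from h1(1) obtain h2 where h2: "peano r h2" "\<And>u. h1 u = h1 0 + u *\<^sub>R h2 u" by (rule peano_SucE) blast
  have h0: "h 0 = 0" by (simp add: h_def \<mu>)
  define c where "c = h1 0"
  have h: "h u = of_real u * c + of_real (u\<^sup>2) * h2 u" for u
  proof -
    have "h u = u *\<^sub>R (c + u *\<^sub>R h2 u)" using h1(2)[of u] h2(2)[of u] h0 by (metis add_0 c_def)
    then show ?thesis by (simp add: scaleR_conv_of_real algebra_simps power2_eq_square)
  qed
  have "(\<mu> \<longlongrightarrow> 1) (nhds 0)" using peano_isCont[OF \<mu>(1)] \<mu>(2) by (simp add: isCont_iff_nhds)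
  then have "\<forall>\<^sub>F u in nhds 0. dist (\<mu> u) 1 < 1" by (rule tendstoD) simp
  then have \<mu>h: "\<forall>\<^sub>F u in nhds 0. \<mu> u = exp (h u)"
  proof eventually_elim
    case (elim u)
    then have "\<mu> u \<noteq> 0" by auto
    then show ?case by (simp add: h_def)
  qed
  have key: "(\<lambda>N. exp (of_real (sqrt (real N)) * (of_real t * (c - \<i> * of_real A)))) \<longlonglongrightarrow> exp (of_real (t\<^sup>2) * (- of_real (\<sigma>2 / 2) - h2 0))" for t
  proof -
    have tN: "(\<lambda>N. t / sqrt (real N)) \<longlonglongrightarrow> 0" by real_asymp
    have evN: "\<forall>\<^sub>F N in sequentially. P (t / sqrt (real N))" if "\<forall>\<^sub>F u in nhds 0. P u" for P
      using tN that by (rule filterlim_compose[unfolded filterlim_iff, rule_format, rotated] | simp add: filterlim_iff)+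
    have cZ: "(\<lambda>N. Z (t / sqrt (real N))) \<longlonglongrightarrow> 1"
      using isCont_tendsto_compose[OF peano_isCont[OF Z] tN] Z0 by simp
    have ch: "(\<lambda>N. h2 (t / sqrt (real N))) \<longlonglongrightarrow> h2 0"
      using isCont_tendsto_compose[OF peano_isCont[OF h2(1)] tN] by simp
    let ?u = "\<lambda>N. t / sqrt (real N)" and ?c = "\<lambda>N. cis (- (t * sqrt (real N) * A))"
    have "(\<lambda>N. (\<phi> N (?u N) - \<mu> (?u N) ^ N * Z (?u N)) * ?c N) \<longlonglongrightarrow> 0"
    proof (rule Lim_null_comparison[OF _ \<kappa>0])
      show "\<forall>\<^sub>F N in sequentially. norm ((\<phi> N (?u N) - \<mu> (?u N) ^ N * Z (?u N)) * ?c N) \<le> C * \<kappa> ^ N"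
        using evN[OF near] eventually_ge_at_top[of 1] by eventually_elim (auto simp: norm_mult)
    qed
    from tendsto_diff[OF lim[of t] this]
    have "(\<lambda>N. \<mu> (?u N) ^ N * Z (?u N) * ?c N) \<longlonglongrightarrow> of_real (exp (- (\<sigma>2 * t\<^sup>2) / 2))"
      by (simp add: algebra_simps)
    from tendsto_divide[OF this tendsto_mult[OF cZ tendsto_exp[OF tendsto_mult_left[OF ch, of "of_real (t\<^sup>2)"]]]]
    have "(\<lambda>N. \<mu> (?u N) ^ N * Z (?u N) * ?c N / (Z (?u N) * exp (of_real (t\<^sup>2) * h2 (?u N)))) \<longlonglongrightarrow>
        of_real (exp (- (\<sigma>2 * t\<^sup>2) / 2)) / (1 * exp (of_real (t\<^sup>2) * h2 0))" by simp
    also have "of_real (exp (- (\<sigma>2 * t\<^sup>2) / 2)) / (1 * exp (of_real (t\<^sup>2) * h2 0)) = exp (of_real (t\<^sup>2) * (- of_real (\<sigma>2 / 2) - h2 0))"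
      by (simp add: exp_of_real[symmetric] exp_diff[symmetric] algebra_simps)
    finally have L: "(\<lambda>N. \<mu> (?u N) ^ N * Z (?u N) * ?c N / (Z (?u N) * exp (of_real (t\<^sup>2) * h2 (?u N)))) \<longlonglongrightarrow> exp (of_real (t\<^sup>2) * (- of_real (\<sigma>2 / 2) - h2 0))" .
    have "\<forall>\<^sub>F N in sequentially. Z (?u N) \<noteq> 0" using tendsto_imp_eventually_ne[OF cZ] by simp
    with evN[OF \<mu>h] eventually_ge_at_top[of 1]
    have "\<forall>\<^sub>F N in sequentially. \<mu> (?u N) ^ N * Z (?u N) * ?c N / (Z (?u N) * exp (of_real (t\<^sup>2) * h2 (?u N)))
        = exp (of_real (sqrt (real N)) * (of_real t * (c - \<i> * of_real A)))"
    proof eventually_elim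
      case (elim N)
      have N: "real N * (?u N) = sqrt (real N) * t" "real N * (?u N)\<^sup>2 = t\<^sup>2"
        using elim by (auto simp: field_simps power_divide)
      have "\<mu> (?u N) ^ N = exp (of_nat N * h (?u N))" using elim by (simp add: exp_of_nat_mult)
      also have "of_nat N * h (?u N) = of_real (real N * ?u N) * c + of_real (real N * (?u N)\<^sup>2) * h2 (?u N)"
        unfolding h by (simp add: algebra_simps)
      finally have \<mu>N: "\<mu> (?u N) ^ N = exp (of_real (sqrt (real N) * t) * c) * exp (of_real (t\<^sup>2) * h2 (?u N))"
        unfolding N exp_add .
      have "\<mu> (?u N) ^ N * Z (?u N) * ?c N / (Z (?u N) * exp (of_real (t\<^sup>2) * h2 (?u N))) = exp (of_real (sqrt (real N) * t) * c) * ?c N"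
        using elim(3) by (simp add: \<mu>N)
      also have "\<dots> = exp (of_real (sqrt (real N)) * (of_real t * (c - \<i> * of_real A)))"
        by (simp add: cis_conv_exp exp_add[symmetric] algebra_simps)
      finally show ?case .
    qed
    with L show ?thesis by (rule Lim_transform_eventually)
  qed
  have one: "exp (of_real t * (c - \<i> * of_real A)) = 1" for t
  proof (rule powers_tendsto_nonzero)
    \<comment> \<open>Along the squares \<open>sqrt N\<close> runs through the integers, so the
      convergent sequence consists of the powers of one number.\<close>
    have "filterlim (\<lambda>n::nat. n ^ 2) at_top sequentially" by (rule filterlim_at_top_mono[OF filterlim_ident]) (auto simp: power2_eq_square)
    from filterlim_compose[OF key[of t] this]
    show "(\<lambda>n. exp (of_real t * (c - \<i> * of_real A)) ^ n) \<longlonglongrightarrow> exp (of_real (t\<^sup>2) * (- of_real (\<sigma>2 / 2) - h2 0))"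
      by (simp add: exp_of_nat_mult)
  qed simp
  have c: "c = \<i> * of_real A" using exp_multiples_eq_1[OF one] by simp
  have "exp (of_real s * (- of_real (\<sigma>2 / 2) - h2 0)) = 1" if "s \<ge> 0" for s
  proof -
    have "(\<lambda>N::nat. 1) \<longlonglongrightarrow> exp (of_real ((sqrt s)\<^sup>2) * (- of_real (\<sigma>2 / 2) - h2 0))" using key[of "sqrt s"] by (simp add: c)
    then show ?thesis using that LIMSEQ_unique[OF tendsto_const] by fastforce
  qed
  then have "- of_real (\<sigma>2 / 2) - h2 0 = 0" by (rule exp_multiples_eq_1)
  then have h20: "h2 0 = - of_real (\<sigma>2 / 2)" by (simp add: algebra_simps)
  show ?thesis
  proof (intro exI[of _ "\<lambda>u. h2 u - h2 0"] conjI)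
    show "peano r (\<lambda>u. h2 u - h2 0)" by (intro peano_diff h2 peano_const)
    show "\<forall>\<^sub>F u in nhds 0. \<mu> u = exp (\<i> * of_real (A * u) + of_real (u\<^sup>2) * (h2 u - h2 0 - of_real (\<sigma>2 / 2)))"
      using \<mu>h by eventually_elim (simp add: h c h20 algebra_simps)
  qed simp
qed

subsection \<open>From characteristic functions to the weak expansion\<close>

lemma one_plus_abs_power_gauss_bounded:
  assumes "c > 0"
  shows "\<exists>C\<ge>0. \<forall>s::real. (1 + \<bar>s\<bar>) ^ m * exp (- c * s\<^sup>2) \<le> C"
proof (intro exI conjI allI)
  fix s :: real
  have "(1 + \<bar>s\<bar>) ^ m \<le> exp \<bar>s\<bar> ^ m" by (intro power_mono) (auto simp: exp_ge_add_one_self)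
  then have "(1 + \<bar>s\<bar>) ^ m * exp (- c * s\<^sup>2) \<le> exp \<bar>s\<bar> ^ m * exp (- c * s\<^sup>2)" by (intro mult_right_mono) auto
  also have "\<dots> = exp (real m * \<bar>s\<bar> - c * s\<^sup>2)" by (simp add: exp_diff exp_of_nat_mult exp_minus divide_inverse)
  \<comment> \<open>Completing the square: the exponent is maximal at
    \<open>\<bar>s\<bar> = m / (2 * c)\<close>.\<close>
  also have "\<dots> \<le> exp ((real m)\<^sup>2 / (4 * c))"
  proof -
    have "0 \<le> (real m - 2 * c * \<bar>s\<bar>)\<^sup>2" by simp
    then have "4 * c * (real m * \<bar>s\<bar> - c * s\<^sup>2) \<le> (real m)\<^sup>2" by (simp add: power2_eq_square algebra_simps)
    then show ?thesis using assms by (simp add: field_simps)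
  qed
  finally show "(1 + \<bar>s\<bar>) ^ m * exp (- c * s\<^sup>2) \<le> exp ((real m)\<^sup>2 / (4 * c))" .
qed simp

lemma integrable_one_plus_abs_power_gauss:
  assumes "c > 0"
  shows "integrable lborel (\<lambda>s::real. (1 + \<bar>s\<bar>) ^ m * exp (- c * s\<^sup>2))"
proof -
  obtain C where C: "\<And>s::real. (1 + \<bar>s\<bar>) ^ m * exp (- (c / 2) * s\<^sup>2) \<le> C"
    using one_plus_abs_power_gauss_bounded[of "c / 2" m] assms by auto
  have "integrable lborel (\<lambda>t. Re (complex_of_real (exp (- (sqrt c * t)\<^sup>2 / 2))))"
    by (rule integrable_Re[OF integral_gaussian_cis(1)]) (use assms in simp)
  then have g: "integrable lborel (\<lambda>s. C * exp (- (c / 2) * s\<^sup>2))"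
    using assms by (simp add: power_mult_distrib)
  show ?thesis
  proof (rule Bochner_Integration.integrable_bound[OF g])
    show "AE s in lborel. norm ((1 + \<bar>s\<bar>) ^ m * exp (- c * s\<^sup>2)) \<le> norm (C * exp (- (c / 2) * s\<^sup>2))"
    proof (rule AE_I2)
      fix s :: real
      have "(1 + \<bar>s\<bar>) ^ m * exp (- c * s\<^sup>2) = ((1 + \<bar>s\<bar>) ^ m * exp (- (c / 2) * s\<^sup>2)) * exp (- (c / 2) * s\<^sup>2)"
        by (simp add: mult.assoc flip: exp_add)
      also have "\<dots> \<le> C * exp (- (c / 2) * s\<^sup>2)" by (intro mult_right_mono C) simp
      finally show "norm ((1 + \<bar>s\<bar>) ^ m * exp (- c * s\<^sup>2)) \<le> norm (C * exp (- (c / 2) * s\<^sup>2))" by simp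
    qed
  qed simp
qed

lemma powr_times_power_tendsto_0:
  assumes "0 < \<kappa>" "\<kappa> < 1"
  shows "(\<lambda>N. real N powr a * \<kappa> ^ N) \<longlonglongrightarrow> 0"
proof -
  define c where "c = - ln \<kappa>"
  have "c > 0" using assms by (simp add: c_def)
  then have "(\<lambda>N. real N powr a * exp (- c * real N)) \<longlonglongrightarrow> 0" by real_asymp
  moreover have "exp (- c * real N) = \<kappa> ^ N" for N
    using assms by (simp add: c_def mult.commute exp_of_nat_mult)
  ultimately show ?thesis by simp
qed

lemma powr_times_div_powr_tendsto_0:
  assumes k: "k \<ge> 1" and ab: "0 \<le> a" "a < b"
  shows "(\<lambda>N. real N powr a * real (N div k) powr (- b)) \<longlonglongrightarrow> 0"
proof (rule Lim_null_comparison)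
  have "(\<lambda>N. real N powr a * (real N / (2 * real k)) powr (- b)) \<longlonglongrightarrow> 0"
  proof -
    have "(\<lambda>N. (2 * real k) powr b * real N powr (- (b - a))) \<longlonglongrightarrow> (2 * real k) powr b * 0"
      using ab by (intro tendsto_mult tendsto_const tendsto_neg_powr filterlim_real_sequentially) auto
    moreover have "\<forall>\<^sub>F N in sequentially. (2 * real k) powr b * real N powr (- (b - a)) = real N powr a * (real N / (2 * real k)) powr (- b)"
      using eventually_ge_at_top[of 1]
      by eventually_elim (use k in \<open>simp add: powr_divide powr_minus powr_diff field_simps\<close>)
    ultimately show ?thesis using Lim_transform_eventually by fastforce
  qed
  then show "(\<lambda>N. real N powr a * (real N / (2 * real k)) powr (- b)) \<longlonglongrightarrow> 0" .
  show "\<forall>\<^sub>F N in sequentially. norm (real N powr a * real (N div k) powr (- b)) \<le> real N powr a * (real N / (2 * real k)) powr (- b)"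
    using eventually_ge_at_top[of "2 * k"]
  proof eventually_elim
    case (elim N)
    \<comment> \<open>For \<open>N\<close> this large, rounding down loses at most a factor
      2.\<close>
    have "real N / (2 * real k) \<le> real (N div k)"
    proof -
      have "N = k * (N div k) + N mod k" by simp
      moreover have "N mod k \<le> k" "1 \<le> N div k" using k elim by (auto simp: div_greater_zero_iff Suc_le_eq less_imp_le)
      then have "N mod k \<le> k * (N div k)" by (metis le_trans mult_le_mono2 mult.right_neutral)
      ultimately have "N \<le> 2 * (k * (N div k))" by linarith
      then have "real N \<le> 2 * (real k * real (N div k))" by (metis of_nat_le_iff of_nat_mult of_nat_numeral)
      then show ?thesis using k by (simp add: field_simps)
    qed
    then have "real (N div k) powr (- b) \<le> (real N / (2 * real k)) powr (- b)"
      using elim k ab by (intro powr_mono2') auto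
    then show ?case by (simp add: mult_left_mono)
  qed
qed

text \<open>Exchanges quantifiers: from a threshold for every \<open>e\<close> to one null sequence
  common to all \<open>f\<close>. \<open>\<epsilon> N\<close> is the infimum of the admissible
  constants, which is admissible itself because the condition is linear in the constant. The infimum
  is taken of a nonempty set only for large \<open>N\<close>, which is all that is claimed.\<close>

lemma uniform_small_o:
  fixes a :: "nat \<Rightarrow> 'f \<Rightarrow> real" and c :: "'f \<Rightarrow> real" and b :: "nat \<Rightarrow> real"
  assumes small: "\<And>e. e > 0 \<Longrightarrow> \<forall>\<^sub>F N in sequentially. \<forall>f\<in>F. a N f \<le> c f * e * b N"
    and c: "\<And>f. f \<in> F \<Longrightarrow> c f \<ge> 0" and b: "\<And>N. b N \<ge> 0"
  shows "\<exists>\<epsilon>. \<epsilon> \<longlonglongrightarrow> 0 \<and> (\<forall>\<^sub>F N in sequentially. \<forall>f\<in>F. a N f \<le> c f * \<epsilon> N * b N)"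
proof -
  define S where "S N = {e. 0 \<le> e \<and> (\<forall>f\<in>F. a N f \<le> c f * e * b N)}" for N
  define \<epsilon> where "\<epsilon> N = Inf (S N)" for N
  have bdd: "bdd_below (S N)" for N by (rule bdd_belowI[of _ 0]) (simp add: S_def)
  have le: "0 \<le> \<epsilon> N \<and> \<epsilon> N \<le> e" if "e \<in> S N" for N e
  proof
    show "0 \<le> \<epsilon> N" unfolding \<epsilon>_def using that by (intro cInf_greatest) (auto simp: S_def)
    show "\<epsilon> N \<le> e" unfolding \<epsilon>_def using that bdd by (rule cInf_lower)
  qed
  have ev: "\<forall>\<^sub>F N in sequentially. e \<in> S N" if "e > 0" for e
    using small[OF that] by eventually_elim (use that in \<open>simp add: S_def\<close>)
  have "\<epsilon> \<longlonglongrightarrow> 0"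
  proof (rule tendstoI)
    fix e :: real assume "e > 0"
    then have "e / 2 > 0" by simp
    from ev[OF this] show "\<forall>\<^sub>F N in sequentially. dist (\<epsilon> N) 0 < e"
    proof eventually_elim
      case (elim N)
      then show ?case using le[OF elim] \<open>e > 0\<close> by simp
    qed
  qed
  moreover have "\<forall>\<^sub>F N in sequentially. \<forall>f\<in>F. a N f \<le> c f * \<epsilon> N * b N"
    using ev[OF zero_less_one]
  proof eventually_elim
    case (elim N)
    show ?case
    proof
      fix f assume f: "f \<in> F"
      have all: "a N f \<le> (c f * b N) * e" if "e \<in> S N" for e using that f by (auto simp: S_def mult_ac)
      have "a N f \<le> (c f * b N) * \<epsilon> N"
      \<comment> \<open>With zero weight one cannot divide, but the bound for any admissible
        constant already says \<open>a N f \<le> 0\<close>.\<close>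
      proof (cases "c f * b N = 0")
        case True then show ?thesis using all[OF elim] by (simp only: mult_zero_left)
      next
        case False
        then have pos: "c f * b N > 0" using c[OF f] b[of N] by (metis mult_nonneg_nonneg order_le_less)
        have "a N f / (c f * b N) \<le> \<epsilon> N"
          unfolding \<epsilon>_def using elim all pos by (intro cInf_greatest) (auto simp: pos_divide_le_eq mult.commute)
        then show ?thesis using pos by (simp add: pos_divide_le_eq mult.commute)
      qed
      then show "a N f \<le> c f * \<epsilon> N * b N" by (simp add: mult_ac)
    qed
  qed
  ultimately show ?thesis by blast
qed

section \<open>The defect of the characteristic function\<close>

definition edgeworth_term :: "real \<Rightarrow> complex poly \<Rightarrow> real \<Rightarrow> complex" where
  "edgeworth_term \<sigma>2 p s = poly p (of_real s) * of_real (exp (- (\<sigma>2 * s\<^sup>2) / 2))"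

text \<open>\<open>Y\<close> is meant to be the centred sum, not divided by \<open>sqrt N\<close>;
  hence the Gaussian terms appear at the frequency \<open>t * sqrt (real N)\<close>.\<close>

definition char_defect :: "'w measure \<Rightarrow> ('w \<Rightarrow> real) \<Rightarrow> nat \<Rightarrow> real \<Rightarrow> (nat \<Rightarrow> complex poly) \<Rightarrow> nat \<Rightarrow> real \<Rightarrow> complex" where
  "char_defect M Y r \<sigma>2 B N t = (LINT w|M. cis (t * Y w))
     - (\<Sum>p\<le>r. of_real (1 / real N powr (real p / 2)) * edgeworth_term \<sigma>2 (B p) (t * sqrt (real N)))"

lemma integrable_mult_bounded:
  fixes F g :: "'a \<Rightarrow> complex"
  assumes F: "integrable M F" and g: "g \<in> borel_measurable M" and K: "\<And>x. cmod (g x) \<le> K"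
  shows "integrable M (\<lambda>x. F x * g x)"
proof (rule Bochner_Integration.integrable_bound)
  show "integrable M (\<lambda>x. F x * of_real K)" using F by simp
  show "AE x in M. norm (F x * g x) \<le> norm (F x * of_real K)"
    using order_trans[OF K abs_ge_self[of K]] by (intro AE_I2) (simp add: norm_mult mult_left_mono)
qed (use F g in auto)

text \<open>Half of the Gaussian exponent absorbs the polynomial, the other half remains as
  decay.\<close>

lemma edgeworth_term_decay:
  fixes B :: "nat \<Rightarrow> complex poly"
  assumes "\<sigma>2 > 0"
  shows "\<exists>C\<ge>0. \<forall>p\<le>r. \<forall>s. cmod (edgeworth_term \<sigma>2 (B p) s) \<le> C * exp (- (\<sigma>2 / 4) * s\<^sup>2)"
proof -
  obtain C m where C0: "0 \<le> C" and C1: "\<forall>p\<in>{..r}. \<forall>s::real. cmod (poly (B p) (of_real s)) \<le> C * (1 + \<bar>s\<bar>) ^ m"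
    using poly_family_growth[of "{..r}" B, OF finite_atMost] by (elim exE conjE)
  have C: "0 \<le> C" "\<And>p s. p \<le> r \<Longrightarrow> cmod (poly (B p) (of_real s)) \<le> C * (1 + \<bar>s\<bar>) ^ m"
    using C0 C1 by simp_all
  obtain D where D: "0 \<le> D" "\<And>s::real. (1 + \<bar>s\<bar>) ^ m * exp (- (\<sigma>2 / 4) * s\<^sup>2) \<le> D"
    using one_plus_abs_power_gauss_bounded[of "\<sigma>2 / 4" m] assms by auto
  show ?thesis
  proof (intro exI[of _ "C * D"] conjI allI impI)
    show "0 \<le> C * D" using C D by simp
    fix p s assume p: "p \<le> r"
    have "cmod (edgeworth_term \<sigma>2 (B p) s) = cmod (poly (B p) (of_real s)) * exp (- (\<sigma>2 * s\<^sup>2) / 2)"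
      by (simp add: edgeworth_term_def norm_mult)
    also have "\<dots> \<le> (C * (1 + \<bar>s\<bar>) ^ m) * exp (- (\<sigma>2 * s\<^sup>2) / 2)" by (intro mult_right_mono C p) simp
    also have "exp (- (\<sigma>2 * s\<^sup>2) / 2) = exp (- (\<sigma>2 / 4) * s\<^sup>2) * exp (- (\<sigma>2 / 4) * s\<^sup>2)" by (simp flip: exp_add)
    also have "(C * (1 + \<bar>s\<bar>) ^ m) * (exp (- (\<sigma>2 / 4) * s\<^sup>2) * exp (- (\<sigma>2 / 4) * s\<^sup>2))
        = C * ((1 + \<bar>s\<bar>) ^ m * exp (- (\<sigma>2 / 4) * s\<^sup>2)) * exp (- (\<sigma>2 / 4) * s\<^sup>2)" by (simp only: mult_ac)
    also have "\<dots> \<le> C * D * exp (- (\<sigma>2 / 4) * s\<^sup>2)" by (intro mult_right_mono mult_left_mono C D) simp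
    finally show "cmod (edgeworth_term \<sigma>2 (B p) s) \<le> C * D * exp (- (\<sigma>2 / 4) * s\<^sup>2)" .
  qed
qed

lemma edgeworth_sum_decay:
  fixes B :: "nat \<Rightarrow> complex poly"
  assumes "\<sigma>2 > 0"
  shows "\<exists>C\<ge>0. \<forall>N\<ge>1. \<forall>t. cmod (\<Sum>p\<le>r. of_real (1 / real N powr (real p / 2)) * edgeworth_term \<sigma>2 (B p) (t * sqrt (real N)))
     \<le> C * exp (- (\<sigma>2 / 4) * (t * sqrt (real N))\<^sup>2)"
proof -
  obtain C where C0: "0 \<le> C" and C1: "\<forall>p\<le>r. \<forall>s. cmod (edgeworth_term \<sigma>2 (B p) s) \<le> C * exp (- (\<sigma>2 / 4) * s\<^sup>2)"
    using edgeworth_term_decay[OF assms, where r = r and B = B] by (elim exE conjE)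
  note C = C0 C1[rule_format]
  show ?thesis
  proof (intro exI[of _ "real (Suc r) * C"] conjI allI impI)
    show "0 \<le> real (Suc r) * C" using C by simp
    fix N :: nat and t :: real assume N: "N \<ge> 1"
    let ?E = "exp (- (\<sigma>2 / 4) * (t * sqrt (real N))\<^sup>2)"
    have "cmod (\<Sum>p\<le>r. of_real (1 / real N powr (real p / 2)) * edgeworth_term \<sigma>2 (B p) (t * sqrt (real N))) \<le> (\<Sum>p\<le>r. C * ?E)"
    proof (rule sum_norm_le)
      fix p assume p: "p \<in> {..r}"
      have "1 \<le> real N powr (real p / 2)" using N by (intro ge_one_powr_ge_zero) auto
      then have "1 / real N powr (real p / 2) \<le> 1" by (subst divide_le_eq_1_pos) linarith+
      then have "1 / real N powr (real p / 2) * cmod (edgeworth_term \<sigma>2 (B p) (t * sqrt (real N))) \<le> 1 * (C * ?E)"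
        using p C by (intro mult_mono) auto
      then show "cmod (of_real (1 / real N powr (real p / 2)) * edgeworth_term \<sigma>2 (B p) (t * sqrt (real N))) \<le> C * ?E"
        by (simp add: norm_mult norm_divide)
    qed
    then show "cmod (\<Sum>p\<le>r. of_real (1 / real N powr (real p / 2)) * edgeworth_term \<sigma>2 (B p) (t * sqrt (real N))) \<le> real (Suc r) * C * ?E"
      by simp
  qed
qed

lemma measurable_edgeworth_term [measurable]: "edgeworth_term \<sigma>2 p \<in> borel_measurable borel"
  unfolding edgeworth_term_def[abs_def]
  by (intro borel_measurable_continuous_onI continuous_intros) auto

text \<open>Fourier inversion is applied to the expectation and to each term of the expansion
  separately; in the latter \<open>z * sqrt (real N)\<close> plays the role of the random variable,
  and hypothesis \<open>P\<close> evaluates the transform of the weight.\<close>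

lemma char_defect_integral:
  fixes P :: "nat \<Rightarrow> complex poly"
  assumes M: "prob_space M" and Y[measurable]: "Y \<in> borel_measurable M" and \<sigma>: "\<sigma>2 > 0" and N: "N \<ge> 1"
    and f: "f \<in> Fspace (q + 2) k"
    and P: "\<And>p s. (LINT z|lborel. (poly (P p) (of_real z) * of_real (normal_density 0 (sqrt \<sigma>2) z)) * cis (s * z)) = edgeworth_term \<sigma>2 (B p) s"
  shows "of_real (2 * pi) * ((LINT w|M. of_real (f (Y w)))
      - (\<Sum>p\<le>r. of_real (1 / real N powr (real p / 2)) *
          (LINT z|lborel. (poly (P p) (of_real z) * of_real (normal_density 0 (sqrt \<sigma>2) z)) * of_real (f (z * sqrt (real N))))))
    = (LINT t|lborel. fourier (\<lambda>x. of_real (f x)) t * char_defect M Y r \<sigma>2 B N t)"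
    and "integrable lborel (\<lambda>t. fourier (\<lambda>x. of_real (f x)) t * char_defect M Y r \<sigma>2 B N t)"
proof -
  interpret prob_space M by (rule M)
  let ?F = "fourier (\<lambda>x. of_real (f x))"
  let ?\<psi> = "\<lambda>t. LINT w|M. cis (t * Y w)"
  let ?c = "\<lambda>p. complex_of_real (1 / real N powr (real p / 2))"
  let ?E = "\<lambda>p t. edgeworth_term \<sigma>2 (B p) (t * sqrt (real N))"
  have F: "integrable lborel ?F" by (rule integrable_fourier_Fspace[OF f])
  have \<psi>m: "?\<psi> \<in> borel_measurable lborel" by measurable
  have \<psi>b: "cmod (?\<psi> t) \<le> 1" for t
  proof -
    have "cmod (?\<psi> t) \<le> (LINT w|M. cmod (cis (t * Y w)))" by (rule integral_norm_bound)
    also have "\<dots> = 1" by (simp add: prob_space)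
    finally show ?thesis .
  qed
  have i1: "integrable lborel (\<lambda>t. ?F t * ?\<psi> t)" by (rule integrable_mult_bounded[OF F \<psi>m \<psi>b])
  have i2: "integrable lborel (\<lambda>t. ?F t * ?E p t)" if "p \<le> r" for p
  proof -
    obtain C where C0: "0 \<le> C" and C1: "\<forall>p\<le>r. \<forall>s. cmod (edgeworth_term \<sigma>2 (B p) s) \<le> C * exp (- (\<sigma>2 / 4) * s\<^sup>2)"
      using edgeworth_term_decay[OF \<sigma>, where r = r and B = B] by (elim exE conjE)
    note C = C1[rule_format, OF that] C0
    have "cmod (?E p t) \<le> C" for t
      by (rule order_trans[OF C(1)]) (use C \<sigma> in \<open>auto intro!: mult_left_le\<close>)
    then show ?thesis by (intro integrable_mult_bounded[OF F]) auto
  qed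
  have e1: "of_real (2 * pi) * (LINT w|M. of_real (f (Y w))) = (LINT t|lborel. ?F t * ?\<psi> t)"
    using Fspace_integral_weight[OF f sigma_finite_measure_axioms, of "\<lambda>_. 1" Y] by simp
  have e2: "of_real (2 * pi) * (LINT z|lborel. (poly (P p) (of_real z) * of_real (normal_density 0 (sqrt \<sigma>2) z)) * of_real (f (z * sqrt (real N))))
     = (LINT t|lborel. ?F t * ?E p t)" for p
  proof -
    have "of_real (2 * pi) * (LINT z|lborel. (poly (P p) (of_real z) * of_real (normal_density 0 (sqrt \<sigma>2) z)) * of_real (f (z * sqrt (real N))))
      = (LINT t|lborel. ?F t * (LINT z|lborel. (poly (P p) (of_real z) * of_real (normal_density 0 (sqrt \<sigma>2) z)) * cis (t * (z * sqrt (real N)))))"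
      using \<sigma> by (intro Fspace_integral_weight[OF f lborel.sigma_finite_measure_axioms] integrable_poly_normal) auto
    also have "\<dots> = (LINT t|lborel. ?F t * ?E p t)"
      unfolding P[symmetric] by (simp only: mult_ac)
    finally show ?thesis .
  qed
  have split: "?F t * char_defect M Y r \<sigma>2 B N t = ?F t * ?\<psi> t - (\<Sum>p\<le>r. ?c p * (?F t * ?E p t))" for t
    by (simp add: char_defect_def right_diff_distrib sum_distrib_left mult_ac)
  have i3: "integrable lborel (\<lambda>t. \<Sum>p\<le>r. ?c p * (?F t * ?E p t))"
    by (intro Bochner_Integration.integrable_sum integrable_mult_right i2) auto
  show "integrable lborel (\<lambda>t. ?F t * char_defect M Y r \<sigma>2 B N t)"
    unfolding split using i1 i3 by (rule Bochner_Integration.integrable_diff)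
  have "(LINT t|lborel. ?F t * char_defect M Y r \<sigma>2 B N t) = (LINT t|lborel. ?F t * ?\<psi> t) - (\<Sum>p\<le>r. ?c p * (LINT t|lborel. ?F t * ?E p t))"
    unfolding split Bochner_Integration.integral_diff[OF i1 i3]
    by (subst Bochner_Integration.integral_sum) (auto intro!: integrable_mult_right i2)
  then show "of_real (2 * pi) * ((LINT w|M. of_real (f (Y w)))
      - (\<Sum>p\<le>r. ?c p * (LINT z|lborel. (poly (P p) (of_real z) * of_real (normal_density 0 (sqrt \<sigma>2) z)) * of_real (f (z * sqrt (real N))))))
    = (LINT t|lborel. ?F t * char_defect M Y r \<sigma>2 B N t)"
    by (simp only: right_diff_distrib sum_distrib_left e1 mult.left_commute[of "of_real (2 * pi)"] e2)
qed

text \<open>The range of \<open>t\<close> splits at \<open>d\<close> and at \<open>T N\<close>. Near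
  0 the main part of the defect is \<open>e\<close> times a profile in
  \<open>t * sqrt (real N)\<close>, whose integral in \<open>t\<close> gains
  \<open>1 / sqrt (real N)\<close>. The rest, in all three ranges, is a small multiple of the weight
  \<open>1 / (1 + t\<^sup>2)\<close>.\<close>

lemma weak_edgeworth_of_char_bounds:
  fixes Y :: "nat \<Rightarrow> 'w \<Rightarrow> real" and B :: "nat \<Rightarrow> complex poly"
  assumes M: "prob_space M" and Y: "\<And>N. Y N \<in> borel_measurable M" and \<sigma>: "\<sigma>2 > 0"
    and near: "\<And>e. e > 0 \<Longrightarrow> \<exists>d>0. \<exists>\<rho>. (\<lambda>N. real N powr ((real r + 1) / 2) * \<rho> N) \<longlonglongrightarrow> 0 \<and>
      (\<forall>\<^sub>F N in sequentially. \<forall>t. \<bar>t\<bar> < d \<longrightarrow> cmod (char_defect M (Y N) r \<sigma>2 B N t)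
        \<le> e * (real N powr (- real r / 2) * ((1 + \<bar>t * sqrt (real N)\<bar>) ^ m * exp (- (\<sigma>2 / 4) * (t * sqrt (real N))\<^sup>2))) + \<rho> N)"
    and far: "\<And>d. d > 0 \<Longrightarrow> \<exists>T \<rho>. (\<lambda>N. real N powr ((real r + 1) / 2) * \<rho> N) \<longlonglongrightarrow> 0 \<and>
      (\<forall>\<^sub>F N in sequentially. T N \<ge> 1 \<and> 1 / T N ^ q \<le> \<rho> N \<and>
        (\<forall>t. d \<le> \<bar>t\<bar> \<longrightarrow> \<bar>t\<bar> < T N \<longrightarrow> cmod (LINT w|M. cis (t * Y N w)) \<le> \<rho> N))"
  shows "\<exists>P :: nat \<Rightarrow> real poly. \<exists>\<epsilon> :: nat \<Rightarrow> real. \<epsilon> \<longlonglongrightarrow> 0 \<and>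
    (\<forall>\<^sub>F N in sequentially. \<forall>f \<in> Fspace (q + 2) k.
       \<bar>integral\<^sup>L M (\<lambda>w. f (Y N w))
        - (\<Sum>p\<le>r. 1 / real N powr (real p / 2) *
             (LINT z|lborel. poly (P p) z * normal_density 0 (sqrt \<sigma>2) z * f (z * sqrt (real N))))\<bar>
       \<le> Cupk (q + 2) k f * \<epsilon> N * real N powr (- (real r + 1) / 2))"
proof -
  interpret prob_space M by (rule M)
  let ?n = "normal_density 0 (sqrt \<sigma>2)"
  let ?C = "Cupk (q + 2) k"
  have "\<exists>P :: complex poly. \<forall>s. (LINT z|lborel. (poly P (of_real z) * of_real (?n z)) * cis (s * z)) = edgeworth_term \<sigma>2 (B p) s" for p
    using poly_normal_fourier[of "sqrt \<sigma>2" "B p"] \<sigma> by (simp add: edgeworth_term_def power_mult_distrib)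
  then obtain P' :: "nat \<Rightarrow> complex poly" where
    P': "\<And>p s. (LINT z|lborel. (poly (P' p) (of_real z) * of_real (?n z)) * cis (s * z)) = edgeworth_term \<sigma>2 (B p) s"
    by metis
  \<comment> \<open>\<open>f\<close> is real, so passing to real parts makes the polynomials real
    and does not increase the error.\<close>
  define P where "P p = map_poly Re (P' p)" for p
  define D where "D N f = (LINT w|M. complex_of_real (f (Y N w)))
      - (\<Sum>p\<le>r. of_real (1 / real N powr (real p / 2)) *
          (LINT z|lborel. (poly (P' p) (of_real z) * of_real (?n z)) * of_real (f (z * sqrt (real N)))))" for N f
  define a where "a N f = \<bar>integral\<^sup>L M (\<lambda>w. f (Y N w)) - (\<Sum>p\<le>r. 1 / real N powr (real p / 2) *
             (LINT z|lborel. poly (P p) z * ?n z * f (z * sqrt (real N))))\<bar>" for N f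
  have aD: "a N f \<le> cmod (D N f)" if f: "f \<in> Fspace (q + 2) k" for N f
  proof -
    obtain K where K: "\<And>x. \<bar>f x\<bar> \<le> K" using Fspace_bounded[OF f] by auto
    have [measurable]: "f \<in> borel_measurable borel" using FspaceD(3)[OF f, of 0] by auto
    have i: "integrable lborel (\<lambda>z. (poly (P' p) (of_real z) * complex_of_real (?n z)) * of_real (f (z * sqrt (real N))))" for p
      using \<sigma> by (intro integrable_mult_bounded[of _ _ _ K] integrable_poly_normal) (auto simp: K)
    have "Re (D N f) = integral\<^sup>L M (\<lambda>w. f (Y N w)) - (\<Sum>p\<le>r. 1 / real N powr (real p / 2) *
             (LINT z|lborel. poly (P p) z * ?n z * f (z * sqrt (real N))))"
    proof -
      have "Re (LINT z|lborel. (poly (P' p) (of_real z) * of_real (?n z)) * of_real (f (z * sqrt (real N))))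
        = (LINT z|lborel. poly (P p) z * ?n z * f (z * sqrt (real N)))" for p
        by (subst integral_Re[OF i, symmetric]) (simp add: P_def poly_map_Re)
      then show ?thesis by (simp add: D_def Re_sum del: of_real_divide)
    qed
    then show ?thesis using abs_Re_le_cmod[of "D N f"] by (simp add: a_def)
  qed
  define G where "G s = (1 + \<bar>s\<bar>) ^ m * exp (- (\<sigma>2 / 4) * s\<^sup>2)" for s :: real
  define IG where "IG = (LINT s|lborel. G s)"
  define J where "J = (LINT t|lborel. 1 / (1 + (t::real)\<^sup>2))"
  have G: "integrable lborel G" unfolding G_def using \<sigma> by (intro integrable_one_plus_abs_power_gauss) simp
  have IG: "IG \<ge> 0" unfolding IG_def by (rule Bochner_Integration.integral_nonneg) (simp add: G_def)
  have J: "J \<ge> 0" unfolding J_def by (rule Bochner_Integration.integral_nonneg) simp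
  obtain K4 where K40: "0 \<le> K4" and K41: "\<forall>N\<ge>1. \<forall>t.
     cmod (\<Sum>p\<le>r. of_real (1 / real N powr (real p / 2)) * edgeworth_term \<sigma>2 (B p) (t * sqrt (real N)))
     \<le> K4 * exp (- (\<sigma>2 / 4) * (t * sqrt (real N))\<^sup>2)"
    using edgeworth_sum_decay[OF \<sigma>, where r = r and B = B] by (elim exE conjE)
  note K4 = K40 K41[rule_format]
  have \<psi>b: "cmod (LINT w|M. cis (t * Y N w)) \<le> 1" for t N
  proof -
    have "cmod (LINT w|M. cis (t * Y N w)) \<le> (LINT w|M. cmod (cis (t * Y N w)))" by (rule integral_norm_bound)
    then show ?thesis by (simp add: prob_space)
  qed
  have main: "\<forall>\<^sub>F N in sequentially. \<forall>f\<in>Fspace (q + 2) k. a N f \<le> ?C f * e0 * real N powr (- (real r + 1) / 2)"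
    if e0: "e0 > 0" for e0
  proof -
    \<comment> \<open>Makes \<open>e * IG\<close> at most \<open>e0 / 2\<close>; the other half of
      \<open>e0\<close> is left for the terms with \<open>R N\<close>. The added 1 keeps the
      denominator positive.\<close>
    define e where "e = e0 / (2 * (IG + 1))"
    have e: "e > 0" using e0 IG by (simp add: e_def)
    have eIG: "e * IG \<le> e0 / 2"
    proof -
      have "e * IG \<le> e * (IG + 1)" using e by simp
      also have "\<dots> = e0 / 2"
      proof -
        have "IG + 1 \<noteq> 0" using IG by linarith
        then show ?thesis unfolding e_def by (simp only: times_divide_eq_left nonzero_mult_divide_mult_cancel_right not_False_eq_True)
      qed
      finally show ?thesis .
    qed
    obtain d \<rho>1 where d: "d > 0" and \<rho>1: "(\<lambda>N. real N powr ((real r + 1) / 2) * \<rho>1 N) \<longlonglongrightarrow> 0" and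
      near': "\<forall>\<^sub>F N in sequentially. \<forall>t. \<bar>t\<bar> < d \<longrightarrow> cmod (char_defect M (Y N) r \<sigma>2 B N t)
        \<le> e * (real N powr (- real r / 2) * G (t * sqrt (real N))) + \<rho>1 N"
      using near[OF e] unfolding G_def by blast
    obtain T \<rho>2 where \<rho>2: "(\<lambda>N. real N powr ((real r + 1) / 2) * \<rho>2 N) \<longlonglongrightarrow> 0" and
      far': "\<forall>\<^sub>F N in sequentially. T N \<ge> 1 \<and> 1 / T N ^ q \<le> \<rho>2 N \<and>
        (\<forall>t. d \<le> \<bar>t\<bar> \<longrightarrow> \<bar>t\<bar> < T N \<longrightarrow> cmod (LINT w|M. cis (t * Y N w)) \<le> \<rho>2 N)"
      using far[OF d] by blast
    \<comment> \<open>Bounds the Gaussian terms for \<open>\<bar>t\<bar> \<ge> d\<close>, where they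
      are exponentially small in \<open>N\<close>.\<close>
    define \<tau> where "\<tau> N = K4 * exp (- (\<sigma>2 / 4 * d\<^sup>2) * real N)" for N :: nat
    \<comment> \<open>The factor \<open>1 + K4\<close> bounds the defect beyond the cut-off, where
      only the transform of \<open>f\<close> is small.\<close>
    define R where "R N = \<bar>\<rho>1 N\<bar> + \<bar>\<rho>2 N\<bar> * (1 + K4) + \<tau> N" for N
    have \<tau>0: "\<tau> N \<ge> 0" for N using K4 by (simp add: \<tau>_def)
    have R0: "R N \<ge> 0" for N using K4 \<tau>0[of N] by (simp add: R_def)
    have Rlim: "(\<lambda>N. real N powr ((real r + 1) / 2) * R N) \<longlonglongrightarrow> 0"
    proof -
      have c: "\<sigma>2 / 4 * d\<^sup>2 > 0" using \<sigma> d by simp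
      have "(\<lambda>N. K4 * (real N powr ((real r + 1) / 2) * exp (- (\<sigma>2 / 4 * d\<^sup>2)) ^ N)) \<longlonglongrightarrow> K4 * 0"
        using c by (intro tendsto_mult tendsto_const powr_times_power_tendsto_0) auto
      moreover have "exp (- (\<sigma>2 / 4 * d\<^sup>2)) ^ N = exp (- (\<sigma>2 / 4 * d\<^sup>2) * real N)" for N
        by (simp add: exp_of_nat_mult[symmetric] mult.commute)
      ultimately have \<tau>l: "(\<lambda>N. real N powr ((real r + 1) / 2) * \<tau> N) \<longlonglongrightarrow> 0"
        by (simp add: \<tau>_def mult.left_commute)
      have ab: "(\<lambda>N. real N powr ((real r + 1) / 2) * \<bar>\<rho> N\<bar>) \<longlonglongrightarrow> 0"
        if "(\<lambda>N. real N powr ((real r + 1) / 2) * \<rho> N) \<longlonglongrightarrow> 0" for \<rho>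
        using tendsto_rabs_zero[OF that] by (simp add: abs_mult)
      have "(\<lambda>N. real N powr ((real r + 1) / 2) * \<bar>\<rho>1 N\<bar> + (real N powr ((real r + 1) / 2) * \<bar>\<rho>2 N\<bar>) * (1 + K4)
         + real N powr ((real r + 1) / 2) * \<tau> N) \<longlonglongrightarrow> 0 + 0 * (1 + K4) + 0"
        by (intro tendsto_add tendsto_mult ab \<rho>1 \<rho>2 \<tau>l tendsto_const)
      then show ?thesis by (simp add: R_def distrib_left mult.assoc)
    qed
    have "(\<lambda>N. 2 * J * (real N powr ((real r + 1) / 2) * R N)) \<longlonglongrightarrow> 0"
      using tendsto_mult_left[OF Rlim, of "2 * J"] by simp
    then have evR: "\<forall>\<^sub>F N in sequentially. 2 * J * (real N powr ((real r + 1) / 2) * R N) < e0 / 2"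
      by (rule order_tendstoD(2)) (use e0 in simp)
    show ?thesis
      using near' far' evR eventually_ge_at_top[of 1]
    proof eventually_elim
      case (elim N)
      show ?case
      proof
        fix f assume f: "f \<in> Fspace (q + 2) k"
        let ?F = "fourier (\<lambda>x. complex_of_real (f x))"
        let ?H = "char_defect M (Y N) r \<sigma>2 B N"
        \<comment> \<open>One integrable majorant for all three ranges, so that the integral itself
          need not be split.\<close>
        let ?b = "\<lambda>t. ?C f * (e * real N powr (- real r / 2)) * G (t * sqrt (real N)) + 2 * ?C f * R N * (1 / (1 + t\<^sup>2))"
        have C0: "?C f \<ge> 0" by (rule Cupk_nonneg)
        have N: "N \<ge> 1" using elim by simp
        then have N0: "real N > 0" by simp
        have Gn: "G s \<ge> 0" for s by (simp add: G_def)
        have pw: "cmod (?F t * ?H t) \<le> ?b t" for t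
        proof -
          let ?S = "\<Sum>p\<le>r. of_real (1 / real N powr (real p / 2)) * edgeworth_term \<sigma>2 (B p) (t * sqrt (real N))"
          let ?q = "1 / (1 + t\<^sup>2)"
          have q: "?q \<ge> 0" by simp
          have first0: "0 \<le> ?C f * (e * real N powr (- real r / 2)) * G (t * sqrt (real N))" using C0 e Gn by simp
          have F2: "cmod (?F t) \<le> 2 * ?C f * ?q" by (rule fourier_decay_square[OF f])
          have H2: "cmod (?H t) \<le> cmod (LINT w|M. cis (t * Y N w)) + cmod ?S"
            unfolding char_defect_def by (rule norm_triangle_ineq4)
          consider "\<bar>t\<bar> < d" | "d \<le> \<bar>t\<bar>" "\<bar>t\<bar> < T N" | "d \<le> \<bar>t\<bar>" "T N \<le> \<bar>t\<bar>" by linarith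
          then show ?thesis
          proof cases
            case 1
            have F1: "cmod (?F t) \<le> ?C f" using fourier_power_bound[OF f, of 0 t] by simp
            have "cmod (?H t) \<le> e * (real N powr (- real r / 2) * G (t * sqrt (real N))) + R N"
            proof -
              have "\<rho>1 N \<le> R N" unfolding R_def using K4 \<tau>0[of N]
                by (smt (verit, ccfv_SIG) abs_ge_self mult_nonneg_nonneg abs_ge_zero)
              then show ?thesis using elim(1) 1 by force
            qed
            then have "cmod (?F t * ?H t) \<le> cmod (?F t) * (e * (real N powr (- real r / 2) * G (t * sqrt (real N))) + R N)"
              unfolding norm_mult by (intro mult_left_mono) auto
            also have "\<dots> = cmod (?F t) * (e * (real N powr (- real r / 2) * G (t * sqrt (real N)))) + cmod (?F t) * R N"
              by (rule distrib_left)
            also have "\<dots> \<le> ?C f * (e * (real N powr (- real r / 2) * G (t * sqrt (real N)))) + (2 * ?C f * ?q) * R N"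
              using e Gn R0 by (intro add_mono mult_right_mono F1 F2) auto
            also have "\<dots> = ?b t" by (simp only: mult_ac)
            finally show ?thesis .
          next
            case 2
            have "cmod ?S \<le> \<tau> N"
            proof (rule order_trans[OF K4(2)[OF N]])
              have "d\<^sup>2 * real N \<le> (t * sqrt (real N))\<^sup>2"
                using 2 d by (simp add: power_mult_distrib mult_right_mono abs_le_square_iff[symmetric])
              then have "- (\<sigma>2 / 4) * (t * sqrt (real N))\<^sup>2 \<le> - (\<sigma>2 / 4) * (d\<^sup>2 * real N)"
                using \<sigma> by simp
              also have "\<dots> = - (\<sigma>2 / 4 * d\<^sup>2) * real N" by simp
              finally show "K4 * exp (- (\<sigma>2 / 4) * (t * sqrt (real N))\<^sup>2) \<le> \<tau> N"
                unfolding \<tau>_def using K4 by (intro mult_left_mono) (simp_all only: exp_le_cancel_iff)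
            qed
            moreover have "cmod (LINT w|M. cis (t * Y N w)) \<le> \<rho>2 N" using elim 2 by blast
            moreover have "\<rho>2 N \<le> \<bar>\<rho>2 N\<bar> * (1 + K4)" using K4 by (simp add: distrib_left add_increasing2)
            ultimately have "cmod (?H t) \<le> R N" using H2 unfolding R_def by linarith
            then have "cmod (?F t * ?H t) \<le> (2 * ?C f * ?q) * R N"
              unfolding norm_mult using F2 C0 q by (intro mult_mono) auto
            then show ?thesis using first0 by (simp add: mult_ac)
          next
            case 3
            have "cmod ?S \<le> K4"
              by (rule order_trans[OF K4(2)[OF N]]) (use K4 \<sigma> in \<open>auto intro!: mult_left_le\<close>)
            then have H: "cmod (?H t) \<le> 1 + K4" using H2 \<psi>b[of t N] by linarith
            have "cmod (?F t) \<le> 2 * ?C f / T N ^ q * ?q" using elim 3 by (intro fourier_decay[OF f]) auto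
            also have "\<dots> = (2 * ?C f * ?q) * (1 / T N ^ q)" by simp
            also have "\<dots> \<le> (2 * ?C f * ?q) * \<bar>\<rho>2 N\<bar>" using elim C0 q by (intro mult_left_mono) auto
            finally have "cmod (?F t * ?H t) \<le> ((2 * ?C f * ?q) * \<bar>\<rho>2 N\<bar>) * (1 + K4)"
              unfolding norm_mult using H C0 q by (intro mult_mono) auto
            also have "\<dots> = (2 * ?C f * ?q) * (\<bar>\<rho>2 N\<bar> * (1 + K4))" by (rule mult.assoc)
            also have "\<dots> \<le> (2 * ?C f * ?q) * R N"
              using C0 q \<tau>0[of N] by (intro mult_left_mono) (auto simp: R_def)
            finally show ?thesis using first0 by (simp add: mult_ac)
          qed
        qed
        have GN: "integrable lborel (\<lambda>t. G (t * sqrt (real N)))"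
          using lborel_integrable_real_affine[OF G, of "sqrt (real N)" 0] N by (simp add: mult.commute)
        have GI: "(LINT t|lborel. G (t * sqrt (real N))) = IG / sqrt (real N)"
          using lborel_integral_real_affine[of "sqrt (real N)" G 0] N
          by (simp add: IG_def mult.commute field_simps)
        have bi: "integrable lborel ?b"
          by (intro Bochner_Integration.integrable_add integrable_mult_right GN integrable_inverse_1_plus_square')
        note CI = char_defect_integral[OF M Y \<sigma> N f P', where r = r]
        \<comment> \<open>The factor \<open>2 * pi\<close> from the inversion is at least 1 and may
          be dropped.\<close>
        have "cmod (D N f) \<le> 2 * pi * cmod (D N f)"
          using pi_gt3 by (intro mult_right_mono[of 1 "2 * pi", simplified mult_1]) auto
        also have "\<dots> = cmod (of_real (2 * pi) * D N f)" by (simp add: norm_mult)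
        also have "of_real (2 * pi) * D N f = (LINT t|lborel. ?F t * ?H t)" unfolding D_def by (rule CI(1))
        also have "cmod \<dots> \<le> (LINT t|lborel. cmod (?F t * ?H t))" by (rule integral_norm_bound)
        also have "\<dots> \<le> (LINT t|lborel. ?b t)" by (rule integral_mono[OF integrable_norm[OF CI(2)] bi pw])
        also have "\<dots> = ?C f * (e * real N powr (- real r / 2)) * (IG / sqrt (real N)) + 2 * ?C f * R N * J"
          unfolding J_def GI[symmetric]
          by (subst Bochner_Integration.integral_add)
            (auto intro!: integrable_mult_right GN integrable_inverse_1_plus_square' simp only: integral_mult_right_zero)
        also have "\<dots> \<le> ?C f * e0 * real N powr (- (real r + 1) / 2)"
        proof -
          have p1: "real N powr (- real r / 2) / sqrt (real N) = real N powr (- (real r + 1) / 2)"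
          proof -
            have "real N powr (- real r / 2) / sqrt (real N) = real N powr (- real r / 2 - 1/2)"
              using N by (simp add: powr_half_sqrt[symmetric] powr_diff)
            also have "- real r / 2 - 1/2 = - (real r + 1) / 2" by (simp add: field_simps)
            finally show ?thesis .
          qed
          have p2: "2 * J * R N \<le> e0 / 2 * real N powr (- (real r + 1) / 2)"
          proof -
            have "real N powr ((real r + 1) / 2) * real N powr (- (real r + 1) / 2) = 1"
            proof -
              have "(real r + 1) / 2 + - (real r + 1) / 2 = 0"
                by (simp only: add_divide_distrib[symmetric] add.right_inverse div_0)
              then show ?thesis using N0 by (metis powr_add powr_zero_eq_one less_irrefl)
            qed
            then have "2 * J * R N = (2 * J * (real N powr ((real r + 1) / 2) * R N)) * real N powr (- (real r + 1) / 2)"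
              by (simp add: mult_ac)
            also have "\<dots> \<le> e0 / 2 * real N powr (- (real r + 1) / 2)"
              using elim by (intro mult_right_mono) auto
            finally show ?thesis .
          qed
          have "?C f * (e * real N powr (- real r / 2)) * (IG / sqrt (real N)) + 2 * ?C f * R N * J
              = ?C f * (e * IG * (real N powr (- real r / 2) / sqrt (real N)) + 2 * J * R N)"
            by (simp add: algebra_simps)
          also have "\<dots> \<le> ?C f * (e0 / 2 * real N powr (- (real r + 1) / 2) + e0 / 2 * real N powr (- (real r + 1) / 2))"
            unfolding p1 using C0 eIG p2 by (intro mult_left_mono add_mono mult_right_mono) auto
          also have "\<dots> = ?C f * e0 * real N powr (- (real r + 1) / 2)" by (simp add: algebra_simps)
          finally show ?thesis .
        qed
        finally show "a N f \<le> ?C f * e0 * real N powr (- (real r + 1) / 2)" using aD[OF f] order_trans by blast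
      qed
    qed
  qed
  have "\<exists>\<epsilon>. \<epsilon> \<longlonglongrightarrow> 0 \<and> (\<forall>\<^sub>F N in sequentially. \<forall>f\<in>Fspace (q + 2) k. a N f \<le> ?C f * \<epsilon> N * real N powr (- (real r + 1) / 2))"
    by (rule uniform_small_o[OF main]) (auto simp: Cupk_nonneg)
  then show ?thesis unfolding a_def by blast
qed

lemma sqrt_inverse_power_eq:
  assumes "N \<ge> 1"
  shows "(1 / sqrt (real N)) ^ p = 1 / real N powr (real p / 2)" "(1 / sqrt (real N)) ^ p = real N powr (- real p / 2)"
proof -
  have "sqrt (real N) ^ p = real N powr (real p / 2)"
    using assms by (simp add: powr_half_sqrt[symmetric] powr_powr flip: powr_realpow)
  then show "(1 / sqrt (real N)) ^ p = 1 / real N powr (real p / 2)" by (simp add: power_divide)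
  then show "(1 / sqrt (real N)) ^ p = real N powr (- real p / 2)" by (simp add: powr_minus_divide)
qed

section \<open>Verification of the frequency bounds for the sums\<close>

theorem theorem2p5:
  fixes M :: "'w measure"
    and X :: "nat \<Rightarrow> 'w \<Rightarrow> real"
    and L :: "real \<Rightarrow> ('b::complex_banach \<Rightarrow>\<^sub>L 'b)"
    and v :: 'b
    and l :: "'b \<Rightarrow>\<^sub>L complex"
    and r q :: nat
    and r1 A \<sigma>2 :: real
  assumes prob: "prob_space M"
    and rv: "\<And>n. X n \<in> borel_measurable M"
    and lin_L: "\<And>t. clinear_op (L t)"
    and lin_l: "clinear_functional l"
    and charf: "\<And>t N. N \<ge> 1 \<Longrightarrow>
        integral\<^sup>L M (\<lambda>w. cis (t * (\<Sum>n=1..N. X n w))) = blinfun_apply l (blinfun_apply (opow (L t) N) v)"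
    \<comment> \<open>(A1) with \<open>s = r + 2\<close>\<close>
    and A1_cont: "continuous_on UNIV L"
    and A1_diff: "\<exists>\<delta>>0. Ck_on (r + 2) {-\<delta>..\<delta>} L"
    \<comment> \<open>(A2)\<close>
    and A2_one: "op_eigenvalue (L 0) 1 \<and> isolated_in_spectrum (L 0) 1 \<and> simple_eigenvalue (L 0) 1"
    and A2_other: "\<And>z. op_eigenvalue (L 0) z \<Longrightarrow> z \<noteq> 1 \<Longrightarrow> cmod z < 1"
    and A2_ess: "\<exists>\<rho><1. \<forall>z\<in>ess_spectrum (L 0). cmod z \<le> \<rho>"
    \<comment> \<open>(A3)\<close>
    and A3: "\<And>t. t \<noteq> 0 \<Longrightarrow> op_spectrum (L t) \<subseteq> {z. cmod z < 1}"
    \<comment> \<open>(A4)\<close>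
    and r1_pos: "r1 > 0"
    and A4: "\<exists>K r2 N0. K > 0 \<and> r2 > 0 \<and> N0 > 0 \<and>
        (\<forall>N::nat. \<forall>t. real N > N0 \<and> K \<le> \<bar>t\<bar> \<and> \<bar>t\<bar> \<le> real N powr r1 \<longrightarrow>
            norm (opow (L t) N) \<le> real N powr (- r2))"
    \<comment> \<open>CLT with the constants \<open>A\<close>, \<open>\<sigma>\<^sup>2 > 0\<close>\<close>
    and sigma_pos: "\<sigma>2 > 0"
    and CLT: "weak_conv_m
        (\<lambda>N. distr M borel (\<lambda>w. ((\<Sum>n=1..N. X n w) - real N * A) / sqrt (real N)))
        (density lborel (normal_density 0 (sqrt \<sigma>2)))"
    and r_pos: "r \<ge> 1"
    and q_big: "real q > (real r + 1) / (2 * r1)"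
  shows "\<exists>P :: nat \<Rightarrow> real poly. \<exists>\<epsilon> :: nat \<Rightarrow> real. \<epsilon> \<longlonglongrightarrow> 0 \<and>
    (\<forall>\<^sub>F N in sequentially. \<forall>f \<in> Fspace (q + 2) 0.
       \<bar>integral\<^sup>L M (\<lambda>w. f ((\<Sum>n=1..N. X n w) - real N * A))
        - (\<Sum>p\<le>r. 1 / real N powr (real p / 2) *
             (LINT z|lborel. poly (P p) z * normal_density 0 (sqrt \<sigma>2) z * f (z * sqrt (real N))))\<bar>
       \<le> Cupk (q + 2) 0 f * \<epsilon> N * real N powr (- (real r + 1) / 2))"
proof -
  interpret prob_space M by (rule prob)
  note rv[measurable]
  define S where "S N w = (\<Sum>n=1..N. X n w)" for N w
  have S[measurable]: "S N \<in> borel_measurable M" for N unfolding S_def by measurable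
  define \<phi> where "\<phi> N t = (LINT w|M. cis (t * S N w))" for N t
  have \<phi>L: "\<phi> N t = l (opow (L t) N v)" if "N \<ge> 1" for N t
    using charf[OF that] by (simp add: \<phi>_def S_def)
  have \<psi>: "(LINT w|M. cis (t * (S N w - real N * A))) = \<phi> N t * cis (- (t * real N * A))" for N t
  proof -
    have "cis (t * (S N w - real N * A)) = cis (t * S N w) * cis (- (t * real N * A))" for w
      by (simp add: cis_mult algebra_simps)
    then show ?thesis by (simp add: \<phi>_def)
  qed
  obtain \<mu> Z C \<kappa> where \<mu>: "peano (r + 2) \<mu>" "\<mu> 0 = 1" and Z2: "peano (r + 2) Z"
    and \<kappa>: "0 < C" "0 < \<kappa>" "\<kappa> < 1"
    and appr: "\<forall>\<^sub>F t in nhds 0. \<forall>N. cmod (l (opow (L t) N v) - \<mu> t ^ N * Z t) \<le> C * \<kappa> ^ N"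
    using leading_eigenvalue_expansion[OF lin_L lin_l A1_cont A1_diff A2_one A2_other A2_ess A3, of v] by blast
  have Z: "peano r Z" by (rule peano_mono[OF Z2]) simp
  have appr': "\<forall>\<^sub>F t in nhds 0. \<forall>N\<ge>1. cmod (\<phi> N t - \<mu> t ^ N * Z t) \<le> C * \<kappa> ^ N"
    using appr by eventually_elim (simp add: \<phi>L)
  have \<phi>0: "\<phi> N 0 = 1" for N by (simp add: \<phi>_def prob_space)
  have lim: "(\<lambda>N. \<phi> N (t / sqrt (real N)) * cis (- (t * sqrt (real N) * A))) \<longlonglongrightarrow> of_real (exp (- (\<sigma>2 * t\<^sup>2) / 2))" for t
    unfolding \<phi>_def by (rule normalized_sum_char_limit[OF prob S sigma_pos]) (use CLT in \<open>simp add: S_def\<close>)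
  obtain k where k: "peano r k" "k 0 = 0" and \<mu>k:
    "\<forall>\<^sub>F u in nhds 0. \<mu> u = exp (\<i> * of_real (A * u) + of_real (u\<^sup>2) * (k u - of_real (\<sigma>2 / 2)))"
    using eigenvalue_log_expansion[OF \<mu> Z \<kappa>(2,3) appr' \<phi>0 lim] by blast
  \<comment> \<open>The growth \<open>exp (\<sigma>2 / 4 * s\<^sup>2)\<close> allowed in the
    expansion is half of the Gaussian decay, so a Gaussian with the other half remains.\<close>
  have s4: "\<sigma>2 / 4 > 0" using sigma_pos by simp
  obtain B :: "nat \<Rightarrow> complex poly" and m where B: "\<forall>e>0. \<exists>d>0. \<forall>t \<epsilon>. 0 < \<epsilon> \<longrightarrow> \<epsilon> < d \<longrightarrow> \<bar>t * \<epsilon>\<bar> < d \<longrightarrow>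
     cmod (exp (of_real (t\<^sup>2) * k (t * \<epsilon>)) * Z (t * \<epsilon>) - (\<Sum>p\<le>r. of_real \<epsilon> ^ p * poly (B p) (of_real t)))
       \<le> e * (\<epsilon> ^ r * (1 + \<bar>t\<bar>) ^ m * exp (\<sigma>2 / 4 * t\<^sup>2))"
    using exp_scaled_expansion[OF k Z r_pos s4] by blast
  have near: "\<exists>d>0. \<exists>\<rho>. (\<lambda>N. real N powr ((real r + 1) / 2) * \<rho> N) \<longlonglongrightarrow> 0 \<and>
      (\<forall>\<^sub>F N in sequentially. \<forall>t. \<bar>t\<bar> < d \<longrightarrow> cmod (char_defect M (\<lambda>w. S N w - real N * A) r \<sigma>2 B N t)
        \<le> e * (real N powr (- real r / 2) * ((1 + \<bar>t * sqrt (real N)\<bar>) ^ m * exp (- (\<sigma>2 / 4) * (t * sqrt (real N))\<^sup>2))) + \<rho> N)"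
    if e: "e > 0" for e
  proof -
    from B e obtain d1 where d1: "d1 > 0" and B1: "\<And>t \<epsilon>. 0 < \<epsilon> \<Longrightarrow> \<epsilon> < d1 \<Longrightarrow> \<bar>t * \<epsilon>\<bar> < d1 \<Longrightarrow>
     cmod (exp (of_real (t\<^sup>2) * k (t * \<epsilon>)) * Z (t * \<epsilon>) - (\<Sum>p\<le>r. of_real \<epsilon> ^ p * poly (B p) (of_real t)))
       \<le> e * (\<epsilon> ^ r * (1 + \<bar>t\<bar>) ^ m * exp (\<sigma>2 / 4 * t\<^sup>2))" by blast
    have "\<forall>\<^sub>F t in nhds 0. (\<forall>N\<ge>1. cmod (\<phi> N t - \<mu> t ^ N * Z t) \<le> C * \<kappa> ^ N) \<and>
       \<mu> t = exp (\<i> * of_real (A * t) + of_real (t\<^sup>2) * (k t - of_real (\<sigma>2 / 2)))"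
      using appr' \<mu>k by (rule eventually_conj)
    then obtain d2 where d2: "d2 > 0" and near2: "\<And>t. \<bar>t\<bar> < d2 \<Longrightarrow> (\<forall>N\<ge>1. cmod (\<phi> N t - \<mu> t ^ N * Z t) \<le> C * \<kappa> ^ N) \<and>
       \<mu> t = exp (\<i> * of_real (A * t) + of_real (t\<^sup>2) * (k t - of_real (\<sigma>2 / 2)))"
      unfolding eventually_nhds_metric dist_real_def by auto
    have "(\<lambda>N. C * (real N powr ((real r + 1) / 2) * \<kappa> ^ N)) \<longlonglongrightarrow> C * 0"
      by (intro tendsto_mult tendsto_const powr_times_power_tendsto_0 \<kappa>)
    then have \<rho>: "(\<lambda>N. real N powr ((real r + 1) / 2) * (C * \<kappa> ^ N)) \<longlonglongrightarrow> 0" by (simp add: mult.left_commute)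
    have "(\<lambda>N. 1 / sqrt (real N)) \<longlonglongrightarrow> 0" by real_asymp
    then have "\<forall>\<^sub>F N in sequentially. 1 / sqrt (real N) < d1" using d1 by (rule order_tendstoD(2))
    then have "\<forall>\<^sub>F N in sequentially. \<forall>t. \<bar>t\<bar> < min d1 d2 \<longrightarrow> cmod (char_defect M (\<lambda>w. S N w - real N * A) r \<sigma>2 B N t)
        \<le> e * (real N powr (- real r / 2) * ((1 + \<bar>t * sqrt (real N)\<bar>) ^ m * exp (- (\<sigma>2 / 4) * (t * sqrt (real N))\<^sup>2))) + C * \<kappa> ^ N"
      using eventually_ge_at_top[of 1]
    proof eventually_elim
      case (elim N)
      show ?case
      proof (intro allI impI)
        fix t :: real assume t: "\<bar>t\<bar> < min d1 d2"
        \<comment> \<open>Scaled frequency and small parameter: \<open>s * \<epsilon> = t\<close>,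
          so \<open>\<bar>t\<bar> < d1\<close> is the smallness that the expansion needs, even for
          large \<open>s\<close>.\<close>
        define s where "s = t * sqrt (real N)"
        define \<epsilon> where "\<epsilon> = 1 / sqrt (real N)"
        have N: "N \<ge> 1" using elim by simp
        have s\<epsilon>: "s * \<epsilon> = t" using N by (simp add: s_def \<epsilon>_def)
        have s2: "s\<^sup>2 = real N * t\<^sup>2" by (simp add: s_def power_mult_distrib mult.commute)
        let ?g = "complex_of_real (exp (- (\<sigma>2 * s\<^sup>2) / 2))"
        let ?P = "\<Sum>p\<le>r. of_real \<epsilon> ^ p * poly (B p) (of_real s)"
        have sum: "(\<Sum>p\<le>r. of_real (1 / real N powr (real p / 2)) * edgeworth_term \<sigma>2 (B p) s) = ?g * ?P"
        proof -
          have "of_real (1 / real N powr (real p / 2)) = complex_of_real \<epsilon> ^ p" for p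
            by (simp only: \<epsilon>_def of_real_power[symmetric] sqrt_inverse_power_eq(1)[OF N])
          then show ?thesis by (simp add: edgeworth_term_def sum_distrib_left sum_distrib_right mult_ac)
        qed
        have \<mu>N: "\<mu> t ^ N * cis (- (t * real N * A)) = ?g * exp (of_real (s\<^sup>2) * k t)"
        proof -
          have "\<mu> t = exp (\<i> * of_real (A * t) + of_real (t\<^sup>2) * (k t - of_real (\<sigma>2 / 2)))" using near2 t by simp
          then have "\<mu> t ^ N * cis (- (t * real N * A))
             = exp (of_nat N * (\<i> * of_real (A * t) + of_real (t\<^sup>2) * (k t - of_real (\<sigma>2 / 2))) + \<i> * of_real (- (t * real N * A)))"
            by (simp only: exp_of_nat_mult cis_conv_exp exp_add)
          also have "of_nat N * (\<i> * of_real (A * t) + of_real (t\<^sup>2) * (k t - of_real (\<sigma>2 / 2))) + \<i> * of_real (- (t * real N * A))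
             = of_real (- (\<sigma>2 * s\<^sup>2) / 2) + of_real (s\<^sup>2) * k t"
            unfolding s2 by (simp add: algebra_simps)
          finally show ?thesis by (simp only: exp_add exp_of_real)
        qed
        \<comment> \<open>Two errors: replacing the characteristic function by the eigenvalue term,
          which is exponentially small in \<open>N\<close>, and expanding the eigenvalue
          term.\<close>
        have "char_defect M (\<lambda>w. S N w - real N * A) r \<sigma>2 B N t
          = (\<phi> N t - \<mu> t ^ N * Z t) * cis (- (t * real N * A)) + (\<mu> t ^ N * cis (- (t * real N * A)) * Z t - ?g * ?P)"
          unfolding char_defect_def \<psi> sum[unfolded s_def] by (simp add: s_def algebra_simps)
        also have "\<dots> = (\<phi> N t - \<mu> t ^ N * Z t) * cis (- (t * real N * A)) + ?g * (exp (of_real (s\<^sup>2) * k (s * \<epsilon>)) * Z (s * \<epsilon>) - ?P)"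
          unfolding \<mu>N s\<epsilon> by (simp add: algebra_simps)
        finally have "cmod (char_defect M (\<lambda>w. S N w - real N * A) r \<sigma>2 B N t)
          \<le> cmod ((\<phi> N t - \<mu> t ^ N * Z t) * cis (- (t * real N * A))) + cmod (?g * (exp (of_real (s\<^sup>2) * k (s * \<epsilon>)) * Z (s * \<epsilon>) - ?P))"
          by (simp only: norm_triangle_ineq)
        also have "\<dots> \<le> C * \<kappa> ^ N + exp (- (\<sigma>2 * s\<^sup>2) / 2) * (e * (\<epsilon> ^ r * (1 + \<bar>s\<bar>) ^ m * exp (\<sigma>2 / 4 * s\<^sup>2)))"
        proof (rule add_mono)
          show "cmod ((\<phi> N t - \<mu> t ^ N * Z t) * cis (- (t * real N * A))) \<le> C * \<kappa> ^ N"
          proof -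
            have "cmod (\<phi> N t - \<mu> t ^ N * Z t) \<le> C * \<kappa> ^ N" using near2[of t] t N by auto
            then show ?thesis by (simp add: norm_mult)
          qed
          have "cmod (exp (of_real (s\<^sup>2) * k (s * \<epsilon>)) * Z (s * \<epsilon>) - ?P) \<le> e * (\<epsilon> ^ r * (1 + \<bar>s\<bar>) ^ m * exp (\<sigma>2 / 4 * s\<^sup>2))"
            by (rule B1) (use N elim t s\<epsilon> in \<open>auto simp: \<epsilon>_def\<close>)
          then show "cmod (?g * (exp (of_real (s\<^sup>2) * k (s * \<epsilon>)) * Z (s * \<epsilon>) - ?P))
             \<le> exp (- (\<sigma>2 * s\<^sup>2) / 2) * (e * (\<epsilon> ^ r * (1 + \<bar>s\<bar>) ^ m * exp (\<sigma>2 / 4 * s\<^sup>2)))"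
            unfolding norm_mult by (intro mult_mono) auto
        qed
        also have "exp (- (\<sigma>2 * s\<^sup>2) / 2) * (e * (\<epsilon> ^ r * (1 + \<bar>s\<bar>) ^ m * exp (\<sigma>2 / 4 * s\<^sup>2)))
           = e * (\<epsilon> ^ r * ((1 + \<bar>s\<bar>) ^ m * (exp (- (\<sigma>2 * s\<^sup>2) / 2) * exp (\<sigma>2 / 4 * s\<^sup>2))))" by (simp only: mult_ac)
        also have "exp (- (\<sigma>2 * s\<^sup>2) / 2) * exp (\<sigma>2 / 4 * s\<^sup>2) = exp (- (\<sigma>2 / 4) * s\<^sup>2)"
          by (simp flip: exp_add)
        also have "\<epsilon> ^ r = real N powr (- real r / 2)" unfolding \<epsilon>_def by (rule sqrt_inverse_power_eq(2)[OF N])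
        finally show "cmod (char_defect M (\<lambda>w. S N w - real N * A) r \<sigma>2 B N t)
          \<le> e * (real N powr (- real r / 2) * ((1 + \<bar>t * sqrt (real N)\<bar>) ^ m * exp (- (\<sigma>2 / 4) * (t * sqrt (real N))\<^sup>2))) + C * \<kappa> ^ N"
          unfolding s_def by simp
      qed
    qed
    with \<rho> show ?thesis using d1 d2 by (intro exI[of _ "min d1 d2"]) auto
  qed
  have far: "\<exists>T \<rho>. (\<lambda>N. real N powr ((real r + 1) / 2) * \<rho> N) \<longlonglongrightarrow> 0 \<and>
      (\<forall>\<^sub>F N in sequentially. T N \<ge> 1 \<and> 1 / T N ^ q \<le> \<rho> N \<and>
        (\<forall>t. d \<le> \<bar>t\<bar> \<longrightarrow> \<bar>t\<bar> < T N \<longrightarrow> cmod (LINT w|M. cis (t * (S N w - real N * A))) \<le> \<rho> N))"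
    if d: "d > 0" for d
  proof -
    let ?a = "(real r + 1) / 2"
    obtain K r2 N0 where K: "K > 0" "r2 > 0" "N0 > 0" and
      A4': "\<And>N t. real N > N0 \<Longrightarrow> K \<le> \<bar>t\<bar> \<Longrightarrow> \<bar>t\<bar> \<le> real N powr r1 \<Longrightarrow> norm (opow (L t) N) \<le> real N powr (- r2)"
      using A4 by blast
    \<comment> \<open>The number of pieces: however small \<open>r2\<close> is, \<open>n\<close>
      pieces give the exponent \<open>r2 * real n\<close>, which must exceed
      \<open>(r + 1) / 2\<close>.\<close>
    obtain n :: nat where n: "n \<ge> 1" "?a < r2 * real n"
    proof -
      obtain n :: nat where n: "?a / r2 < real n" using reals_Archimedean2 by blast
      have "?a / r2 > 0" using K by simp
      then have "real n > 0" using n by linarith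
      moreover have "?a < r2 * real n" using n K by (simp only: pos_divide_less_eq mult.commute)
      ultimately show thesis by (intro that[of n]) auto
    qed
    \<comment> \<open>The lower bound on \<open>q\<close> enters here: beyond the cut-off the
      transform gains the factor \<open>1 / T N ^ q\<close>, of order N^(-r1 q).\<close>
    have rq: "?a < r1 * real q" using q_big r1_pos by (simp add: field_simps)
    \<comment> \<open>The bounded frequencies: this compact set stays away from 0, so (A3) holds on
      all of it.\<close>
    have "\<exists>C2 \<kappa>2. 0 < C2 \<and> 0 < \<kappa>2 \<and> \<kappa>2 < 1 \<and>
      (\<forall>t\<in>{-K..-d} \<union> {d..K}. \<forall>N. norm (Abs_endo (L t) ^ N) \<le> C2 * \<kappa>2 ^ N)"
    proof (rule compact_uniform_decay)
      show "continuous_on UNIV (\<lambda>t. Abs_endo (L t))" by (rule continuous_on_Abs_endo[OF A1_cont])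
      show "compact ({-K..-d} \<union> {d..K})" by (intro compact_Un compact_Icc)
      fix t assume "t \<in> {-K..-d} \<union> {d..K}"
      then have "t \<noteq> 0" using d by auto
      then show "(\<lambda>n. Abs_endo (L t) ^ n) \<longlonglongrightarrow> 0" by (intro powers_tendsto_zero_of_spectrum lin_L A3)
    qed
    then obtain C2 \<kappa>2 where C2: "0 < C2" "0 < \<kappa>2" "\<kappa>2 < 1" and
      dec: "\<And>t N. t \<in> {-K..-d} \<union> {d..K} \<Longrightarrow> norm (opow (L t) N) \<le> C2 * \<kappa>2 ^ N"
      by (auto simp flip: Abs_endo_opow)
    define c where "c = norm l * norm v"
    have c: "c \<ge> 0" by (simp add: c_def)
    define \<rho> where "\<rho> N = c * C2 * \<kappa>2 ^ N + c * real (N div n) powr (- (r2 * real n)) + real (N div n) powr (- (r1 * real q))" for N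
    \<comment> \<open>The cut-off is a power of the piece length \<open>N div n\<close>, not of
      \<open>N\<close>, because (A4) is applied to the pieces.\<close>
    define T where "T N = real (N div n) powr r1" for N
    have "(\<lambda>N. c * C2 * (real N powr ?a * \<kappa>2 ^ N) + c * (real N powr ?a * real (N div n) powr (- (r2 * real n)))
        + real N powr ?a * real (N div n) powr (- (r1 * real q))) \<longlonglongrightarrow> c * C2 * 0 + c * 0 + 0"
      by (intro tendsto_add tendsto_mult tendsto_const powr_times_power_tendsto_0 powr_times_div_powr_tendsto_0 C2 n rq) auto
    then have \<rho>lim: "(\<lambda>N. real N powr ?a * \<rho> N) \<longlonglongrightarrow> 0" by (simp add: \<rho>_def algebra_simps)
    have "\<forall>\<^sub>F N in sequentially. T N \<ge> 1 \<and> 1 / T N ^ q \<le> \<rho> N \<and>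
        (\<forall>t. d \<le> \<bar>t\<bar> \<longrightarrow> \<bar>t\<bar> < T N \<longrightarrow> cmod (LINT w|M. cis (t * (S N w - real N * A))) \<le> \<rho> N)"
      \<comment> \<open>Ensures that the piece length is at least 1 and exceeds
        \<open>N0\<close>.\<close>
      using eventually_ge_at_top[of "n * (nat \<lceil>N0\<rceil> + 1)"]
    proof eventually_elim
      case (elim N)
      have "(n * (nat \<lceil>N0\<rceil> + 1)) div n \<le> N div n" using elim by (rule div_le_mono)
      then have Nn: "nat \<lceil>N0\<rceil> + 1 \<le> N div n" using n by simp
      then have N1: "N div n \<ge> 1" and N0: "real (N div n) > N0" by linarith+
      have N: "N \<ge> 1" using N1 by (cases N) auto
      have T1: "T N \<ge> 1" unfolding T_def using N1 r1_pos by (intro ge_one_powr_ge_zero) auto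
      have \<rho>1: "0 \<le> c * C2 * \<kappa>2 ^ N" "0 \<le> c * real (N div n) powr (- (r2 * real n))" using c C2 by auto
      have Tq: "1 / T N ^ q = real (N div n) powr (- (r1 * real q))"
        using N1 by (simp add: T_def powr_minus_divide powr_powr flip: powr_realpow)
      have "cmod (LINT w|M. cis (t * (S N w - real N * A))) \<le> \<rho> N" if t: "d \<le> \<bar>t\<bar>" "\<bar>t\<bar> < T N" for t
      proof -
        have "cmod (LINT w|M. cis (t * (S N w - real N * A))) = cmod (l (opow (L t) N v))"
          by (simp add: \<psi> \<phi>L[OF N] norm_mult)
        also have "\<dots> \<le> norm l * (norm (opow (L t) N) * norm v)"
          by (rule order_trans[OF norm_blinfun]) (intro mult_left_mono norm_blinfun norm_ge_zero)
        also have "\<dots> = c * norm (opow (L t) N)" by (simp add: c_def)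
        finally have 1: "cmod (LINT w|M. cis (t * (S N w - real N * A))) \<le> c * norm (opow (L t) N)" .
        show ?thesis
        proof (cases "\<bar>t\<bar> \<le> K")
          case True
          then have "norm (opow (L t) N) \<le> C2 * \<kappa>2 ^ N" using t d by (intro dec) auto
          then have "c * norm (opow (L t) N) \<le> c * (C2 * \<kappa>2 ^ N)" using c by (rule mult_left_mono)
          then show ?thesis
            using 1 \<rho>1(2) powr_ge_zero[of "real (N div n)" "- (r1 * real q)"]
            unfolding \<rho>_def mult.assoc by linarith
        next
          case False
          have "norm (Abs_endo (L t) ^ N) \<le> (real (N div n) powr (- r2)) ^ n"
          proof (rule norm_power_le_of_pieces[OF n(1)])
            fix j assume "j = N div n \<or> j = Suc (N div n)"
            then have j: "real (N div n) \<le> real j" by auto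
            have "\<bar>t\<bar> \<le> real j powr r1"
              using t(2) j r1_pos powr_mono2[of r1 "real (N div n)" "real j"] by (simp add: T_def)
            then have "norm (opow (L t) j) \<le> real j powr (- r2)" using False N0 j by (intro A4') auto
            also have "\<dots> \<le> real (N div n) powr (- r2)" using K N1 j by (intro powr_mono2') auto
            finally show "norm (Abs_endo (L t) ^ j) \<le> real (N div n) powr (- r2)" by (simp flip: Abs_endo_opow)
          qed simp
          also have "(real (N div n) powr (- r2)) ^ n = real (N div n) powr (- (r2 * real n))"
            using N1 by (simp add: powr_powr flip: powr_realpow)
          finally have "c * norm (opow (L t) N) \<le> c * real (N div n) powr (- (r2 * real n))"
            using c by (intro mult_left_mono) (simp flip: Abs_endo_opow)
          then show ?thesis using 1 \<rho>1(1) unfolding \<rho>_def by (smt (verit) powr_ge_zero)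
        qed
      qed
      then show ?case using T1 Tq \<rho>1 by (simp add: \<rho>_def)
    qed
    with \<rho>lim show ?thesis by blast
  qed
  have "(\<lambda>w. S N w - real N * A) \<in> borel_measurable M" for N by measurable
  from weak_edgeworth_of_char_bounds[OF prob this sigma_pos near far, of 0] show ?thesis
    unfolding S_def .
qed

end
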